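(* Let $T$ be a real, non-singular matrix transformation of the torus $\mathbb{T}^d$. Suppose that $T$ is diagonal with all eigenvalues $\beta_1,\beta_2,\dots,\beta_d$ strictly larger than $1$. Assume that $1<\beta_1\le\beta_2\le\cdots\le\beta_d$. For $1\le i\le d$, let $\psi_i:\mathbb{R}^+\to\mathbb{R}^+$ be a real positive function, put $\Psi=(\psi_1,\dots,\psi_d)$, and let $\mathbf{a}\in\mathbb{T}^d$. Assume that the set $\mathcal{U}(\Psi)$ of accumulation points of the sequence $\big\{\big(-\frac{\log\psi_1(n)}n,\dots,-\frac{\log\psi_d(n)}n\big)\big\}_{n\ge1}$ is contained in $[0,\infty]^d$ and is bounded. Then $$\dim_{\rm H}W(T,\Psi,\mathbf{a})=\sup_{\mathbf{t}\in\mathcal{U}(\Psi)}\min_{1\le i\le d}\{\theta_i(\mathbf{t})\},$$ where, for $\mathbf{t}=(t_1,\dots,t_d)$, $$\theta_i(\mathbf{t}):=\sum_{k\in\mathcal{K}_1(i)}1+\sum_{k\in\mathcal{K}_2(i)}\left(1-\frac{t_k}{\log\beta_i+t_i}\right)+\sum_{k\in\mathcal{K}_3(i)}\frac{\log\beta_k}{\log\beta_i+t_i}$$ and, in turn, $$\mathcal{K}_1(i):=\{1\le k\le d:\log\beta_k>\log\beta_i+t_i\},\quad \mathcal{K}_2(i):=\{1\le k\le d:\log\beta_k+t_k\le\log\beta_i+t_i\},$$ $$\mathcal{K}_3(i):=\{1,\dots,d\}\setminus(\mathcal{K}_1(i)\cup\mathcal{K}_2(i)).$$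
   Context: Matrix transformation: a real $d\times d$ matrix $T$ determines a self-map of $\mathbb{T}^d=\mathbb{R}^d/\mathbb{Z}^d$ (identified with $[0,1)^d$), also denoted $T$, sending $\mathbf{x}\in[0,1)^d$ to $T\mathbf{x}$ modulo one. $T^n$ denotes the $n$-th iterate of this map (not the matrix power). $\|\cdot\|$ is the distance to the nearest integer. For $\mathbf{a}=(a_1,\dots,a_d)$ and $\Psi(n)=(\psi_1(n),\dots,\psi_d(n))$ let $$R(\mathbf{a},\Psi(n)):=\{\mathbf{x}\in\mathbb{T}^d:\|x_i-a_i\|\le\psi_i(n)\ (1\le i\le d)\},$$ $$W(T,\Psi,\mathbf{a}):=\{\mathbf{x}\in\mathbb{T}^d:T^n(\mathbf{x})\in R(\mathbf{a},\Psi(n))\text{ for infinitely many }n\in\mathbb{N}\}.$$ Accumulation points are taken in the extended sense (coordinates may be infinite); that $\mathcal{U}(\Psi)$ is bounded means that it is a bounded subset of $\mathbb{R}^d$, in particular that no accumulation point has an infinite coordinate. $\dim_{\rm H}$ is Hausdorff dimension. *)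

theory Defs
  imports "HOL-Analysis.Analysis"
begin

(* For s = 0 the contribution of a nonempty set is 1; in Isabelle 0 powr 0 = 0, so this
   case has to be separated. *)
definition diam_power :: "real \<Rightarrow> 'a::metric_space set \<Rightarrow> real" where
  "diam_power s U = (if U = {} then 0 else if s = 0 then 1 else diameter U powr s)"

(* The library's diameter is only meaningful for bounded sets, hence the explicit
   boundedness of the covering sets. *)
definition hausdorff_premeasure :: "real \<Rightarrow> real \<Rightarrow> 'a::metric_space set \<Rightarrow> ennreal" where
  "hausdorff_premeasure s \<delta> A =
     (INF U \<in> {U :: nat \<Rightarrow> 'a set. A \<subseteq> (\<Union>n. U n) \<and> (\<forall>n. bounded (U n) \<and> diameter (U n) \<le> \<delta>)}.
        \<Sum>n. ennreal (diam_power s (U n)))"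

definition hausdorff_measure :: "real \<Rightarrow> 'a::metric_space set \<Rightarrow> ennreal" where
  "hausdorff_measure s A = (SUP \<delta> \<in> {0<..}. hausdorff_premeasure s \<delta> A)"

definition hausdorff_dim :: "'a::metric_space set \<Rightarrow> ereal" where
  "hausdorff_dim A = (INF s \<in> {s. 0 \<le> s \<and> hausdorff_measure s A = 0}. ereal s)"

definition dist_int :: "real \<Rightarrow> real" where
  "dist_int x = infdist x \<int>"

lemma dist_int_le: "n \<in> \<int> \<Longrightarrow> dist_int x \<le> \<bar>x - n\<bar>"
  unfolding dist_int_def using infdist_le[of n "\<int>" x] by (simp add: dist_real_def)

lemma dist_int_nonneg [simp]: "0 \<le> dist_int x"
  by (simp add: dist_int_def infdist_nonneg)

lemma dist_int_attained: "\<exists>n\<in>\<int>. dist_int x = \<bar>x - n\<bar>"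
proof -
  have "closed (\<int> :: real set)" by simp
  moreover have "(\<int> :: real set) \<noteq> {}" using Ints_0 by blast
  ultimately obtain n where "n \<in> (\<int> :: real set)" "infdist x \<int> = dist x n"
    using infdist_attains_inf by blast
  thus ?thesis unfolding dist_int_def dist_real_def by blast
qed

lemma dist_int_minus [simp]: "dist_int (- x) = dist_int x"
proof (rule antisym)
  have *: "dist_int (- y) \<le> dist_int y" for y
  proof -
    obtain n where "n \<in> \<int>" "dist_int y = \<bar>y - n\<bar>" using dist_int_attained by blast
    thus ?thesis using dist_int_le[of "- n" "- y"] by simp
  qed
  show "dist_int (- x) \<le> dist_int x" by (rule *)
  show "dist_int x \<le> dist_int (- x)" using *[of "- x"] by simp
qed

lemma dist_int_add: "dist_int (x + y) \<le> dist_int x + dist_int y"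
proof -
  obtain m where m: "m \<in> \<int>" "dist_int x = \<bar>x - m\<bar>" using dist_int_attained by blast
  obtain n where n: "n \<in> \<int>" "dist_int y = \<bar>y - n\<bar>" using dist_int_attained by blast
  have "dist_int (x + y) \<le> \<bar>x + y - (m + n)\<bar>" using m n by (intro dist_int_le) auto
  thus ?thesis using m n by linarith
qed

lemma dist_int_eq_0_iff: "dist_int x = 0 \<longleftrightarrow> x \<in> \<int>"
proof
  assume "dist_int x = 0"
  thus "x \<in> \<int>" using dist_int_attained[of x] by auto
next
  assume "x \<in> \<int>"
  thus "dist_int x = 0" using dist_int_le[of x x] dist_int_nonneg[of x] by simp
qed

typedef ('d::finite) torus = "{x :: real ^ 'd. \<forall>i. 0 \<le> x $ i \<and> x $ i < 1}"
  by (rule exI[of _ 0]) simp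

(* The canonical projection of R^d onto R^d / Z^d. *)
definition torus_of :: "real ^ 'd \<Rightarrow> ('d::finite) torus" where
  "torus_of v = Abs_torus (\<chi> i. frac (v $ i))"

(* The metric is the quotient of the Euclidean metric: minimising the Euclidean distance over
   translates by Z^d can be done in each coordinate separately. *)
instantiation torus :: (finite) metric_space
begin

definition dist_torus :: "'a torus \<Rightarrow> 'a torus \<Rightarrow> real" where
  "dist_torus x y = L2_set (\<lambda>i. dist_int (Rep_torus x $ i - Rep_torus y $ i)) UNIV"

definition uniformity_torus :: "('a torus \<times> 'a torus) filter" where
  "uniformity_torus = (INF e\<in>{0<..}. principal {(x, y). dist x y < e})"

definition open_torus :: "'a torus set \<Rightarrow> bool" where
  "open_torus U \<longleftrightarrow> (\<forall>x\<in>U. \<forall>\<^sub>F (x', y) in uniformity. x' = x \<longrightarrow> y \<in> U)"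

instance
proof
  fix x y z :: "'a torus"
  have "x = y" if "dist x y = 0"
  proof -
    have "Rep_torus x $ i = Rep_torus y $ i" for i
    proof -
      have "dist_int (Rep_torus x $ i - Rep_torus y $ i) = 0"
        using that by (simp add: dist_torus_def L2_set_eq_0_iff)
      then obtain n :: int where n: "Rep_torus x $ i - Rep_torus y $ i = of_int n"
        by (auto simp: dist_int_eq_0_iff elim: Ints_cases)
      have "\<bar>Rep_torus x $ i - Rep_torus y $ i\<bar> < 1"
        using Rep_torus[of x] Rep_torus[of y] by (auto simp: abs_less_iff) (smt (verit))+
      hence "n = 0" using n by linarith
      thus ?thesis using n by simp
    qed
    thus ?thesis by (simp add: Rep_torus_inject[symmetric] vec_eq_iff)
  qed
  moreover have "dist x x = 0"
    by (simp add: dist_torus_def L2_set_eq_0_iff dist_int_eq_0_iff)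
  ultimately show "dist x y = 0 \<longleftrightarrow> x = y" by auto
  have "dist x y \<le> L2_set (\<lambda>i. dist_int (Rep_torus x $ i - Rep_torus z $ i)
                            + dist_int (Rep_torus y $ i - Rep_torus z $ i)) UNIV"
    unfolding dist_torus_def
  proof (rule L2_set_mono)
    fix i
    have "dist_int ((Rep_torus x $ i - Rep_torus z $ i) + - (Rep_torus y $ i - Rep_torus z $ i))
            \<le> dist_int (Rep_torus x $ i - Rep_torus z $ i)
              + dist_int (- (Rep_torus y $ i - Rep_torus z $ i))"
      by (rule dist_int_add)
    thus "dist_int (Rep_torus x $ i - Rep_torus y $ i)
            \<le> dist_int (Rep_torus x $ i - Rep_torus z $ i)
              + dist_int (Rep_torus y $ i - Rep_torus z $ i)"
      unfolding dist_int_minus by simp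
  qed simp
  also have "\<dots> \<le> dist x z + dist y z"
    unfolding dist_torus_def by (rule L2_set_triangle_ineq)
  finally show "dist x y \<le> dist x z + dist y z" .
qed (simp_all only: uniformity_torus_def open_torus_def)

end

definition torus_map :: "real ^ 'd ^ 'd \<Rightarrow> ('d::finite) torus \<Rightarrow> 'd torus" where
  "torus_map T x = torus_of (T *v Rep_torus x)"

definition target_rect :: "('d::finite) torus \<Rightarrow> ('d \<Rightarrow> real) \<Rightarrow> 'd torus set" where
  "target_rect a r = {x. \<forall>i. dist_int (Rep_torus x $ i - Rep_torus a $ i) \<le> r i}"

definition shrinking_target_set ::
    "real ^ 'd ^ 'd \<Rightarrow> ('d \<Rightarrow> real \<Rightarrow> real) \<Rightarrow> ('d::finite) torus \<Rightarrow> 'd torus set" where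
  "shrinking_target_set T \<psi> a =
     {x. \<exists>\<^sub>\<infinity>n. (torus_map T ^^ n) x \<in> target_rect a (\<lambda>i. \<psi> i (real n))}"

definition accumulation_points :: "(nat \<Rightarrow> 'a::topological_space) \<Rightarrow> 'a set" where
  "accumulation_points u = {l. \<forall>S. open S \<longrightarrow> l \<in> S \<longrightarrow> (\<exists>\<^sub>\<infinity>n. u n \<in> S)}"

definition ereal_vec :: "real ^ 'd \<Rightarrow> ereal ^ ('d::finite)" where
  "ereal_vec x = (\<chi> i. ereal (x $ i))"

(* The (meaningless) term with n = 0 does not affect the accumulation points. *)
definition exponent_set :: "('d::finite \<Rightarrow> real \<Rightarrow> real) \<Rightarrow> (ereal ^ 'd) set" where
  "exponent_set \<psi> =
     accumulation_points (\<lambda>n. ereal_vec (\<chi> i. - ln (\<psi> i (real n)) / real n))"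

definition K1 :: "('d::finite \<Rightarrow> real) \<Rightarrow> real ^ 'd \<Rightarrow> 'd \<Rightarrow> 'd set" where
  "K1 \<beta> t i = {k. ln (\<beta> k) > ln (\<beta> i) + t $ i}"

definition K2 :: "('d::finite \<Rightarrow> real) \<Rightarrow> real ^ 'd \<Rightarrow> 'd \<Rightarrow> 'd set" where
  "K2 \<beta> t i = {k. ln (\<beta> k) + t $ k \<le> ln (\<beta> i) + t $ i}"

definition K3 :: "('d::finite \<Rightarrow> real) \<Rightarrow> real ^ 'd \<Rightarrow> 'd \<Rightarrow> 'd set" where
  "K3 \<beta> t i = UNIV - (K1 \<beta> t i \<union> K2 \<beta> t i)"

definition theta :: "('d::finite \<Rightarrow> real) \<Rightarrow> real ^ 'd \<Rightarrow> 'd \<Rightarrow> real" where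
  "theta \<beta> t i =
     (\<Sum>k\<in>K1 \<beta> t i. 1)
     + (\<Sum>k\<in>K2 \<beta> t i. 1 - t $ k / (ln (\<beta> i) + t $ i))
     + (\<Sum>k\<in>K3 \<beta> t i. ln (\<beta> k) / (ln (\<beta> i) + t $ i))"

end

(* Both bounds come from one count. Under the n-th iterate of x |-> b x mod 1, the preimage of an
   interval of radius exp (- n t) consists of about b^n intervals of length exp (- n t) / b^n, so at
   scale exp (- n L) it is covered by about exp (n * min L (max (ln b) (L - t))) intervals. Summing
   this exponent over the coordinates and dividing by L gives a function of L whose infimum is
   attained at one of the values L = ln (beta i) + t i, where it equals theta_i.
   Upper bound: cover the n-th target preimage at the best of these scales.
   Lower bound: along a very sparse sequence of times n, the limsup set contains a product of
   one-dimensional Cantor sets for which the count above is sharp at every scale.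
   For non-integer b the cylinders of the map are not all full; the substitute is that every window
   of length (l + 5) / b^l contains a full cylinder of order l. *)

theory Submission
  imports Defs "HOL-Real_Asymp.Real_Asymp"
begin

section \<open>Full cylinders of beta transformations\<close>

text \<open>A ball has one radius in all coordinates, while the cells of a given level have a
  different length in each. Counts at the natural scales of a single coordinate are therefore not
  enough: the one-dimensional bounds must hold for every radius, and only their product is compared
  with \<open>r powr s\<close>. All cells of a level carry the same pattern of descendants, so the
  proportion of cell corners serves as mass and no measure is constructed. Full cylinders are only
  guaranteed in windows longer than themselves by a factor linear in their order, so no count is
  sharp up to a constant. Such losses are paid from strict inequalities: a target of exponent
  \<open>\<tau>\<close> is filled by a cylinder of exponent \<open>\<sigma> > \<tau>\<close>, and
  the dimension exponent \<open>s\<close> stays strictly below the minimum of the theta_i. At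
  comparatively large radii this margin is too small for polynomial losses; there a second count,
  linear in the radius and free of them, takes over.\<close>

definition beta_map :: "real \<Rightarrow> real \<Rightarrow> real" where
  "beta_map b x = frac (b * x)"

text \<open>On a cylinder of order \<open>n\<close> the \<open>n\<close>-th iterate is affine with
  slope \<open>b ^ n\<close>. Following this line back from \<open>x\<close> to its zero gives the
  left endpoint of the cylinder of \<open>x\<close>, so the partition itself never has to be
  built.\<close>

definition cyl_left :: "real \<Rightarrow> nat \<Rightarrow> real \<Rightarrow> real" where
  "cyl_left b n x = x - (beta_map b ^^ n) x / b ^ n"

definition full_cyl :: "real \<Rightarrow> nat \<Rightarrow> real set" where
  "full_cyl b n = {v. 0 \<le> v \<and> v + 1 / b ^ n \<le> 1 \<and>
     (\<forall>x. v \<le> x \<and> x < v + 1 / b ^ n \<longrightarrow> (beta_map b ^^ n) x = b ^ n * (x - v))}"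

lemma beta_map_range: "0 \<le> beta_map b x" "beta_map b x < 1"
  by (auto simp: beta_map_def frac_lt_1)

lemma beta_map_funpow_range:
  assumes "0 \<le> x" "x < 1"
  shows "0 \<le> (beta_map b ^^ n) x" "(beta_map b ^^ n) x < 1"
  using assms by (cases n; simp add: beta_map_range)+

lemma cyl_left_0 [simp]: "cyl_left b 0 x = 0"
  by (simp add: cyl_left_def)

lemma cyl_left_Suc:
  fixes b :: real and n :: nat
  assumes "b > 1"
  shows "cyl_left b (Suc n) x = cyl_left b n x + of_int \<lfloor>b * (beta_map b ^^ n) x\<rfloor> / b ^ Suc n"
  using assms by (simp add: cyl_left_def beta_map_def frac_def field_simps)

lemma beta_map_funpow_eq:
  fixes b :: real and n :: nat
  assumes "b > 1"
  shows "(beta_map b ^^ n) x = b ^ n * (x - cyl_left b n x)"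
  using assms by (simp add: cyl_left_def)

lemma cyl_left_le:
  assumes "b > 1" "0 \<le> x" "x < 1"
  shows "cyl_left b n x \<le> x" "x < cyl_left b n x + 1 / b ^ n"
proof -
  have "b ^ n > 0" using assms by simp
  then show "cyl_left b n x \<le> x" "x < cyl_left b n x + 1 / b ^ n"
    using beta_map_funpow_range[OF assms(2,3), of n b]
    using assms(1) by (auto simp: cyl_left_def divide_simps)
qed

lemma cyl_left_Suc_ge:
  assumes "b > 1" "0 \<le> x" "x < 1"
  shows "cyl_left b n x \<le> cyl_left b (Suc n) x"
  using assms beta_map_funpow_range[OF assms(2,3), of n b] by (simp add: cyl_left_Suc)

lemma cyl_left_nonneg:
  assumes "b > 1" "0 \<le> x" "x < 1"
  shows "0 \<le> cyl_left b n x"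
proof (induction n)
  case (Suc n)
  then show ?case using cyl_left_Suc_ge[OF assms, of n] by linarith
qed simp

text \<open>Going one order deeper, \<open>y\<close> keeps the next digit of \<open>x\<close>:
  monotonicity on the common cylinder bounds its digit from above, and \<open>y\<close> not being
  left of the next left endpoint bounds it from below.\<close>

lemma cyl_left_convex:
  assumes b: "b > 1" and x: "0 \<le> x" "x < 1"
    and y: "cyl_left b n x \<le> y" "y \<le> x"
  shows "cyl_left b n y = cyl_left b n x"
  using y
proof (induction n)
  case (Suc n)
  have IH: "cyl_left b n y = cyl_left b n x"
    using Suc cyl_left_Suc_ge[OF b x, of n] by linarith
  let ?d = "\<lfloor>b * (beta_map b ^^ n) x\<rfloor>"
  have y1: "b * (beta_map b ^^ n) y = b ^ Suc n * (y - cyl_left b n x)"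
    using beta_map_funpow_eq[OF b, of n y] IH by simp
  have x1: "b * (beta_map b ^^ n) x = b ^ Suc n * (x - cyl_left b n x)"
    using beta_map_funpow_eq[OF b, of n x] by simp
  have pos: "b ^ Suc n > 0" using b by simp
  have "of_int ?d / b ^ Suc n \<le> y - cyl_left b n x"
    using Suc.prems(1) cyl_left_Suc[OF b, of n x] by linarith
  then have "of_int ?d \<le> b * (beta_map b ^^ n) y"
    unfolding y1 using pos by (simp add: divide_le_eq mult.commute)
  moreover have "b * (beta_map b ^^ n) y \<le> b * (beta_map b ^^ n) x"
    unfolding y1 x1 using pos Suc.prems(2) by (intro mult_left_mono) auto
  ultimately have "\<lfloor>b * (beta_map b ^^ n) y\<rfloor> = ?d"
    by linarith
  then show ?case using IH by (simp add: cyl_left_Suc[OF b])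
qed simp

lemma cyl_left_mono:
  assumes b: "b > 1" and "0 \<le> x" "x \<le> y" "y < 1"
  shows "cyl_left b n x \<le> cyl_left b n y"
proof (rule ccontr)
  assume *: "\<not> ?thesis"
  have "cyl_left b n x = cyl_left b n y"
    using cyl_left_convex[OF b, of y n x] cyl_left_le(1)[OF b, of x n] assms * by auto
  with * show False by simp
qed

lemma full_cyl_cyl_left:
  assumes "b > 1" "v \<in> full_cyl b n" "v \<le> x" "x < v + 1 / b ^ n"
  shows "cyl_left b n x = v"
  using assms by (simp add: full_cyl_def cyl_left_def)

lemma full_cylI:
  assumes "b > 1" "0 \<le> v" "v + 1 / b ^ n \<le> 1"
    and "\<And>x. v \<le> x \<Longrightarrow> x < v + 1 / b ^ n \<Longrightarrow> cyl_left b n x = v"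
  shows "v \<in> full_cyl b n"
  using assms by (auto simp: full_cyl_def beta_map_funpow_eq)

lemma full_cyl_separated:
  assumes "b > 1" "v \<in> full_cyl b n" "v' \<in> full_cyl b n" "v < v'"
  shows "v + 1 / b ^ n \<le> v'"
proof (rule ccontr)
  assume "\<not> ?thesis"
  then have "cyl_left b n v' = v"
    using assms by (intro full_cyl_cyl_left) auto
  moreover have "cyl_left b n v' = v'"
    using assms by (intro full_cyl_cyl_left) auto
  ultimately show False using assms by simp
qed

text \<open>Fullness of \<open>u\<close> means that the inverse branch sending \<open>y\<close> to
  \<open>u + y / b ^ p\<close> is defined on all of [0, 1); it carries the cylinder at
  \<open>v\<close> onto a cylinder inside the one at \<open>u\<close>. The second claim locates the
  \<open>p\<close>-th iterate, which is how prescribed targets are met.\<close>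

lemma full_cyl_compose:
  assumes b: "b > 1" and u: "u \<in> full_cyl b p" and v: "v \<in> full_cyl b q"
  shows "u + v / b ^ p \<in> full_cyl b (p + q)"
    and "\<And>x. u + v / b ^ p \<le> x \<Longrightarrow> x < u + v / b ^ p + 1 / b ^ (p + q) \<Longrightarrow>
           (beta_map b ^^ p) x = b ^ p * (x - u) \<and> v \<le> (beta_map b ^^ p) x \<and>
           (beta_map b ^^ p) x < v + 1 / b ^ q"
proof -
  have pos: "b ^ p > 0" "b ^ q > 0" using b by auto
  have v0: "0 \<le> v" "v + 1 / b ^ q \<le> 1" using v by (auto simp: full_cyl_def)
  have u0: "0 \<le> u" "u + 1 / b ^ p \<le> 1" using u by (auto simp: full_cyl_def)
  have eq: "v / b ^ p + 1 / b ^ (p + q) = (v + 1 / b ^ q) / b ^ p"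
    using b by (simp add: power_add add_divide_distrib)
  have le: "v / b ^ p + 1 / b ^ (p + q) \<le> 1 / b ^ p"
    unfolding eq using pos v0(2) by (intro divide_right_mono) auto
  have v1: "0 \<le> v / b ^ p" using v0 pos by simp
  have *: "(beta_map b ^^ p) x = b ^ p * (x - u) \<and> v \<le> b ^ p * (x - u) \<and>
      b ^ p * (x - u) < v + 1 / b ^ q"
    if x: "u + v / b ^ p \<le> x" "x < u + v / b ^ p + 1 / b ^ (p + q)" for x
  proof -
    have "u \<le> x" "x < u + 1 / b ^ p" using x le v1 by linarith+
    then have 1: "(beta_map b ^^ p) x = b ^ p * (x - u)" using u by (simp add: full_cyl_def)
    have "v / b ^ p \<le> x - u" using x by linarith
    then have 2: "v \<le> b ^ p * (x - u)" using pos by (simp add: divide_le_eq mult.commute)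
    have "x - u < (v + 1 / b ^ q) / b ^ p" using x eq by linarith
    then have 3: "b ^ p * (x - u) < v + 1 / b ^ q" using pos by (simp add: less_divide_eq mult.commute)
    show ?thesis using 1 2 3 by blast
  qed
  then show "(beta_map b ^^ p) x = b ^ p * (x - u) \<and> v \<le> (beta_map b ^^ p) x \<and>
           (beta_map b ^^ p) x < v + 1 / b ^ q"
    if "u + v / b ^ p \<le> x" "x < u + v / b ^ p + 1 / b ^ (p + q)" for x
    using that by metis
  have "(beta_map b ^^ (p + q)) x = b ^ (p + q) * (x - (u + v / b ^ p))"
    if x: "u + v / b ^ p \<le> x" "x < u + v / b ^ p + 1 / b ^ (p + q)" for x
  proof -
    have "(beta_map b ^^ (p + q)) x = (beta_map b ^^ q) ((beta_map b ^^ p) x)"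
      by (simp add: add.commute[of p] funpow_add)
    also have "\<dots> = b ^ q * (b ^ p * (x - u) - v)"
      using *[OF x] v by (simp add: full_cyl_def)
    also have "\<dots> = b ^ (p + q) * (x - (u + v / b ^ p))"
      using b by (simp add: power_add field_simps)
    finally show ?thesis .
  qed
  then show "u + v / b ^ p \<in> full_cyl b (p + q)"
    using u0 le v1 by (auto simp: full_cyl_def)
qed

lemma zero_in_full_cyl:
  assumes "b > 1"
  shows "0 \<in> full_cyl b n"
proof (induction n)
  case (Suc n)
  have "0 \<in> full_cyl b 1"
  proof -
    have "beta_map b x = b * x" if "0 \<le> x" "x < 1 / b" for x
      using assms that by (simp add: beta_map_def frac_eq field_simps)
    then show ?thesis using assms by (auto simp: full_cyl_def)
  qed
  from full_cyl_compose(1)[OF assms Suc this] show ?case by simp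
qed (simp add: full_cyl_def)

text \<open>The cylinder at 0 is full in every order, so the leftmost piece of length
  \<open>1 / b ^ q\<close> of a full cylinder is again full, with the same left endpoint. This
  brings cylinders of different orders to a common one.\<close>

lemma full_cyl_mono:
  assumes "b > 1" "p \<le> q"
  shows "full_cyl b p \<subseteq> full_cyl b q"
  using full_cyl_compose(1)[OF assms(1) _ zero_in_full_cyl[OF assms(1)], of _ p "q - p"] assms by auto

text \<open>The sibling to the left of a cylinder is full: a cylinder can fail to be full only
  because it is cut off by the right end of its parent.\<close>

lemma full_cyl_between:
  assumes b: "b > 1" and x: "0 \<le> x" "x < 1" and y: "0 \<le> y" "y < 1"
    and less: "cyl_left b l x < cyl_left b l y"
  shows "\<exists>q v. 1 \<le> q \<and> q \<le> l \<and> v \<in> full_cyl b q \<and> v \<le> x \<and> x < v + 1 / b ^ q \<and>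
           v + 1 / b ^ q \<le> cyl_left b l y"
  using less
proof (induction l)
  case (Suc l)
  have xy: "x < y" using Suc.prems cyl_left_mono[OF b y(1) _ x(2), of "Suc l"] by fastforce
  have le: "cyl_left b l x \<le> cyl_left b l y" using cyl_left_mono[OF b x(1) _ y(2)] xy by simp
  show ?case
  proof (cases "cyl_left b l x < cyl_left b l y")
    case True
    from Suc.IH[OF True] show ?thesis
      using cyl_left_Suc_ge[OF b y, of l] by (meson le_Suc_eq order_trans)
  next
    case False
    define w where "w = cyl_left b l x"
    have wy: "cyl_left b l y = w" using False le w_def by simp
    define dx where "dx = \<lfloor>b * (beta_map b ^^ l) x\<rfloor>"
    define dy where "dy = \<lfloor>b * (beta_map b ^^ l) y\<rfloor>"
    have pos: "b ^ Suc l > 0" using b by simp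
    have lx: "cyl_left b (Suc l) x = w + of_int dx / b ^ Suc l"
      using cyl_left_Suc[OF b] w_def dx_def by simp
    have ly: "cyl_left b (Suc l) y = w + of_int dy / b ^ Suc l"
      using cyl_left_Suc[OF b] wy dy_def by simp
    have "(of_int dx :: real) < of_int dy"
      using Suc.prems pos unfolding lx ly by (simp add: divide_less_cancel)
    then have "dx + 1 \<le> dy" by simp
    then have "(of_int dx :: real) + 1 \<le> of_int dy" by (metis of_int_1 of_int_add of_int_le_iff)
    then have "(of_int dx + 1) / b ^ Suc l \<le> of_int dy / b ^ Suc l"
      using pos by (intro divide_right_mono) auto
    then have vy: "cyl_left b (Suc l) x + 1 / b ^ Suc l \<le> cyl_left b (Suc l) y"
      unfolding lx ly by (simp add: add_divide_distrib)
    have yy: "cyl_left b (Suc l) y \<le> y" using cyl_left_le[OF b y] by blast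
    have wv: "w \<le> cyl_left b (Suc l) x" using cyl_left_Suc_ge[OF b x, of l] w_def by simp
    have "cyl_left b (Suc l) x \<in> full_cyl b (Suc l)"
    proof (rule full_cylI[OF b cyl_left_nonneg[OF b x]])
      show "cyl_left b (Suc l) x + 1 / b ^ Suc l \<le> 1" using vy yy y by linarith
      \<comment> \<open>Everything within \<open>1 / b ^ Suc l\<close> of this left endpoint is
        still left of \<open>y\<close>, hence in the common parent cylinder at \<open>w\<close>,
        where only the next digit decides.\<close>
      fix z assume z: "cyl_left b (Suc l) x \<le> z" "z < cyl_left b (Suc l) x + 1 / b ^ Suc l"
      have zl: "cyl_left b l z = w"
        using cyl_left_convex[OF b y, of l z] wy wv z vy yy by linarith
      have "b * (beta_map b ^^ l) z = b ^ Suc l * (z - w)"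
        using beta_map_funpow_eq[OF b, of l z] zl by simp
      moreover have "of_int dx / b ^ Suc l \<le> z - w" "z - w < (of_int dx + 1) / b ^ Suc l"
        using z unfolding lx by (simp_all add: add_divide_distrib)
      then have "of_int dx \<le> b ^ Suc l * (z - w)" "b ^ Suc l * (z - w) < of_int dx + 1"
        using pos by (simp_all add: divide_le_eq less_divide_eq mult.commute)
      ultimately have "\<lfloor>b * (beta_map b ^^ l) z\<rfloor> = dx" by linarith
      then show "cyl_left b (Suc l) z = cyl_left b (Suc l) x"
        using zl lx by (simp add: cyl_left_Suc[OF b])
    qed
    then show ?thesis
      using vy cyl_left_le[OF b x, of "Suc l"]
      by (intro exI[of _ "Suc l"] exI[of _ "cyl_left b (Suc l) x"]) auto
  qed
qed simp

text \<open>Pigeonhole: the l + 1 gaps between the left endpoints of l + 2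
  cylinders in the window yield two full cylinders of the same order.\<close>

lemma full_cyl_exists:
  assumes b: "b > 1" and c: "0 \<le> c" "c + (real l + 5) / b ^ l \<le> 1"
  shows "\<exists>v\<in>full_cyl b l. c \<le> v \<and> v + 1 / b ^ l \<le> c + (real l + 5) / b ^ l"
proof -
  define X where "X i = c + real i / b ^ l" for i :: nat
  have pos: "b ^ l > 0" using b by simp
  have Xmono: "X i \<le> X j" if "i \<le> j" for i j
    using that pos by (simp add: X_def divide_right_mono)
  have XSuc: "X (Suc i) = X i + 1 / b ^ l" for i by (simp add: X_def add_divide_distrib)
  have X1: "0 \<le> X i" "X i < 1" "c \<le> X i" if "i \<le> l + 2" for i
  proof -
    have "real i / b ^ l < (real l + 5) / b ^ l"
      using pos that by (intro divide_strict_right_mono) auto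
    moreover have "0 \<le> real i / b ^ l" using pos by simp
    ultimately show "0 \<le> X i" "X i < 1" "c \<le> X i" using c by (auto simp: X_def)
  qed
  define P where "P i q v \<longleftrightarrow> 1 \<le> q \<and> q \<le> l \<and> v \<in> full_cyl b q \<and> v \<le> X i \<and>
      X i < v + 1 / b ^ q \<and> v + 1 / b ^ q \<le> X (Suc i)" for i q v
  have "\<exists>q v. P i q v" if i: "i \<le> l" for i
  proof -
    have *: "cyl_left b l (X i) \<le> X i" "X (Suc i) < cyl_left b l (X (Suc i)) + 1 / b ^ l"
      "cyl_left b l (X (Suc i)) \<le> X (Suc i)"
      using cyl_left_le[OF b, of "X i"] cyl_left_le[OF b, of "X (Suc i)"] X1[of i] X1[of "Suc i"] i
      by auto
    then have "cyl_left b l (X i) < cyl_left b l (X (Suc i))" using XSuc[of i] by linarith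
    moreover have "0 \<le> X i" "X i < 1" "0 \<le> X (Suc i)" "X (Suc i) < 1"
      using X1(1,2)[of i] X1(1,2)[of "Suc i"] i by auto
    ultimately obtain q v where "1 \<le> q" "q \<le> l" "v \<in> full_cyl b q" "v \<le> X i"
      "X i < v + 1 / b ^ q" "v + 1 / b ^ q \<le> cyl_left b l (X (Suc i))"
      using full_cyl_between[OF b] by metis
    then have "P i q v" using *(3) unfolding P_def by linarith
    then show ?thesis by blast
  qed
  then obtain Q V where "\<And>i. i \<le> l \<Longrightarrow> P i (Q i) (V i)" by metis
  then have QV: "1 \<le> Q i \<and> Q i \<le> l \<and> V i \<in> full_cyl b (Q i) \<and>
      V i \<le> X i \<and> X i < V i + 1 / b ^ Q i \<and> V i + 1 / b ^ Q i \<le> X (Suc i)" if "i \<le> l" for i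
    using that unfolding P_def by blast
  have "\<not> inj_on Q {..l}"
  proof (rule pigeonhole)
    have "Q i \<in> {1..l}" if "i \<le> l" for i using QV[OF that] by simp
    then have "Q ` {..l} \<subseteq> {1..l}" by blast
    then have "card (Q ` {..l}) \<le> card {1..l}" by (intro card_mono) auto
    then show "card (Q ` {..l}) < card {..l}" by simp
  qed
  then obtain i j where ij: "i < j" "j \<le> l" "Q i = Q j"
    unfolding inj_on_def by (metis atMost_iff linorder_neqE_nat)
  \<comment> \<open>The first of the two cylinders may start left of the window. The second has the
    same order and lies further right, so by disjointness it starts after \<open>X i\<close>, hence
    inside.\<close>
  have "V i + 1 / b ^ Q i \<le> X j" using QV[of i] Xmono[of "Suc i" j] ij by force
  moreover have "X j < V j + 1 / b ^ Q i" using QV[OF ij(2)] ij(3) by simp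
  ultimately have "V i < V j" by linarith
  then have "V i + 1 / b ^ Q i \<le> V j"
    using full_cyl_separated[OF b] QV[of i] QV[of j] ij by force
  then have "c \<le> V j" using QV[of i] X1(3)[of i] ij by linarith
  moreover have "V j \<in> full_cyl b l" using QV[of j] full_cyl_mono[OF b] ij by blast
  \<comment> \<open>Only the first \<open>l + 3\<close> grid steps are used; the 5 in the window
    length is a convenient excess.\<close>
  moreover have "V j + 1 / b ^ l \<le> c + (real l + 5) / b ^ l"
  proof -
    have "V j \<le> X (l + 2)" using QV[of j] Xmono[of j "l + 2"] ij by force
    then have "V j + 1 / b ^ l \<le> X (l + 5)"
      using XSuc[of "l + 2"] Xmono[of "l + 3" "l + 5"] by (simp add: numeral_eq_Suc)
    then show ?thesis by (simp add: X_def)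
  qed
  ultimately show ?thesis by blast
qed

section \<open>Counting full cylinders and all cylinders\<close>

lemma card_separated_le:
  fixes S :: "real set"
  assumes g: "g > 0" and sep: "\<And>s t. s \<in> S \<Longrightarrow> t \<in> S \<Longrightarrow> s < t \<Longrightarrow> s + g \<le> t"
    and S: "S \<subseteq> {x..x + R}" and R: "0 \<le> R"
  shows "finite S" "real (card S) \<le> R / g + 1"
proof -
  define f where "f s = \<lfloor>(s - x) / g\<rfloor>" for s
  have "f s < f t" if "s \<in> S" "t \<in> S" "s < t" for s t
  proof -
    have "(s - x) / g + 1 \<le> (t - x) / g"
    proof -
      have "(s - x) + g \<le> t - x" using sep[OF that] by linarith
      then have "((s - x) + g) / g \<le> (t - x) / g" using g by (intro divide_right_mono) auto
      then show ?thesis using g by (simp add: add_divide_distrib)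
    qed
    then show ?thesis unfolding f_def by linarith
  qed
  then have inj: "inj_on f S" unfolding inj_on_def by (metis less_irrefl linorder_neqE)
  have sub: "f ` S \<subseteq> {0..\<lfloor>R / g\<rfloor>}"
  proof (intro image_subsetI)
    fix s assume "s \<in> S"
    then have "0 \<le> s - x" "s - x \<le> R" using S by auto
    then have "0 \<le> (s - x) / g" "(s - x) / g \<le> R / g"
      using g by (auto intro: divide_right_mono)
    then show "f s \<in> {0..\<lfloor>R / g\<rfloor>}" by (simp add: f_def floor_mono)
  qed
  show "finite S" using inj sub by (meson finite_atLeastAtMost_int finite_imageD finite_subset)
  have "card S = card (f ` S)" using inj by (simp add: card_image)
  also have "\<dots> \<le> card {0..\<lfloor>R / g\<rfloor>}" using sub by (intro card_mono) auto
  finally have "card S \<le> nat (\<lfloor>R / g\<rfloor> + 1)" by simp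
  moreover have "0 \<le> R / g" using R g by simp
  ultimately show "real (card S) \<le> R / g + 1" by linarith
qed

text \<open>Full cylinders are disjoint and their left endpoints stop at
  \<open>1 - 1 / b ^ n\<close>, which cancels the + 1 of the packing bound.\<close>

lemma full_cyl_card:
  assumes b: "b > 1"
  shows "finite (full_cyl b n)" "real (card (full_cyl b n)) \<le> b ^ n"
proof -
  have *: "0 < 1 / b ^ n" "0 \<le> 1 - 1 / b ^ n" using b by (auto simp: one_le_power)
  have sub: "full_cyl b n \<subseteq> {0..0 + (1 - 1 / b ^ n)}" by (auto simp: full_cyl_def)
  note ** = card_separated_le[OF *(1) full_cyl_separated[OF b] sub *(2)]
  show "finite (full_cyl b n)" by (rule **)
  have "(1 - 1 / b ^ n) / (1 / b ^ n) + 1 = b ^ n" using b by (simp add: field_simps)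
  with **(2) show "real (card (full_cyl b n)) \<le> b ^ n" by simp
qed

text \<open>Each element of \<open>A\<close> but the largest is sent to the least element of
  \<open>E\<close> above it, injectively. This serves to count cylinders through the right ends of
  full ones.\<close>

lemma card_le_card_Suc_interleaved:
  fixes A E :: "real set"
  assumes "finite A" "finite E"
    and "\<And>u v. u \<in> A \<Longrightarrow> v \<in> A \<Longrightarrow> u < v \<Longrightarrow> \<exists>e\<in>E. u < e \<and> e \<le> v"
  shows "card A \<le> card E + 1"
  using assms(1,3)
proof (cases "A = {}")
  case False
  define m where "m u = Min {e\<in>E. u < e}" for u
  have m: "m u \<in> E \<and> u < m u \<and> m u \<le> v" if uv: "u \<in> A" "v \<in> A" "u < v" for u v
  proof -
    obtain e where e: "e \<in> {e\<in>E. u < e}" "e \<le> v" using assms(3)[OF uv] by blast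
    have fin: "finite {e\<in>E. u < e}" using assms(2) by simp
    have "m u \<in> {e\<in>E. u < e}" unfolding m_def using fin e by (intro Min_in) auto
    moreover have "m u \<le> e" unfolding m_def using fin e by (intro Min_le) auto
    ultimately show ?thesis using e by auto
  qed
  have lt: "u < Max A" if "u \<in> A - {Max A}" for u
    using that assms(1) by (metis Diff_iff Max_ge insertI1 less_eq_real_def)
  have MA: "Max A \<in> A" using assms(1) False by simp
  have "m u < m v" if "u \<in> A - {Max A}" "v \<in> A - {Max A}" "u < v" for u v
    using m[of u v] m[OF _ MA lt, of v] that by force
  then have "inj_on m (A - {Max A})" unfolding inj_on_def by (metis less_irrefl linorder_neqE)
  moreover have "m ` (A - {Max A}) \<subseteq> E" using m[OF _ MA lt] by auto
  ultimately have "card (A - {Max A}) \<le> card E"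
    using assms(2) by (simp add: card_inj_on_le)
  then show ?thesis using assms(1) MA by simp
qed simp

text \<open>Between the left endpoints of two distinct cylinders lies the right end of a full
  cylinder of some order \<open>q \<le> l\<close>. There are at most \<open>b ^ q\<close> of these
  for each \<open>q\<close>, which costs a factor \<open>l + 1\<close> against the heuristic count
  \<open>b ^ l\<close>; on the exponential scale this is negligible.\<close>

lemma cyl_left_card:
  fixes b :: real and l :: nat
  assumes b: "b > 1"
  shows "finite (cyl_left b l ` {0..<1})" "real (card (cyl_left b l ` {0..<1})) \<le> (real l + 1) * b ^ l"
proof -
  show fin: "finite (cyl_left b l ` {0..<1})"
  proof (induction l)
    case (Suc l)
    have "cyl_left b (Suc l) x \<in> (\<lambda>(u, d). u + of_int d / b ^ Suc l) ` (cyl_left b l ` {0..<1} \<times> {0..\<lfloor>b\<rfloor>})"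
      if x: "0 \<le> x" "x < 1" for x
    proof -
      have "b * (beta_map b ^^ l) x \<le> b * 1"
        using b beta_map_funpow_range[OF x, of l b] by (intro mult_left_mono) auto
      then have "\<lfloor>b * (beta_map b ^^ l) x\<rfloor> \<in> {0..\<lfloor>b\<rfloor>}"
        using b beta_map_funpow_range[OF x, of l b] by (auto intro: floor_mono)
      with x show ?thesis unfolding cyl_left_Suc[OF b] by force
    qed
    then have "cyl_left b (Suc l) ` {0..<1} \<subseteq>
       (\<lambda>(u, d). u + of_int d / b ^ Suc l) ` (cyl_left b l ` {0..<1} \<times> {0..\<lfloor>b\<rfloor>})" by auto
    then show ?case by (rule finite_subset) (use Suc in auto)
  qed (auto intro: finite_subset[of _ "{0}"])
  define E where "E = (\<Union>q\<in>{1..l}. (\<lambda>v. v + 1 / b ^ q) ` full_cyl b q)"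
  have "card (cyl_left b l ` {0..<1}) \<le> card E + 1"
  proof (rule card_le_card_Suc_interleaved[OF fin])
    show "finite E" unfolding E_def using full_cyl_card[OF b] by auto
    fix u v assume "u \<in> cyl_left b l ` {0..<1}" "v \<in> cyl_left b l ` {0..<1}" "u < v"
    then obtain x y where xy: "0 \<le> x" "x < 1" "u = cyl_left b l x" "0 \<le> y" "y < 1" "v = cyl_left b l y"
      by auto
    have "cyl_left b l x < cyl_left b l y" using \<open>u < v\<close> xy by simp
    from full_cyl_between[OF b xy(1,2) xy(4,5) this]
    obtain q w where "1 \<le> q" "q \<le> l" "w \<in> full_cyl b q" "x < w + 1 / b ^ q" "w + 1 / b ^ q \<le> v"
      using xy(6) by blast
    moreover have "u \<le> x" using xy cyl_left_le[OF b xy(1,2), of l] by simp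
    ultimately show "\<exists>e\<in>E. u < e \<and> e \<le> v" unfolding E_def by force
  qed
  moreover have "real (card E) \<le> real l * b ^ l"
  proof -
    have "card E \<le> (\<Sum>q\<in>{1..l}. card ((\<lambda>v. v + 1 / b ^ q) ` full_cyl b q))"
      unfolding E_def by (rule card_UN_le) simp
    also have "\<dots> \<le> (\<Sum>q\<in>{1..l}. card (full_cyl b q))"
      by (intro sum_mono card_image_le full_cyl_card[OF b])
    finally have "real (card E) \<le> (\<Sum>q\<in>{1..l}. real (card (full_cyl b q)))"
      by (metis of_nat_le_iff of_nat_sum)
    also have "\<dots> \<le> (\<Sum>q\<in>{1..l}. b ^ l)"
      using b by (intro sum_mono order_trans[OF full_cyl_card(2)[OF b]] power_increasing) auto
    finally show ?thesis by simp
  qed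
  moreover have "1 \<le> b ^ l" using b by (simp add: one_le_power)
  ultimately show "real (card (cyl_left b l ` {0..<1})) \<le> (real l + 1) * b ^ l"
    by (simp add: distrib_right)
qed

section \<open>Covering target preimages\<close>

text \<open>Exponential growth rate of the number of intervals of length \<open>exp (- n * L)\<close> needed to cover the
  preimage of an interval of radius \<open>exp (- n * t)\<close> under the \<open>n\<close>-th iterate.\<close>

definition loc_exp :: "real \<Rightarrow> real \<Rightarrow> real \<Rightarrow> real" where
  "loc_exp b t L = min L (max (ln b) (L - t))"

text \<open>With r = exp (- n L) and p = exp (- n t), up to constants: 1 / r intervals cover
  everything, \<open>b ^ n\<close> is the number of components of the preimage, and p / r is their
  total length divided by r.\<close>

lemma exp_loc_exp:
  assumes "b > 1"
  shows "exp (real n * loc_exp b t L) =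
    min (1 / exp (- real n * L)) (max (b ^ n) (exp (- real n * t) / exp (- real n * L)))"
proof -
  have 1: "1 / exp (- real n * L) = exp (real n * L)" by (simp add: exp_minus field_simps)
  have 2: "b ^ n = exp (real n * ln b)" using assms by (simp add: exp_of_nat_mult)
  have 3: "exp (- real n * t) / exp (- real n * L) = exp (real n * (L - t))"
    by (simp add: exp_diff[symmetric] algebra_simps)
  have mn: "exp (min x y) = min (exp x) (exp y)" "exp (max x y) = max (exp x) (exp y)" for x y :: real
    by (auto simp: min_def max_def)
  have rn: "real n * min x y = min (real n * x) (real n * y)"
    "real n * max x y = max (real n * x) (real n * y)" for x y :: real
    by (simp_all add: min_mult_distrib_left max_mult_distrib_left)
  show ?thesis unfolding 1 2 3 loc_exp_def rn mn ..
qed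

lemma dist_int_le_1: "dist_int x \<le> 1"
proof -
  have "dist_int x \<le> \<bar>x - of_int \<lfloor>x\<rfloor>\<bar>" by (rule dist_int_le) simp
  then show ?thesis by linarith
qed

lemma dist_int_unit_cases:
  assumes "0 \<le> x" "x < 1" "0 \<le> y" "y < 1"
  obtains m where "m \<in> {-1, 0, 1::int}" "dist_int (x - y) = \<bar>x - y - of_int m\<bar>"
proof -
  obtain z where z: "z \<in> \<int>" "dist_int (x - y) = \<bar>x - y - z\<bar>"
    using dist_int_attained by blast
  then obtain m :: int where m: "z = of_int m" by (auto elim: Ints_cases)
  have "dist_int (x - y) \<le> \<bar>x - y\<bar>" using dist_int_le[of 0 "x - y"] by simp
  then have "\<bar>of_int m :: real\<bar> < 2" using z m assms by linarith
  then have "m \<in> {-1, 0, 1}" by auto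
  then show ?thesis using that z m by auto
qed

lemma interval_grid_cover:
  fixes r R c :: real
  assumes r: "0 < r" and R: "0 \<le> R"
  defines "C \<equiv> (\<lambda>i. c + real i * r) ` {..nat \<lfloor>R / r\<rfloor>}"
  shows "finite C" "real (card C) \<le> R / r + 1" "{c..c + R} \<subseteq> (\<Union>x\<in>C. {x..x + r})"
proof -
  show "finite C" by (simp add: C_def)
  have R0: "0 \<le> R / r" using assms by simp
  have "card C \<le> card {..nat \<lfloor>R / r\<rfloor>}" unfolding C_def by (rule card_image_le) simp
  also have "\<dots> = nat \<lfloor>R / r\<rfloor> + 1" by simp
  finally show "real (card C) \<le> R / r + 1" using R0 by linarith
  show "{c..c + R} \<subseteq> (\<Union>x\<in>C. {x..x + r})"
  proof
    fix x assume x: "x \<in> {c..c + R}"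
    define i where "i = nat \<lfloor>(x - c) / r\<rfloor>"
    have 0: "0 \<le> (x - c) / r" "(x - c) / r \<le> R / r" using x r by (auto intro: divide_right_mono)
    then have "real i \<le> (x - c) / r" "(x - c) / r \<le> real i + 1" by (auto simp: i_def)
    then have "c + real i * r \<le> x" "x \<le> c + real i * r + r"
      using r by (auto simp: field_simps)
    moreover have "i \<le> nat \<lfloor>R / r\<rfloor>" unfolding i_def using 0 by (intro nat_mono floor_mono)
    ultimately show "x \<in> (\<Union>x\<in>C. {x..x + r})" unfolding C_def by force
  qed
qed

text \<open>The 9 is 3 * 3: three integer translates of the target, and
  \<open>2 * (p / r) + b ^ n\<close> is at most three times the maximum. The factor
  \<open>n + 1\<close> is that of the cylinder count. When \<open>1 / r\<close> is the smaller
  bound, a plain grid on [0, 1] does it.\<close>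

lemma target_preimage_cover:
  fixes b a p r :: real
  assumes b: "b > 1" and r: "0 < r" "r \<le> 1" and p: "0 \<le> p" and a: "0 \<le> a" "a < 1"
  shows "\<exists>C. finite C \<and> real (card C) \<le> 9 * (real n + 1) * min (1 / r) (max (b ^ n) (p / r)) \<and>
     {x\<in>{0..<1}. dist_int ((beta_map b ^^ n) x - a) \<le> p} \<subseteq> (\<Union>c\<in>C. {c..c + r})"
proof (cases "1 / r \<le> max (b ^ n) (p / r)")
  case True
  define C where "C = (\<lambda>i. 0 + real i * r) ` {..nat \<lfloor>1 / r\<rfloor>}"
  have C: "finite C" "real (card C) \<le> 1 / r + 1" "{0..0 + 1} \<subseteq> (\<Union>x\<in>C. {x..x + r})"
    unfolding C_def by (rule interval_grid_cover[OF r(1)]; simp)+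
  have "1 \<le> 1 / r" using r by simp
  then have "1 / r + 1 \<le> 9 * (1 / r)" by linarith
  also have "\<dots> \<le> 9 * (real n + 1) * (1 / r)" using r by (intro mult_right_mono) auto
  finally have "1 / r + 1 \<le> 9 * (real n + 1) * min (1 / r) (max (b ^ n) (p / r))"
    unfolding min_absorb1[OF True] .
  with C(2) have "real (card C) \<le> 9 * (real n + 1) * min (1 / r) (max (b ^ n) (p / r))" by linarith
  moreover have "{x\<in>{0..<1}. dist_int ((beta_map b ^^ n) x - a) \<le> p} \<subseteq> {0..0 + 1}" by auto
  then have "{x\<in>{0..<1}. dist_int ((beta_map b ^^ n) x - a) \<le> p} \<subseteq> (\<Union>x\<in>C. {x..x + r})"
    using C(3) by (rule subset_trans)
  ultimately show ?thesis using C(1) by (intro exI[of _ C] conjI)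
next
  case False
  define h where "h = max (b ^ n) (p / r)"
  have pos: "b ^ n > 0" using b by simp
  define U where "U = cyl_left b n ` {0..<1}"
  \<comment> \<open>A pair \<open>um\<close> is the left endpoint of a cylinder and an integer
    translate of the target; on that branch the preimage lies in an interval of length
    \<open>2 * p / b ^ n\<close>, which \<open>G\<close> subdivides with step
    \<open>r\<close>.\<close>
  define G where "G um = (\<lambda>i. fst um + (a + of_int (snd um) - p) / b ^ n + real i * r) `
      {..nat \<lfloor>(2 * p / b ^ n) / r\<rfloor>}" for um :: "real \<times> int"
  have R: "0 \<le> 2 * p / b ^ n" using p pos by simp
  note G = interval_grid_cover[OF r(1) R, of "fst um + (a + of_int (snd um) - p) / b ^ n" for um,
      folded G_def]
  define C where "C = (\<Union>um\<in>U \<times> {-1, 0, 1}. G um)"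
  have finU: "finite U" unfolding U_def by (rule cyl_left_card[OF b])
  have "card C \<le> (\<Sum>um\<in>U \<times> {-1, 0, 1}. card (G um))"
    unfolding C_def by (rule card_UN_le) (simp add: finU)
  then have "real (card C) \<le> (\<Sum>um\<in>U \<times> {-1, 0, 1}. real (card (G um)))"
    by (metis of_nat_le_iff of_nat_sum)
  also have "\<dots> \<le> (\<Sum>um\<in>U \<times> {-1, 0, 1::int}. (2 * p / b ^ n) / r + 1)"
    by (intro sum_mono G(2))
  also have "\<dots> = 3 * real (card U) * ((2 * p / b ^ n) / r + 1)"
    by (simp add: card_cartesian_product)
  also have "\<dots> \<le> 3 * ((real n + 1) * b ^ n) * ((2 * p / b ^ n) / r + 1)"
    using cyl_left_card(2)[OF b, of n] add_nonneg_nonneg[OF divide_nonneg_pos[OF R r(1)] zero_le_one]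
    by (intro mult_right_mono mult_left_mono) (auto simp: U_def)
  also have "\<dots> = 3 * (real n + 1) * (2 * (p / r) + b ^ n)"
    using b r by (simp add: field_simps)
  also have "\<dots> \<le> 3 * (real n + 1) * (3 * h)"
    unfolding h_def by (intro mult_left_mono) (auto simp: max_def)
  finally have card: "real (card C) \<le> 9 * (real n + 1) * h" by (simp add: algebra_simps)
  have "{x\<in>{0..<1}. dist_int ((beta_map b ^^ n) x - a) \<le> p} \<subseteq> (\<Union>c\<in>C. {c..c + r})"
  proof
    fix x assume "x \<in> {x\<in>{0..<1}. dist_int ((beta_map b ^^ n) x - a) \<le> p}"
    then have x: "0 \<le> x" "x < 1" and d: "dist_int ((beta_map b ^^ n) x - a) \<le> p" by auto
    define y where "y = (beta_map b ^^ n) x"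
    have "0 \<le> y" "y < 1" unfolding y_def using beta_map_funpow_range[OF x] by auto
    from dist_int_unit_cases[OF this a] obtain m :: int where
      m: "m \<in> {-1, 0, 1}" "dist_int (y - a) = \<bar>y - a - of_int m\<bar>" .
    define u where "u = cyl_left b n x"
    have uU: "u \<in> U" using x by (auto simp: u_def U_def)
    have xy: "x = u + y / b ^ n" by (simp add: u_def y_def cyl_left_def)
    have 1: "a + of_int m - p \<le> y" "y \<le> a + of_int m + p" using m d y_def by auto
    have "(a + of_int m - p) / b ^ n \<le> y / b ^ n"
      using 1(1) pos by (intro divide_right_mono) auto
    moreover have "y / b ^ n \<le> (a + of_int m - p) / b ^ n + 2 * p / b ^ n"
      unfolding add_divide_distrib[symmetric] using 1(2) pos by (intro divide_right_mono) auto
    ultimately have "x \<in> {u + (a + of_int m - p) / b ^ n..u + (a + of_int m - p) / b ^ n + 2 * p / b ^ n}"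
      unfolding xy by simp
    moreover have "{u + (a + of_int m - p) / b ^ n..u + (a + of_int m - p) / b ^ n + 2 * p / b ^ n} \<subseteq>
        (\<Union>c\<in>G (u, m). {c..c + r})"
      using G(3)[of "(u, m)"] by (simp only: fst_conv snd_conv)
    ultimately have "x \<in> (\<Union>c\<in>G (u, m). {c..c + r})" by (rule subsetD[rotated])
    moreover have "G (u, m) \<subseteq> C" unfolding C_def using uU m(1) by blast
    ultimately show "x \<in> (\<Union>c\<in>C. {c..c + r})" by blast
  qed
  moreover have "finite C" unfolding C_def using finU by (auto simp: G_def)
  moreover have "min (1 / r) (max (b ^ n) (p / r)) = h" using False unfolding h_def by (simp add: min_def)
  ultimately show ?thesis using card by (intro exI[of _ C] conjI) (simp_all only:)
qed

section \<open>Hausdorff measure of limsup sets\<close>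

lemma diameter_le_dist:
  fixes S :: "'a::metric_space set"
  assumes "0 \<le> d" "\<And>x y. x \<in> S \<Longrightarrow> y \<in> S \<Longrightarrow> dist x y \<le> d"
  shows "bounded S" "diameter S \<le> d"
proof -
  show "bounded S" using assms(2) by (meson bounded_def bounded_two_points)
  show "diameter S \<le> d"
    using assms by (auto simp: diameter_def intro!: cSUP_least)
qed

text \<open>The Hausdorff-Cantelli argument: a limsup set is covered by the families beyond any
  index, and the tails of a convergent series become arbitrarily small.\<close>

lemma hausdorff_measure_limsup_zero:
  fixes W :: "'a::metric_space set" and \<U> :: "nat \<Rightarrow> 'a set set"
  assumes s: "s > 0"
    and fin: "\<And>n. finite (\<U> n)"
    and bd: "\<And>n U. U \<in> \<U> n \<Longrightarrow> bounded U \<and> diameter U \<le> \<rho> n"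
    and W: "W \<subseteq> {x. \<exists>\<^sub>\<infinity>n. x \<in> \<Union>(\<U> n)}"
    and lim: "\<rho> \<longlonglongrightarrow> 0" and nonneg: "\<And>n. 0 \<le> \<rho> n"
    and summ: "summable (\<lambda>n. real (card (\<U> n)) * \<rho> n powr s)"
  shows "hausdorff_measure s W = 0"
proof -
  define f where "f n = real (card (\<U> n)) * \<rho> n powr s" for n
  have f0: "0 \<le> f n" for n by (simp add: f_def)
  have summf: "summable f" using summ by (simp add: f_def[abs_def])
  have pre: "hausdorff_premeasure s \<delta> W \<le> ennreal \<epsilon>" if \<delta>: "\<delta> > 0" and \<epsilon>: "\<epsilon> > 0" for \<delta> \<epsilon>
  proof -
    obtain N1 where N1: "\<And>n. n \<ge> N1 \<Longrightarrow> norm (\<Sum>i. f (i + n)) < \<epsilon>"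
      using suminf_exist_split[OF \<epsilon> summf] by blast
    obtain N2 where N2: "\<And>n. n \<ge> N2 \<Longrightarrow> \<rho> n \<le> \<delta>"
      using order_tendstoD(2)[OF lim \<delta>] unfolding eventually_sequentially by (meson less_imp_le)
    define N where "N = max N1 N2"
    have "\<forall>n. \<exists>e. bij_betw e {0..<card (\<U> n)} (\<U> n)" using fin ex_bij_betw_nat_finite by blast
    then obtain e where e: "\<And>n. bij_betw (e n) {0..<card (\<U> n)} (\<U> n)" by metis
    \<comment> \<open>The premeasure wants one sequence of sets. Families of varying size are padded
      with empty sets, whose \<open>diam_power\<close> is 0, and listed through the pairing
      function.\<close>
    define V where "V = (\<lambda>(n, j). if j < card (\<U> (n + N)) then e (n + N) j else {})"
    have eU: "e n j \<in> \<U> n" if "j < card (\<U> n)" for n j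
      using e[of n] that by (auto simp: bij_betw_def)
    have cov: "W \<subseteq> (\<Union>m. V (prod_decode m))"
    proof
      fix x assume "x \<in> W"
      then have "\<exists>\<^sub>\<infinity>n. x \<in> \<Union>(\<U> n)" using W by auto
      then have "\<exists>n\<ge>N. x \<in> \<Union>(\<U> n)" unfolding INFM_nat_le by (rule spec)
      then obtain n where n: "n \<ge> N" "x \<in> \<Union>(\<U> n)" by (elim exE conjE)
      then obtain U where U: "U \<in> \<U> n" "x \<in> U" by blast
      then obtain j where j: "j < card (\<U> n)" "e n j = U"
      proof -
        have "U \<in> e n ` {0..<card (\<U> n)}" using U(1) bij_betw_imp_surj_on[OF e[of n]] by simp
        then show ?thesis using that by (elim imageE) simp
      qed
      have "V (prod_decode (prod_encode (n - N, j))) = U" using n j by (simp add: V_def)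
      then show "x \<in> (\<Union>m. V (prod_decode m))" using U by blast
    qed
    have Vbd: "bounded (V p) \<and> diameter (V p) \<le> \<delta>" for p
    proof (cases p)
      case (Pair n j)
      have "\<rho> (n + N) \<le> \<delta>" using N2[of "n + N"] by (simp add: N_def)
      then show ?thesis using bd[OF eU, of j "n + N"] \<delta> by (auto simp: V_def Pair)
    qed
    have Vle: "diam_power s (V (n, j)) \<le> (if j < card (\<U> (n + N)) then \<rho> (n + N) powr s else 0)" for n j
    proof (cases "j < card (\<U> (n + N))")
      case True
      then have "diameter (V (n, j)) \<le> \<rho> (n + N)" "bounded (V (n, j))"
        using bd[OF eU, of j "n + N"] by (auto simp: V_def)
      then have "diameter (V (n, j)) powr s \<le> \<rho> (n + N) powr s"
        using s diameter_ge_0 by (intro powr_mono2) auto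
      then show ?thesis using True s by (auto simp: diam_power_def)
    qed (auto simp: V_def diam_power_def)
    have "hausdorff_premeasure s \<delta> W \<le> (\<Sum>m. ennreal (diam_power s (V (prod_decode m))))"
      unfolding hausdorff_premeasure_def using cov Vbd by (intro INF_lower) auto
    also have "\<dots> = (\<Sum>n. \<Sum>j. ennreal (diam_power s (V (n, j))))"
      by (rule suminf_ennreal_2dimen[where f = "\<lambda>p. ennreal (diam_power s (V p))"]) simp
    also have "\<dots> \<le> (\<Sum>n. ennreal (f (n + N)))"
    proof (intro suminf_le allI)
      fix n
      have "(\<Sum>j. ennreal (diam_power s (V (n, j)))) \<le>
          (\<Sum>j. ennreal (if j < card (\<U> (n + N)) then \<rho> (n + N) powr s else 0))"
        by (intro suminf_le allI ennreal_leI Vle) auto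
      also have "\<dots> = (\<Sum>j<card (\<U> (n + N)). ennreal (if j < card (\<U> (n + N)) then \<rho> (n + N) powr s else 0))"
        by (intro suminf_finite) auto
      also have "\<dots> = (\<Sum>j<card (\<U> (n + N)). ennreal (\<rho> (n + N) powr s))"
        by (intro sum.cong) auto
      also have "\<dots> = ennreal (f (n + N))"
        by (simp add: f_def ennreal_mult ennreal_of_nat_eq_real_of_nat)
      finally show "(\<Sum>j. ennreal (diam_power s (V (n, j)))) \<le> ennreal (f (n + N))" .
    qed auto
    also have "\<dots> = ennreal (\<Sum>n. f (n + N))"
      using summf f0 by (intro suminf_ennreal2) (auto simp: summable_iff_shift)
    also have "\<dots> \<le> ennreal \<epsilon>" using N1[of N] by (intro ennreal_leI) (auto simp: N_def)
    finally show ?thesis .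
  qed
  have "hausdorff_premeasure s \<delta> W = 0" if "\<delta> > 0" for \<delta>
    using pre[OF that] by (metis ennreal_le_epsilon add_0 le_zero_eq)
  then show ?thesis unfolding hausdorff_measure_def by simp
qed

section \<open>The dimension function\<close>

text \<open>At scale \<open>D = ln (\<beta> i) + t $ i\<close> the classes \<open>K1\<close>,
  \<open>K2\<close>, \<open>K3\<close> record which of the values \<open>D\<close>,
  \<open>D - t $ k\<close>, \<open>ln (\<beta> k)\<close> is taken by \<open>loc_exp\<close>. This
  turns \<open>theta\<close> into a ratio free of case distinctions.\<close>

lemma theta_eq:
  fixes \<beta> :: "'d::finite \<Rightarrow> real"
  assumes \<beta>: "\<And>k. 1 < \<beta> k" and t: "\<And>k. 0 \<le> t $ k"
  shows "theta \<beta> t i = (\<Sum>k\<in>UNIV. loc_exp (\<beta> k) (t $ k) (ln (\<beta> i) + t $ i)) / (ln (\<beta> i) + t $ i)"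
proof -
  define D where "D = ln (\<beta> i) + t $ i"
  define f where "f k = loc_exp (\<beta> k) (t $ k) D / D" for k
  have lb: "0 < ln (\<beta> k)" for k using \<beta>[of k] by simp
  have D: "D > 0" using lb[of i] t[of i] by (simp add: D_def)
  have 1: "f k = 1" if "k \<in> K1 \<beta> t i" for k
  proof -
    have "D < ln (\<beta> k)" using that by (simp add: K1_def D_def)
    then have "loc_exp (\<beta> k) (t $ k) D = D" unfolding loc_exp_def by linarith
    then show ?thesis using D by (simp add: f_def)
  qed
  have 2: "f k = 1 - t $ k / D" if "k \<in> K2 \<beta> t i" for k
  proof -
    have "ln (\<beta> k) + t $ k \<le> D" using that by (simp add: K2_def D_def)
    then have "loc_exp (\<beta> k) (t $ k) D = D - t $ k" unfolding loc_exp_def using t[of k] by linarith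
    then show ?thesis using D by (simp add: f_def diff_divide_distrib)
  qed
  have 3: "f k = ln (\<beta> k) / D" if "k \<in> K3 \<beta> t i" for k
  proof -
    have "ln (\<beta> k) \<le> D" "D < ln (\<beta> k) + t $ k"
      using that by (auto simp: K1_def K2_def K3_def D_def)
    then have "loc_exp (\<beta> k) (t $ k) D = ln (\<beta> k)" unfolding loc_exp_def by linarith
    then show ?thesis by (simp add: f_def)
  qed
  have disj: "K1 \<beta> t i \<inter> K2 \<beta> t i = {}"
  proof -
    have False if "k \<in> K1 \<beta> t i" "k \<in> K2 \<beta> t i" for k
      using that t[of k] by (simp add: K1_def K2_def)
    then show ?thesis by blast
  qed
  have un: "UNIV = (K1 \<beta> t i \<union> K2 \<beta> t i) \<union> K3 \<beta> t i" by (auto simp: K3_def)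
  have "sum f UNIV = sum f (K1 \<beta> t i \<union> K2 \<beta> t i) + sum f (K3 \<beta> t i)"
    unfolding un by (intro sum.union_disjoint) (auto simp: K3_def)
  also have "sum f (K1 \<beta> t i \<union> K2 \<beta> t i) = sum f (K1 \<beta> t i) + sum f (K2 \<beta> t i)"
    by (intro sum.union_disjoint disj) auto
  finally have "sum f UNIV = theta \<beta> t i"
    using 1 2 3 by (simp add: theta_def D_def)
  then show ?thesis by (simp add: f_def D_def sum_divide_distrib)
qed

text \<open>The kinks of the sum at which its slope increases are exactly the scales
  \<open>ln (\<beta> i) + t i\<close>; between two consecutive ones the sum is concave.\<close>

lemma loc_exp_sum_ge:
  fixes \<beta> t :: "'d::finite \<Rightarrow> real"
  assumes \<beta>: "\<And>k. 1 < \<beta> k" and t: "\<And>k. 0 \<le> t k"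
    and m: "\<And>i. m * (ln (\<beta> i) + t i) \<le> (\<Sum>k\<in>UNIV. loc_exp (\<beta> k) (t k) (ln (\<beta> i) + t i))"
    and card: "m \<le> real CARD('d)" and L: "0 \<le> L"
  shows "m * L \<le> (\<Sum>k\<in>UNIV. loc_exp (\<beta> k) (t k) L)"
proof -
  define D where "D i = ln (\<beta> i) + t i" for i
  define G where "G k = loc_exp (\<beta> k) (t k)" for k
  have lb: "0 < ln (\<beta> k)" for k using \<beta>[of k] by simp
  have Dpos: "0 < D i" for i using lb[of i] t[of i] by (simp add: D_def)
  have mD: "m * D i \<le> (\<Sum>k\<in>UNIV. G k (D i))" for i using m by (simp add: D_def G_def)
  have lin: "G k x = x - t k" if "D k \<le> x" for k x
    using that t[of k] unfolding G_def loc_exp_def D_def by linarith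
  have conc: "G k x = min x (ln (\<beta> k))" if "x \<le> D k" for k x
    using that t[of k] unfolding G_def loc_exp_def D_def by linarith
  show ?thesis
  proof (cases "\<exists>i. L \<le> D i")
    case True
    define A where "A = {x \<in> range D. L \<le> x}"
    \<comment> \<open>\<open>0\<close> is added so that the leftmost piece also has a left end;
      there both sides of the claim vanish.\<close>
    define B where "B = insert 0 {x \<in> range D. x \<le> L}"
    have fin: "finite A" "finite B" by (auto simp: A_def B_def)
    have ne: "A \<noteq> {}" "B \<noteq> {}" using True by (auto simp: A_def B_def)
    define R where "R = Min A"
    define l where "l = Max B"
    have RA: "R \<in> A" and lB: "l \<in> B" unfolding R_def l_def using fin ne by auto
    have LR: "L \<le> R" and lL: "l \<le> L" using RA lB L by (auto simp: A_def B_def)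
    have dich: "D k \<le> l \<or> R \<le> D k" for k
    proof (cases "L \<le> D k")
      case True
      then have "D k \<in> A" by (simp add: A_def)
      then show ?thesis unfolding R_def using fin by simp
    next
      case False
      then have "D k \<in> B" by (simp add: B_def)
      then show ?thesis unfolding l_def using fin by simp
    qed
    have mR: "m * R \<le> (\<Sum>k\<in>UNIV. G k R)" using RA mD by (auto simp: A_def)
    have ml: "m * l \<le> (\<Sum>k\<in>UNIV. G k l)"
    proof (cases "l = 0")
      case True
      have "G k 0 = 0" for k using conc[of 0 k] Dpos[of k] lb[of k] by simp
      then show ?thesis using True by simp
    next
      case False
      then show ?thesis using lB mD by (auto simp: B_def)
    qed
    show ?thesis
    proof (cases "L = R")
      case True
      then show ?thesis using mR by (simp add: G_def)
    next
      case False
      then have LR': "L < R" using LR by simp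
      \<comment> \<open>Concavity on [l, R], with denominators cleared: \<open>L\<close> is a convex
        combination of \<open>l\<close> and \<open>R\<close>, and each summand is there either
        affine or a minimum of affine functions.\<close>
      have "(R - L) * G k l + (L - l) * G k R \<le> (R - l) * G k L" for k
      proof (cases "D k \<le> l")
        case True
        then have eq: "G k l = l - t k" "G k L = L - t k" "G k R = R - t k"
          using lin lL LR by auto
        show ?thesis unfolding eq by (simp add: algebra_simps)
      next
        case False
        then have RD: "R \<le> D k" using dich by blast
        have eq: "G k l = min l (ln (\<beta> k))" "G k L = min L (ln (\<beta> k))" "G k R = min R (ln (\<beta> k))"
          using conc RD lL LR by auto
        have "(R - L) * G k l + (L - l) * G k R \<le> (R - L) * l + (L - l) * R"
          unfolding eq using lL LR by (intro add_mono mult_left_mono) auto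
        moreover have "(R - L) * G k l + (L - l) * G k R \<le> (R - L) * ln (\<beta> k) + (L - l) * ln (\<beta> k)"
          unfolding eq using lL LR by (intro add_mono mult_left_mono) auto
        moreover have "(R - L) * l + (L - l) * R = (R - l) * L"
          "(R - L) * ln (\<beta> k) + (L - l) * ln (\<beta> k) = (R - l) * ln (\<beta> k)"
          by (simp_all add: algebra_simps)
        ultimately show ?thesis unfolding eq(2) by (simp add: min_def)
      qed
      then have "(\<Sum>k\<in>UNIV. (R - L) * G k l + (L - l) * G k R) \<le> (\<Sum>k\<in>UNIV. (R - l) * G k L)"
        by (intro sum_mono)
      then have 1: "(R - L) * (\<Sum>k\<in>UNIV. G k l) + (L - l) * (\<Sum>k\<in>UNIV. G k R) \<le> (R - l) * (\<Sum>k\<in>UNIV. G k L)"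
        by (simp add: sum.distrib sum_distrib_left)
      have "(R - L) * (m * l) + (L - l) * (m * R) \<le> (R - L) * (\<Sum>k\<in>UNIV. G k l) + (L - l) * (\<Sum>k\<in>UNIV. G k R)"
        using lL LR mR ml by (intro add_mono mult_left_mono) auto
      moreover have "(R - L) * (m * l) + (L - l) * (m * R) = (R - l) * (m * L)"
        by (simp add: algebra_simps)
      ultimately have "(R - l) * (m * L) \<le> (R - l) * (\<Sum>k\<in>UNIV. G k L)" using 1 by linarith
      moreover have "0 < R - l" using lL LR' by linarith
      ultimately have "m * L \<le> (\<Sum>k\<in>UNIV. G k L)" by (simp only: mult_le_cancel_left_pos)
      then show ?thesis by (simp add: G_def)
    qed
  next
    case False
    \<comment> \<open>Beyond the last kink every summand has slope 1, so the sum has slope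
      \<open>CARD('d)\<close>, which is at least \<open>m\<close>.\<close>
    have "Max (range D) \<in> range D" by (intro Max_in) auto
    then obtain i where "Max (range D) = D i" by (rule rangeE)
    then have i: "D i = Max (range D)" by simp
    have le: "D k \<le> D i" "D k \<le> L" "D i \<le> L" for k using False i by (auto simp: not_le less_imp_le)
    have "(\<Sum>k\<in>UNIV. G k L) = (\<Sum>k\<in>UNIV. G k (D i) + (L - D i))"
      using lin[OF le(1)] lin[OF le(2)] by simp
    also have "\<dots> = (\<Sum>k\<in>UNIV. G k (D i)) + real CARD('d) * (L - D i)"
      by (simp add: sum.distrib)
    also have "\<dots> \<ge> m * D i + m * (L - D i)"
      using mD[of i] card le(3) by (intro add_mono mult_right_mono) auto
    finally show ?thesis by (simp add: G_def algebra_simps)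
  qed
qed

lemma theta_le_card:
  fixes \<beta> :: "'d::finite \<Rightarrow> real"
  assumes \<beta>: "\<And>k. 1 < \<beta> k" and t: "\<And>k. 0 \<le> t $ k"
  shows "theta \<beta> t i \<le> real CARD('d)"
proof -
  define D where "D = ln (\<beta> i) + t $ i"
  have D: "D > 0" using \<beta>[of i] t[of i] by (simp add: D_def add_pos_nonneg)
  have "(\<Sum>k\<in>UNIV. loc_exp (\<beta> k) (t $ k) D) \<le> (\<Sum>k\<in>(UNIV::'d set). D)"
    by (intro sum_mono) (simp add: loc_exp_def)
  then show ?thesis unfolding theta_eq[OF assms] D_def[symmetric] using D by (simp add: divide_le_eq)
qed

lemma theta_pos:
  fixes \<beta> :: "'d::finite \<Rightarrow> real"
  assumes \<beta>: "\<And>k. 1 < \<beta> k" and t: "\<And>k. 0 \<le> t $ k"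
  shows "0 < theta \<beta> t i"
proof -
  define D where "D = ln (\<beta> i) + t $ i"
  have D: "D > 0" using \<beta>[of i] t[of i] by (simp add: D_def add_pos_nonneg)
  have "0 < loc_exp (\<beta> k) (t $ k) D" for k
    using D \<beta>[of k] by (simp add: loc_exp_def less_max_iff_disj)
  then have "0 < (\<Sum>k\<in>UNIV. loc_exp (\<beta> k) (t $ k) D)" by (intro sum_pos) auto
  then show ?thesis unfolding theta_eq[OF assms] D_def[symmetric] using D by simp
qed

text \<open>The index classes of \<open>theta\<close> jump as \<open>t\<close> varies, but minima,
  maxima and quotients with positive denominator are continuous, and these are all that the form
  given by \<open>loc_exp\<close> contains.\<close>

lemma tendsto_theta:
  fixes \<beta> :: "'d::finite \<Rightarrow> real" and t :: "real ^ 'd"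
  assumes \<beta>: "\<And>k. 1 < \<beta> k" and t: "\<And>k. 0 \<le> t $ k"
    and f: "\<And>k. ((\<lambda>x. f x $ k) \<longlongrightarrow> t $ k) F" and f0: "\<And>x k. 0 \<le> f x $ k"
  shows "((\<lambda>x. theta \<beta> (f x) i) \<longlongrightarrow> theta \<beta> t i) F"
proof -
  have "ln (\<beta> i) + t $ i > 0" using \<beta>[of i] t[of i] by (simp add: add_pos_nonneg)
  then show ?thesis unfolding theta_eq[OF \<beta> t] theta_eq[OF \<beta> f0] loc_exp_def
    by (intro tendsto_divide tendsto_sum tendsto_min tendsto_max tendsto_add tendsto_diff
        tendsto_const f) auto
qed

section \<open>One-dimensional Cantor sets\<close>

text \<open>The number of digits to prescribe: a cylinder of this order has length exp (- n
  \<sigma>), up to a factor \<open>b\<close> from rounding up.\<close>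

definition target_depth :: "real \<Rightarrow> real \<Rightarrow> nat \<Rightarrow> nat" where
  "target_depth b \<sigma> n = nat \<lceil>real n * \<sigma> / ln b\<rceil>"

lemma target_depth_bounds:
  assumes b: "b > 1" and \<sigma>: "0 \<le> \<sigma>"
  shows "target_depth b \<sigma> 0 = 0"
    and "exp (real n * \<sigma>) \<le> b ^ target_depth b \<sigma> n"
    and "b ^ target_depth b \<sigma> n \<le> b * exp (real n * \<sigma>)"
    and "real (target_depth b \<sigma> n) \<le> real n * \<sigma> / ln b + 1"
    and "b ^ (n + target_depth b \<sigma> n) \<le> exp (real n * (2 * ln b + \<sigma>))"
proof -
  have lb: "ln b > 0" using b by simp
  have nn: "0 \<le> real n * \<sigma> / ln b" using lb \<sigma> by simp
  define l where "l = target_depth b \<sigma> n"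
  show "target_depth b \<sigma> 0 = 0" by (simp add: target_depth_def)
  have l: "real n * \<sigma> / ln b \<le> real l" "real l \<le> real n * \<sigma> / ln b + 1"
    unfolding l_def target_depth_def using nn by linarith+
  have pw: "b ^ k = exp (real k * ln b)" for k using b by (simp add: exp_of_nat_mult)
  have "real n * \<sigma> \<le> real l * ln b" using l(1) lb by (simp add: divide_le_eq)
  then show "exp (real n * \<sigma>) \<le> b ^ target_depth b \<sigma> n" by (simp add: pw l_def)
  have "real l * ln b \<le> (real n * \<sigma> / ln b + 1) * ln b" using l(2) lb by (intro mult_right_mono) auto
  also have "\<dots> = real n * \<sigma> + ln b" using lb by (simp add: distrib_right)
  finally have le: "real l * ln b \<le> real n * \<sigma> + ln b" .
  then have "exp (real l * ln b) \<le> exp (real n * \<sigma> + ln b)" by simp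
  also have "\<dots> = b * exp (real n * \<sigma>)" using b by (simp add: exp_add)
  finally show "b ^ target_depth b \<sigma> n \<le> b * exp (real n * \<sigma>)" by (simp add: pw l_def)
  show "real (target_depth b \<sigma> n) \<le> real n * \<sigma> / ln b + 1" using l(2) by (simp add: l_def)
  \<comment> \<open>One \<open>ln b\<close> comes from \<open>b ^ n\<close>, the other pays for the
    rounding, which is possible once \<open>n\<close> is positive; for \<open>n = 0\<close> the
    depth is 0.\<close>
  show "b ^ (n + target_depth b \<sigma> n) \<le> exp (real n * (2 * ln b + \<sigma>))"
  proof (cases "n = 0")
    case False
    then have "1 * ln b \<le> real n * ln b" using lb by (intro mult_right_mono) auto
    then have "real (n + l) * ln b \<le> real n * (2 * ln b + \<sigma>)"
      using le by (simp add: algebra_simps)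
    then show ?thesis by (simp only: pw l_def exp_le_cancel_iff)
  qed (simp add: target_depth_def)
qed

text \<open>The strict \<open>v + 1 / b ^ l < 1\<close> keeps the cylinders off the right end of
  their parents. Then the closure of a cell stays inside the half-open parent cell, as the
  compactness argument requires.\<close>

definition target_cyl :: "real \<Rightarrow> real \<Rightarrow> real \<Rightarrow> nat \<Rightarrow> nat \<Rightarrow> real \<Rightarrow> bool" where
  "target_cyl b a \<tau> n l v \<longleftrightarrow> v \<in> full_cyl b l \<and> v + 1 / b ^ l < 1 \<and>
     (\<forall>y. v \<le> y \<longrightarrow> y < v + 1 / b ^ l \<longrightarrow> \<bar>y - a\<bar> \<le> exp (- real n * \<tau>))"

text \<open>A full cylinder of order \<open>l\<close> near \<open>a\<close> is only guaranteed in a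
  window of length \<open>(l + 5) / b ^ l\<close>, which can exceed exp (- n \<sigma>) by a factor
  linear in \<open>n\<close>. Hence the gap between the exponent \<sigma> of the cylinder and the
  smaller exponent \<tau> of the target.\<close>

lemma eventually_target_cyl:
  assumes b: "b > 1" and a: "0 \<le> a" "a < 1" and \<tau>: "0 < \<tau>" "\<tau> < \<sigma>"
  shows "\<forall>\<^sub>F n in sequentially. \<exists>v. target_cyl b a \<tau> n (target_depth b \<sigma> n) v"
proof -
  have lb: "ln b > 0" using b by simp
  define c d where "c = \<sigma> - \<tau>" and "d = \<sigma> / ln b"
  have pos: "c > 0" "d > 0" using \<tau> lb by (auto simp: c_def d_def)
  have lim1: "(\<lambda>n. (real n * d + 6) * exp (- real n * c)) \<longlonglongrightarrow> 0"
    using pos by real_asymp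
  have lim2: "(\<lambda>n. exp (- real n * \<tau>)) \<longlonglongrightarrow> 0"
    using \<tau> by real_asymp
  have ev1: "\<forall>\<^sub>F n in sequentially. (real n * d + 6) * exp (- real n * c) < 1"
    using order_tendstoD(2)[OF lim1, of 1] by simp
  have ev2: "\<forall>\<^sub>F n in sequentially. exp (- real n * \<tau>) < 1 / 4"
    using order_tendstoD(2)[OF lim2, of "1 / 4"] by simp
  show ?thesis
  proof (rule eventually_mono[OF eventually_conj[OF ev1 ev2]])
    fix n assume "(real n * d + 6) * exp (- real n * c) < 1 \<and> exp (- real n * \<tau>) < 1 / 4"
    then have n1: "(real n * d + 6) * exp (- real n * c) < 1" and n2: "exp (- real n * \<tau>) < 1 / 4" by auto
    define l where "l = target_depth b \<sigma> n"
    note tb = target_depth_bounds(2-)[OF b, of \<sigma> n]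
    define w where "w = (real l + 5) / b ^ l"
    have w0: "0 < w" using b by (simp add: w_def)
    have "w \<le> (real n * d + 6) / exp (real n * \<sigma>)"
      unfolding w_def l_def using tb \<tau> by (intro frac_le) (auto simp: d_def)
    also have "\<dots> = ((real n * d + 6) * exp (- real n * c)) * exp (- real n * \<tau>)"
      by (simp add: c_def exp_minus exp_add exp_diff field_simps)
    also have "\<dots> \<le> 1 * exp (- real n * \<tau>)" using n1 by (intro mult_right_mono) auto
    finally have w: "w \<le> exp (- real n * \<tau>)" by simp
    \<comment> \<open>The window is put on the side of \<open>a\<close> that has room: its length is
      below 1 / 4, so it stays in [0, 1).\<close>
    define c0 where "c0 = (if a < 1 / 2 then a else a - w)"
    have c0: "0 \<le> c0" "c0 + w < 1" "a - w \<le> c0" "c0 \<le> a"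
      using a w n2 w0 unfolding c0_def by (auto split: if_splits)
    obtain v where v: "v \<in> full_cyl b l" "c0 \<le> v" "v + 1 / b ^ l \<le> c0 + w"
      using full_cyl_exists[OF b c0(1), of l] c0(2) unfolding w_def by auto
    have "\<bar>y - a\<bar> \<le> exp (- real n * \<tau>)" if "v \<le> y" "y < v + 1 / b ^ l" for y
      using that v c0 w by linarith
    then have "target_cyl b a \<tau> n l v" using v c0 by (auto simp: target_cyl_def)
    then show "\<exists>v. target_cyl b a \<tau> n (target_depth b \<sigma> n) v" unfolding l_def by blast
  qed
qed

text \<open>One full cylinder is chosen in each window of length \<open>w\<close>; taking all of them would not
  give an equidistributed family.\<close>

lemma equidistributed_full_cyls:
  fixes b w v :: real and l q :: nat
  assumes b: "b > 1" and v: "v \<in> full_cyl b l" "v + 1 / b ^ l < 1"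
    and w: "w = (real q + 5) / b ^ q" "w \<le> 1"
  shows "\<exists>H. finite H \<and> H \<subseteq> full_cyl b (q + l) \<and> 1 / (2 * w) \<le> real (card H) \<and>
    (\<forall>h\<in>H. h + 1 / b ^ (q + l) < 1 \<and>
       (\<forall>x. h \<le> x \<longrightarrow> x < h + 1 / b ^ (q + l) \<longrightarrow>
          v \<le> (beta_map b ^^ q) x \<and> (beta_map b ^^ q) x < v + 1 / b ^ l)) \<and>
    (\<forall>x R. 0 \<le> R \<longrightarrow> real (card (H \<inter> {x..x + R})) \<le> R / w + 2)"
proof -
  have pos: "b ^ q > 0" "b ^ l > 0" using b by auto
  have w0: "0 < w" using pos by (simp add: w)
  \<comment> \<open>\<open>M\<close> adjacent windows of length \<open>w\<close> fit into [0, 1].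
    Each receives one full cylinder of order \<open>q\<close>, and in it the piece that
    \<open>q\<close> iterates carry onto the cylinder at \<open>v\<close>.\<close>
  define M where "M = nat \<lfloor>1 / w\<rfloor>"
  have w1: "1 \<le> 1 / w" using w0 w(2) by simp
  have M: "real M \<le> 1 / w" "1 / w < real M + 1" "1 \<le> real M"
    unfolding M_def using w1 le_floor_iff[of 1 "1 / w"] by linarith+
  have "\<forall>i. \<exists>g. i < M \<longrightarrow> g \<in> full_cyl b q \<and> real i * w \<le> g \<and> g + 1 / b ^ q \<le> (real i + 1) * w"
  proof
    fix i
    show "\<exists>g. i < M \<longrightarrow> g \<in> full_cyl b q \<and> real i * w \<le> g \<and> g + 1 / b ^ q \<le> (real i + 1) * w"
    proof (cases "i < M")
      case True
      have "(real i + 1) * w \<le> real M * w" using True w0 by (intro mult_right_mono) auto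
      also have "\<dots> \<le> 1" using M(1) w0 by (simp add: le_divide_eq)
      finally have "real i * w + (real q + 5) / b ^ q \<le> 1" by (simp add: w(1) distrib_right add_divide_distrib)
      from full_cyl_exists[OF b _ this] w0
      obtain g where "g \<in> full_cyl b q" "real i * w \<le> g" "g + 1 / b ^ q \<le> real i * w + (real q + 5) / b ^ q"
        by auto
      moreover have "(real i + 1) * w = real i * w + (real q + 5) / b ^ q" by (simp add: w(1) distrib_right add_divide_distrib)
      ultimately show ?thesis by auto
    qed simp
  qed
  then obtain g where g: "\<And>i. i < M \<Longrightarrow> g i \<in> full_cyl b q \<and> real i * w \<le> g i \<and>
      g i + 1 / b ^ q \<le> (real i + 1) * w" by metis
  define h where "h i = g i + v / b ^ q" for i
  define H where "H = h ` {..<M}"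
  have v0: "0 \<le> v" using v by (simp add: full_cyl_def)
  have v1: "v < 1" using v(2) pos(2) by (smt (verit) divide_pos_pos)
  have hb: "real i * w \<le> h i" "h i < (real i + 1) * w" if "i < M" for i
  proof -
    have "0 \<le> v / b ^ q" "v / b ^ q < 1 / b ^ q" using v0 v1 pos by (auto intro: divide_strict_right_mono)
    then show "real i * w \<le> h i" "h i < (real i + 1) * w" using g[OF that] by (auto simp: h_def)
  qed
  have hlt: "h i < h j" if "i < j" "j < M" for i j
  proof -
    have "(real i + 1) * w \<le> real j * w" using that w0 by (intro mult_right_mono) auto
    then show ?thesis using hb[of i] hb[of j] that by simp
  qed
  have inj: "inj_on h {..<M}" unfolding inj_on_def
    by (metis hlt lessThan_iff less_irrefl linorder_neqE_nat)
  have "card H = M" unfolding H_def using inj by (simp add: card_image)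
  moreover have "1 / (2 * w) = (1 / w) / 2" by simp
  ultimately have H1: "1 / (2 * w) \<le> real (card H)" using M by linarith
  have H2: "H \<subseteq> full_cyl b (q + l)"
    using full_cyl_compose(1)[OF b _ v(1)] g by (auto simp: H_def h_def)
  have H3: "h' + 1 / b ^ (q + l) < 1 \<and> (\<forall>x. h' \<le> x \<longrightarrow> x < h' + 1 / b ^ (q + l) \<longrightarrow>
          v \<le> (beta_map b ^^ q) x \<and> (beta_map b ^^ q) x < v + 1 / b ^ l)" if h': "h' \<in> H" for h'
  proof -
    obtain i where i: "i < M" "h' = g i + v / b ^ q"
      using h' unfolding H_def h_def by (elim imageE) simp
    have gi: "g i \<in> full_cyl b q" using g[OF i(1)] by simp
    have "v / b ^ q + 1 / b ^ (q + l) = (v + 1 / b ^ l) / b ^ q"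
      using b by (simp add: power_add add_divide_distrib)
    also have "\<dots> < 1 / b ^ q" using v(2) pos by (intro divide_strict_right_mono) auto
    finally have "h' + 1 / b ^ (q + l) < g i + 1 / b ^ q" by (simp add: i)
    also have "\<dots> \<le> 1" using gi by (simp add: full_cyl_def)
    finally show ?thesis using full_cyl_compose(2)[OF b gi v(1)] i(2) by blast
  qed
  have H4: "real (card (H \<inter> {x..x + R})) \<le> R / w + 2" if R: "0 \<le> R" for x R
  proof -
    \<comment> \<open>The window index of a point of \<open>H\<close> in [x, x + R] lies in an
      interval of length \<open>R / w + 1\<close>, whence the + 2.\<close>
    define I where "I = {i. i < M \<and> h i \<in> {x..x + R}}"
    have "H \<inter> {x..x + R} \<subseteq> h ` I" by (auto simp: H_def I_def)
    then have "card (H \<inter> {x..x + R}) \<le> card (h ` I)" by (intro card_mono) (auto simp: I_def)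
    also have "\<dots> \<le> card I" by (intro card_image_le) (simp add: I_def)
    also have "\<dots> = card (real ` I)" by (simp add: card_image)
    finally have 1: "real (card (H \<inter> {x..x + R})) \<le> real (card (real ` I))" by simp
    have sub: "real ` I \<subseteq> {x / w - 1..(x / w - 1) + (R / w + 1)}"
    proof
      fix y assume "y \<in> real ` I"
      then obtain i where i: "y = real i" "i < M" "x \<le> h i" "h i \<le> x + R" by (auto simp: I_def)
      have "x \<le> (y + 1) * w" "y * w \<le> x + R" using hb[OF i(2)] i by auto
      then have "x / w \<le> y + 1" "y \<le> (x + R) / w" using w0 by (simp_all add: divide_le_eq le_divide_eq)
      then show "y \<in> {x / w - 1..(x / w - 1) + (R / w + 1)}" by (simp add: add_divide_distrib)
    qed
    have R0: "0 \<le> R / w + 1" using R w0 by simp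
    have sep: "s + 1 \<le> t" if "s \<in> real ` I" "t \<in> real ` I" "s < t" for s t using that by auto
    show ?thesis using card_separated_le(2)[OF zero_less_one sep sub R0] 1 by simp
  qed
  have "finite H" by (simp add: H_def)
  then show ?thesis
    by (intro exI[of _ H] conjI[OF _ conjI] conjI[OF H1 conjI] H2 ballI allI impI H4) (use H3 in blast)+
qed

section \<open>Nested homogeneous families of cylinders\<close>

fun cantor_level :: "real \<Rightarrow> (nat \<Rightarrow> nat) \<Rightarrow> (nat \<Rightarrow> real set) \<Rightarrow> nat \<Rightarrow> real set" where
  "cantor_level b p H 0 = {0}"
| "cantor_level b p H (Suc j) = (\<lambda>(u, h). u + h / b ^ p j) ` (cantor_level b p H j \<times> H j)"

text \<open>\<open>p j\<close> is the order of the cells of level \<open>j\<close>, and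
  \<open>w j\<close> the typical spacing of their children in units of the parent's length. Each
  cell receives the same copy of \<open>H j\<close>, so all cells of a level have equally many
  descendants and counting can replace a measure.\<close>

locale cantor_construction =
  fixes b :: real and p :: "nat \<Rightarrow> nat" and H :: "nat \<Rightarrow> real set" and w :: "nat \<Rightarrow> real"
  assumes b: "b > 1" and p0: "p 0 = 0" and pmono: "\<And>j. p j \<le> p (Suc j)"
    and Hfin: "\<And>j. finite (H j)" and Hfull: "\<And>j. H j \<subseteq> full_cyl b (p (Suc j) - p j)"
    and Hlt: "\<And>j h. h \<in> H j \<Longrightarrow> h + 1 / b ^ (p (Suc j) - p j) < 1"
    and w0: "\<And>j. 0 < w j" and Hcard: "\<And>j. 1 / (2 * w j) \<le> real (card (H j))"
    and Hcount: "\<And>j x R. 0 \<le> R \<Longrightarrow> real (card (H j \<inter> {x..x + R})) \<le> R / w j + 2"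
begin

abbreviation "A \<equiv> cantor_level b p H"

lemma bpos: "0 < b ^ k" using b by simp

lemma level_full: "A j \<subseteq> full_cyl b (p j)"
proof (induction j)
  case 0
  then show ?case using zero_in_full_cyl[OF b] by (simp add: p0)
next
  case (Suc j)
  have "u + h / b ^ p j \<in> full_cyl b (p j + (p (Suc j) - p j))" if "u \<in> A j" "h \<in> H j" for u h
    using that Suc Hfull[of j] by (intro full_cyl_compose(1)[OF b]) auto
  then show ?case using pmono[of j] by auto
qed

lemma level_finite: "finite (A j)"
  by (induction j) (auto simp: Hfin)

lemma child_bounds:
  assumes "h \<in> H j"
  shows "0 \<le> h / b ^ p j" "h / b ^ p j + 1 / b ^ p (Suc j) < 1 / b ^ p j"
proof -
  show "0 \<le> h / b ^ p j" using assms Hfull[of j] bpos[of "p j"] by (auto simp: full_cyl_def)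
  have "h / b ^ p j + 1 / b ^ p (Suc j) = (h + 1 / b ^ (p (Suc j) - p j)) / b ^ p j"
    using b pmono[of j] by (simp add: power_diff field_simps)
  also have "\<dots> < 1 / b ^ p j" using Hlt[OF assms] bpos by (intro divide_strict_right_mono) auto
  finally show "h / b ^ p j + 1 / b ^ p (Suc j) < 1 / b ^ p j" .
qed

lemma level_parent:
  assumes "z \<in> A (Suc j)"
  shows "\<exists>u\<in>A j. u \<le> z \<and> z + 1 / b ^ p (Suc j) < u + 1 / b ^ p j"
proof -
  obtain u h where uh: "u \<in> A j" "h \<in> H j" "z = u + h / b ^ p j" using assms by auto
  then have "u \<le> z" "z + 1 / b ^ p (Suc j) < u + 1 / b ^ p j"
    using child_bounds[OF uh(2)] by linarith+
  then show ?thesis using uh(1) by blast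
qed

lemma level_card_Suc: "card (A (Suc j)) = card (A j) * card (H j)"
proof -
  have "False" if "u \<in> A j" "u' \<in> A j" "h \<in> H j" "h' \<in> H j" "u < u'" "u + h / b ^ p j = u' + h' / b ^ p j"
    for u u' h h'
  proof -
    have "u + 1 / b ^ p j \<le> u'" using full_cyl_separated[OF b] level_full that by blast
    moreover have "0 < 1 / b ^ p (Suc j)" using bpos by simp
    ultimately show False using child_bounds[OF that(3)] child_bounds[OF that(4)] that(6) by linarith
  qed
  then have "u = u'" if "u \<in> A j" "u' \<in> A j" "h \<in> H j" "h' \<in> H j" "u + h / b ^ p j = u' + h' / b ^ p j"
    for u u' h h' using that by (metis linorder_neqE)
  then have "inj_on (\<lambda>(u, h). u + h / b ^ p j) (A j \<times> H j)"
    using b by (force simp: inj_on_def)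
  then show ?thesis by (simp add: card_image card_cartesian_product)
qed

lemma level_card_pos: "0 < card (A j)"
proof (induction j)
  case (Suc j)
  have "0 < 1 / (2 * w j)" using w0 by simp
  then have "0 < card (H j)" using Hcard[of j] by linarith
  then show ?case using Suc level_card_Suc by simp
qed simp

text \<open>A corner in the window has its parent's corner in the window enlarged to the left by one
  parent length; inside one parent the count is \<open>Hcount\<close> rescaled by
  \<open>b ^ p j\<close>.\<close>

lemma level_count_Suc:
  assumes R: "0 \<le> R"
  shows "real (card (A (Suc j) \<inter> {x..x + R})) \<le>
    real (card (A j \<inter> {x - 1 / b ^ p j..x + R})) * (R * b ^ p j / w j + 2)"
proof -
  define B where "B = A j \<inter> {x - 1 / b ^ p j..x + R}"
  define F where "F u = (\<lambda>h. u + h / b ^ p j) ` (H j \<inter> {(x - u) * b ^ p j..(x - u) * b ^ p j + R * b ^ p j})" for u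
  have sub: "A (Suc j) \<inter> {x..x + R} \<subseteq> (\<Union>u\<in>B. F u)"
  proof
    fix z assume z: "z \<in> A (Suc j) \<inter> {x..x + R}"
    then obtain u h where uh: "u \<in> A j" "h \<in> H j" "z = u + h / b ^ p j" by auto
    have z': "x \<le> u + h / b ^ p j" "u + h / b ^ p j \<le> x + R" using z uh by auto
    have "0 < 1 / b ^ p (Suc j)" using bpos by simp
    then have "h / b ^ p j < 1 / b ^ p j" using child_bounds[OF uh(2)] by linarith
    then have "x - 1 / b ^ p j \<le> u" "u \<le> x + R" using child_bounds(1)[OF uh(2)] z' by linarith+
    then have "u \<in> B" using uh(1) by (simp add: B_def)
    moreover have "x - u \<le> h / b ^ p j" "h / b ^ p j \<le> (x - u) + R" using z' by auto
    then have "(x - u) * b ^ p j \<le> h" "h \<le> ((x - u) + R) * b ^ p j"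
      using bpos by (simp_all only: le_divide_eq divide_le_eq if_True)
    then have "z \<in> F u" unfolding F_def uh(3) using uh(2) by (auto simp: distrib_right)
    ultimately show "z \<in> (\<Union>u\<in>B. F u)" by blast
  qed
  have finB: "finite B" by (simp add: B_def level_finite)
  have finF: "finite (F u)" for u by (simp add: F_def Hfin)
  have "card (A (Suc j) \<inter> {x..x + R}) \<le> card (\<Union>u\<in>B. F u)"
    by (intro card_mono sub) (simp add: finB finF)
  also have "\<dots> \<le> (\<Sum>u\<in>B. card (F u))" by (rule card_UN_le[OF finB])
  finally have "real (card (A (Suc j) \<inter> {x..x + R})) \<le> (\<Sum>u\<in>B. real (card (F u)))"
    by (metis of_nat_le_iff of_nat_sum)
  also have "\<dots> \<le> (\<Sum>u\<in>B. R * b ^ p j / w j + 2)"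
  proof (intro sum_mono)
    fix u
    have "real (card (F u)) \<le> real (card (H j \<inter> {(x - u) * b ^ p j..(x - u) * b ^ p j + R * b ^ p j}))"
      unfolding F_def by (simp add: Hfin card_image_le)
    also have "\<dots> \<le> R * b ^ p j / w j + 2" using R bpos[of "p j"] by (intro Hcount) simp
    finally show "real (card (F u)) \<le> R * b ^ p j / w j + 2" .
  qed
  finally show ?thesis by (simp add: B_def)
qed

text \<open>All cells of level \<open>j\<close> share one set \<open>Q\<close> of relative positions
  of their descendants. So the proportion of corners of level \<open>N\<close> in a window is at
  most that of level \<open>j\<close> in the window enlarged by a cell length; cross-multiplying
  keeps this within the naturals.\<close>

lemma level_count_descendants:
  assumes jN: "j \<le> N"
  shows "card (A N \<inter> {x..x + R}) * card (A j) \<le> card (A j \<inter> {x - 1 / b ^ p j..x + R}) * card (A N)"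
proof -
  have "\<exists>Q. finite Q \<and> A N \<subseteq> (\<lambda>(u, y). u + y) ` (A j \<times> Q) \<and> card (A j) * card Q \<le> card (A N) \<and>
      (\<forall>y\<in>Q. 0 \<le> y \<and> y + 1 / b ^ p N \<le> 1 / b ^ p j)"
    using jN
  proof (induction N rule: dec_induct)
    case base
    have "A j \<subseteq> (\<lambda>(u, y). u + y) ` (A j \<times> {0})"
    proof
      fix x assume "x \<in> A j"
      then show "x \<in> (\<lambda>(u, y). u + y) ` (A j \<times> {0})" by (intro image_eqI[of _ _ "(x, 0)"]) auto
    qed
    then show ?case by (intro exI[of _ "{0}"]) auto
  next
    case (step N)
    then obtain Q where Q: "finite Q" "A N \<subseteq> (\<lambda>(u, y). u + y) ` (A j \<times> Q)"
      "card (A j) * card Q \<le> card (A N)" "\<forall>y\<in>Q. 0 \<le> y \<and> y + 1 / b ^ p N \<le> 1 / b ^ p j" by blast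
    define Q' where "Q' = (\<lambda>(y, h). y + h / b ^ p N) ` (Q \<times> H N)"
    have "card Q' \<le> card (Q \<times> H N)" unfolding Q'_def by (intro card_image_le) (simp add: Q Hfin)
    then have "card (A j) * card Q' \<le> card (A j) * (card Q * card (H N))"
      by (simp add: card_cartesian_product)
    also have "\<dots> \<le> card (A (Suc N))" unfolding level_card_Suc using Q(3)
      by (simp add: mult.assoc[symmetric])
    finally have 1: "card (A j) * card Q' \<le> card (A (Suc N))" .
    have 2: "A (Suc N) \<subseteq> (\<lambda>(u, y). u + y) ` (A j \<times> Q')"
    proof
      fix z assume "z \<in> A (Suc N)"
      then obtain z' h where z: "z' \<in> A N" "h \<in> H N" "z = z' + h / b ^ p N" by auto
      then obtain u y where u: "u \<in> A j" "y \<in> Q" "z' = u + y" using Q(2) by auto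
      have "y + h / b ^ p N \<in> Q'" unfolding Q'_def using u z by force
      then show "z \<in> (\<lambda>(u, y). u + y) ` (A j \<times> Q')" using u(1) z(3) u(3) by (force simp: add.assoc)
    qed
    have 3: "0 \<le> y \<and> y + 1 / b ^ p (Suc N) \<le> 1 / b ^ p j" if y: "y \<in> Q'" for y
    proof -
      obtain y' h where yh: "y' \<in> Q" "h \<in> H N" "y = y' + h / b ^ p N" using y by (auto simp: Q'_def)
      have "0 \<le> y'" "y' + 1 / b ^ p N \<le> 1 / b ^ p j" using Q(4) yh(1) by auto
      then show ?thesis using child_bounds[OF yh(2)] unfolding yh(3) by linarith
    qed
    show ?case using 1 2 3 Q(1) Hfin[of N] by (intro exI[of _ Q']) (auto simp: Q'_def)
  qed
  then obtain Q where Q: "finite Q" "A N \<subseteq> (\<lambda>(u, y). u + y) ` (A j \<times> Q)"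
    "card (A j) * card Q \<le> card (A N)" "\<forall>y\<in>Q. 0 \<le> y \<and> y + 1 / b ^ p N \<le> 1 / b ^ p j" by blast
  define B where "B = A j \<inter> {x - 1 / b ^ p j..x + R}"
  have "A N \<inter> {x..x + R} \<subseteq> (\<lambda>(u, y). u + y) ` (B \<times> Q)"
  proof
    fix z assume z: "z \<in> A N \<inter> {x..x + R}"
    then obtain u y where u: "u \<in> A j" "y \<in> Q" "z = u + y" using Q(2) by auto
    have y: "0 \<le> y" "y + 1 / b ^ p N \<le> 1 / b ^ p j" using Q(4) u(2) by auto
    have "x \<le> z" "z \<le> x + R" using z by auto
    moreover have "0 < 1 / b ^ p N" using bpos by simp
    ultimately have "x - 1 / b ^ p j \<le> u" "u \<le> x + R" using y u(3) by linarith+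
    then have "u \<in> B" using u(1) by (simp add: B_def)
    then show "z \<in> (\<lambda>(u, y). u + y) ` (B \<times> Q)" using u by force
  qed
  then have "card (A N \<inter> {x..x + R}) \<le> card ((\<lambda>(u, y). u + y) ` (B \<times> Q))"
    by (intro card_mono) (auto simp: Q(1) B_def level_finite)
  also have "\<dots> \<le> card (B \<times> Q)" by (intro card_image_le) (auto simp: Q(1) B_def level_finite)
  also have "\<dots> = card B * card Q" by (rule card_cartesian_product)
  finally have "card (A N \<inter> {x..x + R}) * card (A j) \<le> card B * (card (A j) * card Q)"
    by (simp add: mult.assoc mult.commute[of "card Q"])
  also have "\<dots> \<le> card B * card (A N)" using Q(3) by (intro mult_left_mono) auto
  finally show ?thesis by (simp add: B_def)
qed

text \<open>As \<open>r\<close> is at most the cell length, at most 5 corners of level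
  \<open>j\<close> matter, each with at most \<open>3 * r * b ^ p j / w j + 2\<close> relevant
  children. A cell has at least \<open>1 / (2 * w j)\<close> children, and dividing by this gives
  the constants 30 and 20.\<close>

lemma level_count:
  assumes r: "1 / b ^ p (Suc j) \<le> r" "r \<le> 1 / b ^ p j" and N: "Suc j \<le> N"
  shows "real (card (A N \<inter> {x..x + 2 * r})) \<le>
    (30 * r * b ^ p j + 20 * w j) / real (card (A j)) * real (card (A N))"
proof -
  have r0: "0 < r" using r(1) bpos[of "p (Suc j)"] by (smt (verit) divide_pos_pos)
  define S where "S = real (card (A (Suc j) \<inter> {x - 1 / b ^ p (Suc j)..x + 2 * r}))"
  define y where "y = x - r"
  have "S \<le> real (card (A (Suc j) \<inter> {y..y + 3 * r}))"
    unfolding S_def y_def using r(1) by (intro of_nat_mono card_mono) (auto simp: level_finite simp del: cantor_level.simps)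
  also have "\<dots> \<le> real (card (A j \<inter> {y - 1 / b ^ p j..y + 3 * r})) * (3 * r * b ^ p j / w j + 2)"
    using r0 by (intro level_count_Suc) auto
  also have "\<dots> \<le> 5 * (3 * r * b ^ p j / w j + 2)"
  proof (intro mult_right_mono)
    have sep: "s + 1 / b ^ p j \<le> t" if "s \<in> A j \<inter> {y - 1 / b ^ p j..y + 3 * r}"
      "t \<in> A j \<inter> {y - 1 / b ^ p j..y + 3 * r}" "s < t" for s t
      using full_cyl_separated[OF b] level_full that by blast
    have sub: "A j \<inter> {y - 1 / b ^ p j..y + 3 * r} \<subseteq> {y - 1 / b ^ p j..(y - 1 / b ^ p j) + 4 / b ^ p j}"
      using r(2) by auto
    have "real (card (A j \<inter> {y - 1 / b ^ p j..y + 3 * r})) \<le> (4 / b ^ p j) / (1 / b ^ p j) + 1"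
      using bpos[of "p j"] by (intro card_separated_le(2)[OF _ sep sub]) auto
    also have "\<dots> = 5" using b by simp
    finally show "real (card (A j \<inter> {y - 1 / b ^ p j..y + 3 * r})) \<le> 5" .
    show "0 \<le> 3 * r * b ^ p j / w j + 2" using r0 bpos[of "p j"] w0[of j] by (intro add_nonneg_nonneg divide_nonneg_pos mult_nonneg_nonneg) auto
  qed
  finally have S: "S \<le> 5 * (3 * r * b ^ p j / w j + 2)" .
  have cA: "real (card (A j)) > 0" "real (card (A (Suc j))) > 0" using level_card_pos by (simp_all only: of_nat_0_less_iff)
  have "real (card (A N \<inter> {x..x + 2 * r})) * real (card (A (Suc j))) \<le> S * real (card (A N))"
    unfolding S_def of_nat_mult[symmetric] of_nat_le_iff by (rule level_count_descendants[OF N])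
  then have "real (card (A N \<inter> {x..x + 2 * r})) \<le> S / real (card (A (Suc j))) * real (card (A N))"
    using cA by (simp add: le_divide_eq del: cantor_level.simps)
  also have "\<dots> \<le> (30 * r * b ^ p j + 20 * w j) / real (card (A j)) * real (card (A N))"
  proof (intro mult_right_mono)
    have "real (card (A j)) * (1 / (2 * w j)) \<le> real (card (A (Suc j)))"
      unfolding level_card_Suc of_nat_mult using Hcard by (intro mult_left_mono) auto
    moreover have "0 < real (card (A j)) * (1 / (2 * w j))" using cA w0[of j] by simp
    moreover have "0 \<le> 5 * (3 * r * b ^ p j / w j + 2)" using r0 bpos[of "p j"] w0[of j] by (intro add_nonneg_nonneg divide_nonneg_pos mult_nonneg_nonneg) auto
    ultimately have "S / real (card (A (Suc j))) \<le> 5 * (3 * r * b ^ p j / w j + 2) / (real (card (A j)) * (1 / (2 * w j)))"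
      using S by (intro frac_le) auto
    also have "\<dots> = (30 * r * b ^ p j + 20 * w j) / real (card (A j))"
      using w0[of j] cA by (simp add: field_simps)
    finally show "S / real (card (A (Suc j))) \<le> (30 * r * b ^ p j + 20 * w j) / real (card (A j))" .
  qed simp
  finally show ?thesis .
qed

end

text \<open>\<open>m\<close> and \<open>n\<close> are consecutive times. Hitting the target at time
  \<open>m\<close> uses up the order \<open>m + target_depth b \<sigma> m\<close>; the
  \<open>q\<close> iterates left before time \<open>n\<close> are free, and windows of length exp (-
  B m) already contain full cylinders of order \<open>q\<close>. A common \<open>B\<close> for all
  coordinates makes them change level at common radii.\<close>

definition good_step :: "real \<Rightarrow> real \<Rightarrow> real \<Rightarrow> real \<Rightarrow> real \<Rightarrow> nat \<Rightarrow> nat \<Rightarrow> bool" where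
  "good_step b a \<tau> \<sigma> B m n \<longleftrightarrow>
     m + target_depth b \<sigma> m \<le> n \<and>
     (let q = n - (m + target_depth b \<sigma> m) in (real q + 5) / b ^ q \<le> exp (- B * real m)) \<and>
     (\<exists>v. target_cyl b a \<tau> n (target_depth b \<sigma> n) v)"

lemma eventually_good_step:
  assumes b: "b > 1" and a: "0 \<le> a" "a < 1" and \<tau>: "0 < \<tau>" "\<tau> < \<sigma>"
  shows "\<forall>\<^sub>F n in sequentially. good_step b a \<tau> \<sigma> B m n"
proof -
  define p where "p = m + target_depth b \<sigma> m"
  have "(\<lambda>q. (real q + 5) / b ^ q) \<longlonglongrightarrow> 0" using b by real_asymp
  then have "\<forall>\<^sub>F q in sequentially. (real q + 5) / b ^ q < exp (- B * real m)"
    by (intro order_tendstoD(2)) auto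
  moreover have "filterlim (\<lambda>n. n - p) at_top sequentially" by (rule filterlim_minus_const_nat_at_top)
  ultimately have "\<forall>\<^sub>F n in sequentially. (real (n - p) + 5) / b ^ (n - p) < exp (- B * real m)"
    by (rule eventually_compose_filterlim)
  then show ?thesis
    using eventually_ge_at_top[of p] eventually_target_cyl[OF b a \<tau>]
    by eventually_elim (auto simp: good_step_def p_def Let_def)
qed

text \<open>Losses may depend on \<open>n j\<close>: they are negligible once \<open>n (j + 1)\<close> is much larger. At scales
  close to \<open>exp (- B * n j)\<close> even a factor \<open>n (j + 1)\<close> would be too much, whence the last conjunct.\<close>

lemma cantor_set_exists:
  fixes b a \<tau> \<sigma> B :: real and n :: "nat \<Rightarrow> nat"
  assumes b: "b > 1" and \<tau>: "0 < \<tau>" "\<tau> < \<sigma>" and B: "2 * ln b + \<sigma> \<le> B"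
    and n0: "n 0 = 0" and good: "\<And>j. good_step b a \<tau> \<sigma> B (n j) (n (Suc j))"
  defines "p \<equiv> \<lambda>j. n j + target_depth b \<sigma> (n j)"
  shows "\<exists>A. (\<forall>j. finite (A j) \<and> A j \<noteq> {} \<and> A j \<subseteq> full_cyl b (p j)) \<and>
    (\<forall>j. \<forall>z\<in>A (Suc j). \<exists>u\<in>A j. u \<le> z \<and> z + 1 / b ^ p (Suc j) < u + 1 / b ^ p j) \<and>
    (\<forall>j. \<forall>z\<in>A (Suc j). \<forall>x. z \<le> x \<longrightarrow> x < z + 1 / b ^ p (Suc j) \<longrightarrow>
       \<bar>(beta_map b ^^ n (Suc j)) x - a\<bar> \<le> exp (- real (n (Suc j)) * \<tau>)) \<and>
    (\<forall>j N x L. j + 2 \<le> N \<longrightarrow> exp (- B * real (n (Suc j))) \<le> exp (- real (n (Suc j)) * L) \<longrightarrow>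
       exp (- real (n (Suc j)) * L) \<le> exp (- B * real (n j)) \<longrightarrow>
       real (card (A N \<inter> {x..x + 2 * exp (- real (n (Suc j)) * L)})) \<le>
         100 * b * (real (n (Suc j)) + 5) * exp (B * real (n j)) *
           exp (- real (n (Suc j)) * loc_exp b \<sigma> L) * real (card (A N))) \<and>
    (\<forall>j N x r. j + 2 \<le> N \<longrightarrow> (real (n (Suc j)) + 5) / b ^ n (Suc j) \<le> r \<longrightarrow> r \<le> exp (- B * real (n j)) \<longrightarrow>
       real (card (A N \<inter> {x..x + 2 * r})) \<le> 60 * exp ((2 * ln b + \<sigma>) * real (n j)) * r * real (card (A N)))"
proof -
  have pos: "0 < b ^ k" for k using b by simp
  have \<sigma>: "0 \<le> \<sigma>" using \<tau> by simp
  define l where "l j = target_depth b \<sigma> (n (Suc j))" for j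
  define q where "q j = n (Suc j) - p j" for j
  define w where "w j = (real (q j) + 5) / b ^ q j" for j
  have pn: "p j \<le> n (Suc j)" for j using good[of j] by (simp add: good_step_def p_def)
  have wB: "w j \<le> exp (- B * real (n j))" for j
    using good[of j] by (simp only: good_step_def p_def w_def q_def Let_def)
  have Bpos: "0 \<le> B" using B \<sigma> b by (smt (verit) ln_gt_zero)
  have w1: "w j \<le> 1" for j using wB[of j] Bpos by (meson exp_le_one_iff mult_nonpos_nonneg neg_le_0_iff_le of_nat_0_le_iff order_trans)
  have pSuc: "p (Suc j) = n (Suc j) + l j" for j by (simp add: p_def l_def)
  have ql: "q j + l j = p (Suc j) - p j" for j using pn[of j] by (simp add: q_def pSuc)
  have "\<forall>j. \<exists>v. target_cyl b a \<tau> (n (Suc j)) (l j) v" using good by (auto simp: good_step_def l_def)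
  then obtain v where v: "\<And>j. target_cyl b a \<tau> (n (Suc j)) (l j) (v j)" by metis
  define P where "P j K \<longleftrightarrow> finite K \<and> K \<subseteq> full_cyl b (q j + l j) \<and> 1 / (2 * w j) \<le> real (card K) \<and>
    (\<forall>h\<in>K. h + 1 / b ^ (q j + l j) < 1 \<and>
       (\<forall>x. h \<le> x \<longrightarrow> x < h + 1 / b ^ (q j + l j) \<longrightarrow>
          v j \<le> (beta_map b ^^ q j) x \<and> (beta_map b ^^ q j) x < v j + 1 / b ^ l j)) \<and>
    (\<forall>x R. 0 \<le> R \<longrightarrow> real (card (K \<inter> {x..x + R})) \<le> R / w j + 2)" for j K
  have "\<exists>K. P j K" for j
    unfolding P_def using v[of j] w1[of j]
    by (intro equidistributed_full_cyls[OF b]) (auto simp: target_cyl_def w_def)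
  then obtain H where H: "\<And>j. P j (H j)" by metis
  note H' = H[unfolded P_def ql]
  interpret cantor_construction b p H w
  proof
    show "b > 1" by (rule b)
    show "p 0 = 0" by (simp add: p_def n0 target_depth_def)
    show "p j \<le> p (Suc j)" for j using pn[of j] by (simp add: pSuc)
    show "finite (H j)" "H j \<subseteq> full_cyl b (p (Suc j) - p j)" "1 / (2 * w j) \<le> real (card (H j))" for j
      using H'[of j] by blast+
    show "h + 1 / b ^ (p (Suc j) - p j) < 1" if "h \<in> H j" for j h using H'[of j] that by blast
    show "0 < w j" for j using pos by (simp add: w_def)
    show "real (card (H j \<inter> {x..x + R})) \<le> R / w j + 2" if "0 \<le> R" for j x R using H'[of j] that by blast
  qed
  have target: "\<bar>(beta_map b ^^ n (Suc j)) x - a\<bar> \<le> exp (- real (n (Suc j)) * \<tau>)"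
    if z: "z \<in> A (Suc j)" and x: "z \<le> x" "x < z + 1 / b ^ p (Suc j)" for j z x
  proof -
    obtain u h where uh: "u \<in> A j" "h \<in> H j" "z = u + h / b ^ p j" using z by auto
    have u: "u \<in> full_cyl b (p j)" using level_full uh(1) by blast
    have h: "h \<in> full_cyl b (q j + l j)" using uh(2) Hfull[of j] by (auto simp: ql)
    have sum: "p j + (q j + l j) = p (Suc j)" using pn[of j] by (simp add: q_def pSuc)
    define y where "y = (beta_map b ^^ p j) x"
    have y: "h \<le> y" "y < h + 1 / b ^ (q j + l j)"
      using full_cyl_compose(2)[OF b u h, of x] x unfolding uh(3) sum y_def by auto
    have "v j \<le> (beta_map b ^^ q j) y" "(beta_map b ^^ q j) y < v j + 1 / b ^ l j"
      using H[of j] uh(2) y unfolding P_def by blast+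
    moreover have "(beta_map b ^^ q j) y = (beta_map b ^^ n (Suc j)) x"
    proof -
      have "n (Suc j) = q j + p j" using pn[of j] by (simp add: q_def)
      then show ?thesis by (simp add: y_def funpow_add)
    qed
    ultimately show ?thesis using v[of j] by (simp add: target_cyl_def)
  qed
  have bp: "b ^ p j \<le> exp ((2 * ln b + \<sigma>) * real (n j))" for j
    using target_depth_bounds(5)[OF b \<sigma>, of "n j"] by (simp add: p_def mult.commute)
  have bpB: "exp ((2 * ln b + \<sigma>) * real (n j)) \<le> exp (B * real (n j))" for j
    using B by (simp add: mult_right_mono)
  \<comment> \<open>This is what the lower bound on \<open>B\<close> is for: radii up to exp (- B
    n_j) do not exceed the length of a cell of level \<open>j\<close>.\<close>
  have expB: "exp (- B * real (n j)) \<le> 1 / b ^ p j" for j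
  proof -
    have "b ^ p j \<le> exp (B * real (n j))" using bp[of j] bpB[of j] by linarith
    then have "1 / exp (B * real (n j)) \<le> 1 / b ^ p j" using pos by (intro frac_le) auto
    then show ?thesis by (simp add: exp_minus field_simps)
  qed
  have wle: "w j \<le> (real (n (Suc j)) + 5) * b ^ p j / b ^ n (Suc j)" for j
  proof -
    have "b ^ q j = b ^ n (Suc j) / b ^ p j" using b pn[of j] by (simp add: q_def power_diff)
    then have "w j = (real (q j) + 5) * b ^ p j / b ^ n (Suc j)" by (simp add: w_def)
    also have "\<dots> \<le> (real (n (Suc j)) + 5) * b ^ p j / b ^ n (Suc j)"
      using less_imp_le[OF pos] by (intro divide_right_mono mult_right_mono) (auto simp: q_def)
    finally show ?thesis .
  qed
  have ratio: "X / real (card (A j)) \<le> X" if "0 \<le> X" for X :: real and j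
  proof -
    have "1 \<le> real (card (A j))" using level_card_pos[of j] by linarith
    then have "X / real (card (A j)) \<le> X / 1" using that by (intro frac_le) auto
    then show ?thesis by simp
  qed
  \<comment> \<open>Radii at least the length of a cell of level \<open>Suc j\<close>. Up to losses
    in \<open>n j\<close> and a linear factor, the window holds a proportion \<open>r\<close> of
    these cells, or a single one with share \<open>1 / b ^ n (Suc j)\<close>.\<close>
  have fine: "real (card (A N \<inter> {x..x + 2 * r})) \<le>
      30 * b ^ p j * (r + (real (n (Suc j)) + 5) / b ^ n (Suc j)) * real (card (A N))"
    if N: "j + 2 \<le> N" and r: "1 / b ^ p (Suc j) \<le> r" "r \<le> exp (- B * real (n j))" for j N x r
  proof -
    have r0: "0 \<le> r" using r(1) pos[of "p (Suc j)"] by (smt (verit) divide_pos_pos)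
    have "real (card (A N \<inter> {x..x + 2 * r})) \<le> (30 * r * b ^ p j + 20 * w j) / real (card (A j)) * real (card (A N))"
      using r expB[of j] N by (intro level_count) auto
    also have "\<dots> \<le> (30 * b ^ p j * (r + (real (n (Suc j)) + 5) / b ^ n (Suc j))) * real (card (A N))"
    proof (intro mult_right_mono)
      have "(30 * r * b ^ p j + 20 * w j) / real (card (A j)) \<le> 30 * r * b ^ p j + 20 * w j"
        using r0 pos[of "p j"] w0[of j] by (intro ratio add_nonneg_nonneg) auto
      also have "\<dots> \<le> 30 * r * b ^ p j + 30 * ((real (n (Suc j)) + 5) * b ^ p j / b ^ n (Suc j))"
        using wle[of j] w0[of j] by linarith
      also have "\<dots> = 30 * b ^ p j * (r + (real (n (Suc j)) + 5) / b ^ n (Suc j))"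
        by (simp add: algebra_simps)
      finally show "(30 * r * b ^ p j + 20 * w j) / real (card (A j)) \<le>
        30 * b ^ p j * (r + (real (n (Suc j)) + 5) / b ^ n (Suc j))" .
    qed simp
    finally show ?thesis .
  qed
  \<comment> \<open>Radii below the length of a cell of level \<open>Suc j\<close> but not below the
    spacing of its children: the mass looks uniform inside the cell, so the window takes a fraction
    of order \<open>r * b ^ p (Suc j)\<close> of one cell, whose own share is at most
    \<open>2 * w j\<close>.\<close>
  have coarse: "real (card (A N \<inter> {x..x + 2 * r})) \<le>
      100 * (real (n (Suc j)) + 5) * b ^ p j * (r * b ^ l j) * real (card (A N))"
    if N: "j + 2 \<le> N" and r: "r \<le> 1 / b ^ p (Suc j)" "exp (- B * real (n (Suc j))) \<le> r" for j N x r
  proof -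
    have r0: "0 \<le> r" using r(2) by (smt (verit) exp_gt_zero)
    have wr: "w (Suc j) \<le> r" using wB[of "Suc j"] r(2) by linarith
    have "q (Suc j) \<le> p (Suc (Suc j))" using pSuc[of "Suc j"] by (simp add: q_def)
    then have "1 / b ^ p (Suc (Suc j)) \<le> 1 / b ^ q (Suc j)"
      using b by (intro frac_le power_increasing) auto
    also have "\<dots> \<le> w (Suc j)" unfolding w_def using less_imp_le[OF pos] by (intro divide_right_mono) auto
    finally have r2: "1 / b ^ p (Suc (Suc j)) \<le> r" using wr by linarith
    have "real (card (A N \<inter> {x..x + 2 * r})) \<le>
       (30 * r * b ^ p (Suc j) + 20 * w (Suc j)) / real (card (A (Suc j))) * real (card (A N))"
      using r r2 N by (intro level_count) auto
    also have "\<dots> \<le> (100 * (real (n (Suc j)) + 5) * b ^ p j * (r * b ^ l j)) * real (card (A N))"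
    proof (intro mult_right_mono)
      have c: "1 / (2 * w j) \<le> real (card (A (Suc j)))"
      proof -
        have "1 \<le> card (A j)" using level_card_pos[of j] by simp
        then have "card (H j) \<le> card (A (Suc j))" unfolding level_card_Suc by simp
        then show ?thesis using Hcard[of j] by linarith
      qed
      have "1 * r \<le> b ^ p (Suc j) * r" using b r0 by (intro mult_right_mono) (auto simp: one_le_power)
      then have "30 * r * b ^ p (Suc j) + 20 * w (Suc j) \<le> 50 * (r * b ^ p (Suc j))"
        using wr by (simp add: mult.commute)
      then have "(30 * r * b ^ p (Suc j) + 20 * w (Suc j)) / real (card (A (Suc j))) \<le>
          50 * (r * b ^ p (Suc j)) / (1 / (2 * w j))"
        using c w0[of j] r0 pos[of "p (Suc j)"] by (intro frac_le) auto
      also have "\<dots> = 100 * (r * b ^ p (Suc j)) * w j" using w0[of j] by simp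
      also have "\<dots> \<le> 100 * (r * b ^ p (Suc j)) * ((real (n (Suc j)) + 5) * b ^ p j / b ^ n (Suc j))"
        using wle[of j] r0 pos[of "p (Suc j)"] by (intro mult_left_mono) auto
      also have "\<dots> = 100 * (real (n (Suc j)) + 5) * b ^ p j * (r * b ^ l j)"
        using b by (simp add: pSuc power_add)
      finally show "(30 * r * b ^ p (Suc j) + 20 * w (Suc j)) / real (card (A (Suc j))) \<le>
          100 * (real (n (Suc j)) + 5) * b ^ p j * (r * b ^ l j)" .
    qed simp
    finally show ?thesis .
  qed
  have main1: "real (card (A N \<inter> {x..x + 2 * exp (- real (n (Suc j)) * L)})) \<le>
         100 * b * (real (n (Suc j)) + 5) * exp (B * real (n j)) *
           exp (- real (n (Suc j)) * loc_exp b \<sigma> L) * real (card (A N))"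
    if N: "j + 2 \<le> N" and r1: "exp (- B * real (n (Suc j))) \<le> exp (- real (n (Suc j)) * L)"
      and r2: "exp (- real (n (Suc j)) * L) \<le> exp (- B * real (n j))" for j N x L
  proof -
    define m where "m = n (Suc j)"
    define r where "r = exp (- real m * L)"
    \<comment> \<open>This is \<open>exp (- real m * loc_exp b \<sigma> L)\<close> with
      \<open>b ^ l j\<close> in place of exp (m \<sigma>), so it exceeds that value by at most the
      rounding factor \<open>b\<close>. It unites the two ranges of radii.\<close>
    define Z where "Z = max r (min (1 / b ^ m) (r * b ^ l j))"
    have r0: "0 < r" by (simp add: r_def)
    have Z0: "0 \<le> Z" using r0 by (simp add: Z_def)
    have bound: "real (card (A N \<inter> {x..x + 2 * r})) \<le> 100 * (real m + 5) * b ^ p j * Z * real (card (A N))"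
    proof (cases "1 / b ^ p (Suc j) \<le> r")
      case True
      have "1 / b ^ m \<le> r * b ^ l j"
        using True pos by (simp add: pSuc m_def[symmetric] power_add field_simps)
      then have Z: "Z = max r (1 / b ^ m)" by (simp add: Z_def min_def)
      have "r + (real m + 5) / b ^ m \<le> Z + (real m + 5) * Z"
      proof (rule add_mono)
        have "(real m + 5) * (1 / b ^ m) \<le> (real m + 5) * Z" by (intro mult_left_mono) (auto simp: Z)
        then show "(real m + 5) / b ^ m \<le> (real m + 5) * Z" by simp
      qed (simp add: Z)
      also have "\<dots> \<le> 3 * ((real m + 5) * Z)" using Z0 by (simp add: algebra_simps)
      finally have "r + (real m + 5) / b ^ m \<le> 3 * ((real m + 5) * Z)" .
      then have "30 * b ^ p j * (r + (real m + 5) / b ^ m) \<le> 30 * b ^ p j * (3 * ((real m + 5) * Z))"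
        using pos[of "p j"] by (intro mult_left_mono) auto
      also have "\<dots> = 90 * ((real m + 5) * b ^ p j * Z)" by (simp add: algebra_simps)
      also have "\<dots> \<le> 100 * ((real m + 5) * b ^ p j * Z)"
        using Z0 pos[of "p j"] by (intro mult_right_mono mult_nonneg_nonneg) auto
      finally have "30 * b ^ p j * (r + (real m + 5) / b ^ m) \<le> 100 * (real m + 5) * b ^ p j * Z"
        by (simp only: mult.assoc)
      then have "30 * b ^ p j * (r + (real m + 5) / b ^ m) * real (card (A N)) \<le>
          100 * (real m + 5) * b ^ p j * Z * real (card (A N))" by (intro mult_right_mono) auto
      moreover have "real (card (A N \<inter> {x..x + 2 * r})) \<le> 30 * b ^ p j * (r + (real m + 5) / b ^ m) * real (card (A N))"
        unfolding m_def using r2 True by (intro fine N) (auto simp: r_def m_def)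
      ultimately show ?thesis by linarith
    next
      case False
      have "r * b ^ l j \<le> 1 / b ^ m"
        using False pos by (simp add: pSuc m_def[symmetric] power_add field_simps)
      then have "r * b ^ l j \<le> Z" by (simp add: Z_def min_def)
      then have "100 * (real m + 5) * b ^ p j * (r * b ^ l j) * real (card (A N)) \<le> 100 * (real m + 5) * b ^ p j * Z * real (card (A N))"
        using pos[of "p j"] by (intro mult_right_mono mult_left_mono) auto
      moreover have "real (card (A N \<inter> {x..x + 2 * r})) \<le> 100 * (real m + 5) * b ^ p j * (r * b ^ l j) * real (card (A N))"
        unfolding m_def using r1 False by (intro coarse N) (auto simp: r_def m_def)
      ultimately show ?thesis by linarith
    qed
    have "Z \<le> b * exp (- real m * loc_exp b \<sigma> L)"
    proof -
      have pw: "b ^ m = exp (real m * ln b)" using b by (simp add: exp_of_nat_mult)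
      have e1: "r \<le> exp (- real m * loc_exp b \<sigma> L)"
        unfolding r_def by (simp add: loc_exp_def mult_left_mono)
      have e2: "min (1 / b ^ m) (r * exp (real m * \<sigma>)) \<le> exp (- real m * loc_exp b \<sigma> L)"
      proof (cases "ln b \<le> L - \<sigma>")
        case True
        have "r * exp (real m * \<sigma>) = exp (- real m * (L - \<sigma>))"
          by (simp add: r_def exp_add[symmetric] algebra_simps)
        also have "\<dots> \<le> exp (- real m * loc_exp b \<sigma> L)" using True
          by (simp add: loc_exp_def mult_left_mono)
        finally show ?thesis by linarith
      next
        case False
        have "1 / b ^ m = exp (- real m * ln b)" unfolding pw by (simp add: exp_minus field_simps)
        also have "\<dots> \<le> exp (- real m * loc_exp b \<sigma> L)" using False
          by (simp add: loc_exp_def mult_left_mono)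
        finally show ?thesis by linarith
      qed
      have lb: "b ^ l j \<le> b * exp (real m * \<sigma>)"
        using target_depth_bounds(3)[OF b \<sigma>, of m] by (simp add: l_def m_def)
      have "r * b ^ l j \<le> b * (r * exp (real m * \<sigma>))"
        using mult_left_mono[OF lb, of r] r0 by (simp add: mult_ac)
      moreover have "1 / b ^ m \<le> b * (1 / b ^ m)" using b pos[of m] by (simp add: divide_right_mono)
      ultimately have "min (1 / b ^ m) (r * b ^ l j) \<le> b * min (1 / b ^ m) (r * exp (real m * \<sigma>))"
        by (auto simp: min_def)
      also have "\<dots> \<le> b * exp (- real m * loc_exp b \<sigma> L)" using e2 b by (intro mult_left_mono) auto
      finally have "min (1 / b ^ m) (r * b ^ l j) \<le> b * exp (- real m * loc_exp b \<sigma> L)" .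
      moreover have "1 * exp (- real m * loc_exp b \<sigma> L) \<le> b * exp (- real m * loc_exp b \<sigma> L)"
        using b by (intro mult_right_mono) auto
      then have "r \<le> b * exp (- real m * loc_exp b \<sigma> L)" using e1 by linarith
      ultimately show ?thesis by (simp add: Z_def)
    qed
    moreover have "b ^ p j \<le> exp (B * real (n j))" using bp[of j] bpB[of j] by linarith
    ultimately have "100 * (real m + 5) * b ^ p j * Z * real (card (A N)) \<le>
       100 * (real m + 5) * exp (B * real (n j)) * (b * exp (- real m * loc_exp b \<sigma> L)) * real (card (A N))"
      using Z0 pos[of "p j"] b by (intro mult_mono mult_nonneg_nonneg) auto
    then show ?thesis using bound unfolding r_def m_def by (simp add: mult_ac)
  qed
  \<comment> \<open>Here \<open>r\<close> dominates the whole term with the linear factor, so the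
    bound is linear in \<open>r\<close> with a loss depending on \<open>n j\<close> only.\<close>
  have main2: "real (card (A N \<inter> {x..x + 2 * r})) \<le> 60 * exp ((2 * ln b + \<sigma>) * real (n j)) * r * real (card (A N))"
    if N: "j + 2 \<le> N" and r: "(real (n (Suc j)) + 5) / b ^ n (Suc j) \<le> r" "r \<le> exp (- B * real (n j))" for j N x r
  proof -
    have "1 / b ^ p (Suc j) \<le> (real (n (Suc j)) + 5) / b ^ n (Suc j)"
      using b by (intro frac_le power_increasing) (auto simp: pSuc)
    then have r1: "1 / b ^ p (Suc j) \<le> r" using r(1) by linarith
    have r0: "0 \<le> r" using r1 pos[of "p (Suc j)"] by (smt (verit) divide_pos_pos)
    have "real (card (A N \<inter> {x..x + 2 * r})) \<le>
      30 * b ^ p j * (r + (real (n (Suc j)) + 5) / b ^ n (Suc j)) * real (card (A N))"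
      by (intro fine N r1 r)
    also have "\<dots> \<le> 30 * exp ((2 * ln b + \<sigma>) * real (n j)) * (r + r) * real (card (A N))"
      using bp[of j] r(1) r0 pos[of "p j"] pos[of "n (Suc j)"] by (intro mult_mono mult_nonneg_nonneg add_mono add_nonneg_nonneg) auto
    finally show ?thesis by (simp add: mult_ac)
  qed
  show ?thesis
  proof (intro exI[of _ A] conjI allI ballI impI)
    show "finite (A j)" "A j \<noteq> {}" "A j \<subseteq> full_cyl b (p j)" for j
      using level_finite level_card_pos[of j] level_full by auto
  qed (use level_parent target main1 main2 in \<open>blast+\<close>)
qed

section \<open>The lower bound\<close>

lemma Rep_torus_range: "0 \<le> Rep_torus x $ i" "Rep_torus x $ i < 1"
  using Rep_torus[of x] by auto

lemma Rep_torus_of: "Rep_torus (torus_of v) $ i = frac (v $ i)"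
  unfolding torus_of_def by (subst Abs_torus_inverse) (auto simp: frac_lt_1)

lemma dist_torus_of_le: "dist (torus_of x) (torus_of y) \<le> dist x y"
proof -
  have "dist_int (frac a - frac b) \<le> \<bar>a - b\<bar>" for a b :: real
  proof -
    have "dist_int (frac a - frac b) \<le> \<bar>frac a - frac b - of_int (\<lfloor>b\<rfloor> - \<lfloor>a\<rfloor>)\<bar>"
      by (rule dist_int_le) simp
    then show ?thesis by (simp add: frac_def)
  qed
  then show ?thesis unfolding dist_torus_def dist_vec_def
    by (intro L2_set_mono) (auto simp: Rep_torus_of dist_real_def)
qed

lemma dist_int_le_dist_torus: "dist_int (Rep_torus x $ i - Rep_torus y $ i) \<le> dist x y"
  unfolding dist_torus_def by (rule member_le_L2_set) auto

text \<open>Covering sets on the torus are pulled back to open sets of R^d, where the closed cells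
  form compact sets.\<close>

lemma open_torus_nbhd: "open {x. \<exists>y\<in>U. dist (torus_of x) y < e}"
  unfolding open_dist
proof (clarify)
  fix x y assume y: "y \<in> U" "dist (torus_of x) y < e"
  have "dist (torus_of x') y < e" if "dist x' x < e - dist (torus_of x) y" for x'
    using dist_triangle[of "torus_of x'" y "torus_of x"] dist_torus_of_le[of x' x] that by linarith
  then show "\<exists>e'>0. \<forall>x'. dist x' x < e' \<longrightarrow> x' \<in> {x. \<exists>y\<in>U. dist (torus_of x) y < e}"
    using y by (intro exI[of _ "e - dist (torus_of x) y"]) auto
qed

text \<open>Mass distribution: counting corners of cells at a deep level replaces the measure of a ball,
  and compactness reduces a countable cover to that level.\<close>

lemma hausdorff_measure_product_cantor_pos:
  fixes A :: "'d::finite \<Rightarrow> nat \<Rightarrow> real set" and g :: "'d \<Rightarrow> nat \<Rightarrow> real" and W :: "'d torus set"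
  assumes s: "0 < s" and C: "1 \<le> C" and g: "\<And>k N. 0 \<le> g k N"
    and fin: "\<And>k N. finite (A k N)" and ne: "\<And>k N. A k N \<noteq> {}"
    and sub: "\<And>k N z. z \<in> A k N \<Longrightarrow> 0 \<le> z \<and> z < 1 \<and> z + g k N \<le> 1"
    and nest: "\<And>k N z. z \<in> A k (Suc N) \<Longrightarrow> \<exists>u\<in>A k N. u \<le> z \<and> z + g k (Suc N) < u + g k N"
    and count: "\<And>r. 0 < r \<Longrightarrow> r \<le> 1 \<Longrightarrow> \<exists>N0. \<forall>N\<ge>N0. \<forall>x.
      (\<Prod>k\<in>UNIV. real (card (A k N \<inter> {x k..x k + 2 * r}))) \<le> C * r powr s * (\<Prod>k\<in>UNIV. real (card (A k N)))"
    and W: "\<And>x. (\<And>k N. \<exists>u\<in>A k N. u \<le> Rep_torus x $ k \<and> Rep_torus x $ k < u + g k N) \<Longrightarrow> x \<in> W"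
  shows "hausdorff_measure s W \<noteq> 0"
proof
  assume H0: "hausdorff_measure s W = 0"
  \<comment> \<open>The power of 3 counts the integer translates through which a small ball of the
    torus is seen in the unit cube.\<close>
  define C' where "C' = 3 ^ CARD('d) * C"
  have C'1: "1 \<le> C'"
  proof -
    have "1 * 1 \<le> 3 ^ CARD('d) * C" using C by (intro mult_mono) auto
    then show ?thesis by (simp add: C'_def)
  qed
  \<comment> \<open>The cover and its enlargement below contribute at most \<epsilon> each, and
    together they have to stay under \<open>1 / C'\<close>.\<close>
  define \<epsilon> where "\<epsilon> = 1 / (2 * C')"
  have \<epsilon>: "0 < \<epsilon>" using C'1 by (simp add: \<epsilon>_def)
  have "hausdorff_premeasure s 1 W \<le> hausdorff_measure s W"
    unfolding hausdorff_measure_def by (intro SUP_upper) simp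
  then have "hausdorff_premeasure s 1 W < ennreal \<epsilon>" using H0 \<epsilon> by simp
  then obtain U :: "nat \<Rightarrow> 'd torus set" where U: "W \<subseteq> (\<Union>n. U n)" "\<And>n. bounded (U n)"
    and Usum: "(\<Sum>n. ennreal (diam_power s (U n))) < ennreal \<epsilon>"
    unfolding hausdorff_premeasure_def INF_less_iff by blast
  define d where "d n = diameter (U n)" for n
  \<comment> \<open>Radii slightly larger than the diameters make the covering sets open and the
    radii positive, even for single points.\<close>
  define \<eta> where "\<eta> n = \<epsilon> * (1 / 2) ^ Suc n" for n
  define r where "r n = (d n powr s + \<eta> n) powr (1 / s)" for n
  have d0: "0 \<le> d n" for n unfolding d_def by (rule diameter_ge_0[OF U(2)])
  have \<eta>0: "0 < \<eta> n" for n using \<epsilon> by (simp add: \<eta>_def)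
  have base0: "0 < d n powr s + \<eta> n" for n using \<eta>0[of n] by (simp add: add_nonneg_pos)
  have rs: "r n powr s = d n powr s + \<eta> n" for n
    using s base0[of n] by (simp add: r_def powr_powr)
  have r0: "0 < r n" for n using base0[of n] by (simp add: r_def)
  have dr: "d n < r n" for n
  proof -
    have "d n powr s < r n powr s" using rs \<eta>0[of n] by simp
    then show ?thesis using s d0[of n] r0[of n] by (smt (verit) powr_mono2)
  qed
  define V where "V n = {x :: real ^ 'd. \<exists>y\<in>U n. dist (torus_of x) y < r n - d n}" for n
  have Vopen: "open (V n)" for n unfolding V_def by (rule open_torus_nbhd)
  define K where "K N = {x :: real ^ 'd. \<forall>k. \<exists>u\<in>A k N. u \<le> x $ k \<and> x $ k \<le> u + g k N}" for N
  have Kcompact: "compact (K N)" for N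
  proof -
    have "K N = (\<Inter>k. (\<lambda>x. x $ k) -` (\<Union>u\<in>A k N. {u..u + g k N}))" by (auto simp: K_def)
    moreover have "closed ((\<lambda>x :: real ^ 'd. x $ k) -` (\<Union>u\<in>A k N. {u..u + g k N}))" for k
      by (intro closed_vimage closed_UN fin ballI closed_atLeastAtMost continuous_intros)
    ultimately have "closed (K N)" by (simp add: closed_INT)
    moreover have "K N \<subseteq> cbox 0 1"
    proof
      fix x assume x: "x \<in> K N"
      have "0 \<le> x $ k \<and> x $ k \<le> 1" for k
      proof -
        obtain u where "u \<in> A k N" "u \<le> x $ k" "x $ k \<le> u + g k N" using x by (auto simp: K_def)
        then show ?thesis using sub[of u k N] by linarith
      qed
      then show "x \<in> cbox 0 1" by (simp add: mem_box_cart)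
    qed
    ultimately show ?thesis using bounded_subset[OF bounded_cbox] compact_eq_bounded_closed by blast
  qed
  have Kdec1: "K (Suc N) \<subseteq> K N" for N
  proof
    fix x assume x: "x \<in> K (Suc N)"
    have "\<exists>u\<in>A k N. u \<le> x $ k \<and> x $ k \<le> u + g k N" for k
    proof -
      obtain z where z: "z \<in> A k (Suc N)" "z \<le> x $ k" "x $ k \<le> z + g k (Suc N)" using x by (auto simp: K_def)
      obtain u where u: "u \<in> A k N" "u \<le> z" "z + g k (Suc N) < u + g k N" using nest[OF z(1)] by blast
      then have "u \<le> x $ k" "x $ k < u + g k N" using z(2,3) by linarith+
      then show ?thesis using u(1) by (blast intro: less_imp_le)
    qed
    then show "x \<in> K N" by (simp add: K_def)
  qed
  have Kdec: "K N \<subseteq> K M" if "M \<le> N" for M N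
    using lift_Suc_antimono_le[of K, OF Kdec1 that] .
  \<comment> \<open>Strict nesting: a point of the closed cells of level \<open>Suc N\<close> lies
    in the half-open cells of level \<open>N\<close>. So a point of all \<open>K N\<close> lies in
    [0, 1)^d and projects into \<open>W\<close>.\<close>
  have Kcov: "x \<in> (\<Union>n. V n)" if x: "\<And>N. x \<in> K N" for x
  proof -
    have strict: "\<exists>u\<in>A k N. u \<le> x $ k \<and> x $ k < u + g k N" for k N
    proof -
      obtain z where z: "z \<in> A k (Suc N)" "z \<le> x $ k" "x $ k \<le> z + g k (Suc N)"
        using x[of "Suc N"] by (auto simp: K_def)
      obtain u where u: "u \<in> A k N" "u \<le> z" "z + g k (Suc N) < u + g k N" using nest[OF z(1)] by blast
      then have "u \<le> x $ k" "x $ k < u + g k N" using z(2,3) by linarith+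
      then show ?thesis using u(1) by (blast intro: less_imp_le)
    qed
    have "0 \<le> x $ k \<and> x $ k < 1" for k
    proof -
      obtain u where "u \<in> A k 0" "u \<le> x $ k" "x $ k < u + g k 0" using strict[of k 0] by blast
      then show ?thesis using sub[of u k 0] by linarith
    qed
    then have "Rep_torus (torus_of x) $ k = x $ k" for k by (simp add: Rep_torus_of frac_eq)
    then have "torus_of x \<in> W" using strict by (intro W) simp
    then obtain n where "torus_of x \<in> U n" using U(1) by blast
    then have "x \<in> V n" unfolding V_def using dr[of n] by force
    then show ?thesis by blast
  qed
  \<comment> \<open>Compactness: otherwise the sets \<open>K N\<close> minus the first
    \<open>N\<close> open sets would be a decreasing sequence of nonempty compact sets.\<close>
  have "\<exists>M. K M \<subseteq> (\<Union>n<M. V n)"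
  proof (rule ccontr)
    assume no: "\<nexists>M. K M \<subseteq> (\<Union>n<M. V n)"
    define F where "F N = K N - (\<Union>n<N. V n)" for N
    have "\<Inter>(range F) \<noteq> {}"
    proof (rule compact_nest)
      show "compact (F N)" for N unfolding F_def
        by (intro compact_diff Kcompact open_UN ballI Vopen)
      show "F N \<noteq> {}" for N using no unfolding F_def by blast
      show "F N \<subseteq> F M" if "M \<le> N" for M N
        using Kdec[OF that] that unfolding F_def by fastforce
    qed
    then obtain x where x: "\<And>N. x \<in> F N" by blast
    then have "\<And>N. x \<in> K N" by (simp add: F_def)
    then obtain n where "x \<in> V n" using Kcov by blast
    then show False using x[of "Suc n"] by (auto simp: F_def)
  qed
  then obtain M where M: "K M \<subseteq> (\<Union>n<M. V n)" ..
  define small where "small n N \<longleftrightarrow> (\<forall>x. (\<Prod>k\<in>UNIV. real (card (A k N \<inter> {x k..x k + 2 * r n})))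
      \<le> C * r n powr s * (\<Prod>k\<in>UNIV. real (card (A k N))))" for n N
  have "\<forall>n. \<exists>N0. r n \<le> 1 \<longrightarrow> (\<forall>N\<ge>N0. small n N)"
    unfolding small_def using count[OF r0] by blast
  then obtain N0 where "\<And>n N. r n \<le> 1 \<Longrightarrow> N0 n \<le> N \<Longrightarrow> small n N"
    by metis
  then have N0: "(\<Prod>k\<in>UNIV. real (card (A k N \<inter> {x k..x k + 2 * r n})))
      \<le> C * r n powr s * (\<Prod>k\<in>UNIV. real (card (A k N)))" if "r n \<le> 1" "N0 n \<le> N" for n N x
    using that by (simp add: small_def)
  \<comment> \<open>Only finitely many sets are left, so one level is deep enough for the counts at
    all their radii up to 1.\<close>
  define N where "N = M + (\<Sum>n<M. N0 n)"
  have NN0: "N0 n \<le> N" if "n < M" for n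
    using member_le_sum[of n "{..<M}" N0] that by (simp add: N_def)
  define P where "P = PiE (UNIV :: 'd set) (\<lambda>k. A k N)"
  define Pn where "Pn n = {f \<in> P. vec_lambda f \<in> V n}" for n
  have finP: "finite P" unfolding P_def by (intro finite_PiE fin) simp
  have cardP: "real (card P) = (\<Prod>k\<in>UNIV. real (card (A k N)))" unfolding P_def by (simp add: card_PiE)
  have cardP0: "0 < real (card P)" unfolding cardP using fin ne by (intro prod_pos) (simp add: card_gt_0_iff)
  have Psub: "P \<subseteq> (\<Union>n<M. Pn n)"
  proof
    fix f assume f: "f \<in> P"
    have "f k \<in> A k N" for k using f by (auto simp: P_def)
    then have "\<exists>u\<in>A k N. u \<le> f k \<and> f k \<le> u + g k N" for k
      using g[of k N] by (intro bexI[of _ "f k"]) auto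
    then have "vec_lambda f \<in> K N" by (simp add: K_def)
    then have "vec_lambda f \<in> (\<Union>n<M. V n)" using M Kdec[of M N] by (auto simp: N_def)
    then show "f \<in> (\<Union>n<M. Pn n)" using f by (auto simp: Pn_def)
  qed
  have Pn_le: "real (card (Pn n)) \<le> C' * (diam_power s (U n) + \<eta> n) * real (card P)" if n: "n < M" for n
  proof (cases "U n = {}")
    case True
    then have "Pn n = {}" by (auto simp: Pn_def V_def)
    then show ?thesis using \<eta>0[of n] C'1 by (simp add: True diam_power_def)
  next
    case False
    then have dp: "diam_power s (U n) + \<eta> n = r n powr s" using s rs by (simp add: diam_power_def d_def)
    show ?thesis unfolding dp
    proof (cases "r n \<le> 1")
      case False
      then have "1 \<le> r n powr s" using s by (simp add: ge_one_powr_ge_zero)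
      then have "1 * 1 \<le> C' * r n powr s" using C'1 by (intro mult_mono) auto
      then have "1 * real (card P) \<le> C' * r n powr s * real (card P)" by (intro mult_right_mono) auto
      moreover have "card (Pn n) \<le> card P" by (intro card_mono finP) (auto simp: Pn_def)
      ultimately show "real (card (Pn n)) \<le> C' * r n powr s * real (card P)" by linarith
    next
      case True
      obtain y0 where y0: "y0 \<in> U n" using False by blast
      define I where "I = PiE (UNIV :: 'd set) (\<lambda>_. {-1, 0, 1 :: int})"
      define X where "X m k = Rep_torus y0 $ k + of_int (m k) - r n" for m k
      define Q where "Q m = PiE (UNIV :: 'd set) (\<lambda>k. A k N \<inter> {X m k..X m k + 2 * r n})" for m :: "'d \<Rightarrow> int"
      have finI: "finite I" unfolding I_def by (intro finite_PiE) auto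
      have cardI: "real (card I) = 3 ^ CARD('d)" unfolding I_def by (simp add: card_PiE)
      have sub': "Pn n \<subseteq> (\<Union>m\<in>I. Q m)"
      proof
        fix f assume f: "f \<in> Pn n"
        then obtain y where y: "y \<in> U n" "dist (torus_of (vec_lambda f)) y < r n - d n" by (auto simp: Pn_def V_def)
        have "dist y y0 \<le> d n" unfolding d_def using diameter_bounded_bound[OF U(2) y(1) y0] .
        then have dist: "dist (torus_of (vec_lambda f)) y0 < r n"
          using y(2) dist_triangle[of "torus_of (vec_lambda f)" y0 y] by linarith
        have fA: "f k \<in> A k N" for k using f by (auto simp: Pn_def P_def)
        have "\<exists>m\<in>{-1, 0, 1::int}. \<bar>f k - Rep_torus y0 $ k - of_int m\<bar> < r n" for k
        proof -
          have fk: "0 \<le> f k" "f k < 1" using sub[OF fA[of k]] by auto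
          then have "Rep_torus (torus_of (vec_lambda f)) $ k = f k" by (simp add: Rep_torus_of frac_eq)
          then have "dist_int (f k - Rep_torus y0 $ k) < r n"
            using dist dist_int_le_dist_torus[of "torus_of (vec_lambda f)" k y0] by simp
          then show ?thesis
            using dist_int_unit_cases[OF fk Rep_torus_range[of y0 k]] by metis
        qed
        then obtain m where m: "\<And>k. m k \<in> {-1, 0, 1::int}" "\<And>k. \<bar>f k - Rep_torus y0 $ k - of_int (m k)\<bar> < r n"
          by metis
        have "m \<in> I" using m(1) by (auto simp: I_def)
        moreover have "f \<in> Q m"
        proof -
          have "f k \<in> A k N \<inter> {X m k..X m k + 2 * r n}" for k
            using fA[of k] m(2)[of k] by (auto simp: X_def abs_less_iff)
          then show ?thesis unfolding Q_def by (intro PiE_I) simp_all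
        qed
        ultimately show "f \<in> (\<Union>m\<in>I. Q m)" by blast
      qed
      have finQ: "finite (Q m)" for m unfolding Q_def by (intro finite_PiE) (auto simp: fin)
      have "card (Pn n) \<le> card (\<Union>m\<in>I. Q m)" by (intro card_mono sub') (simp add: finI finQ)
      also have "\<dots> \<le> (\<Sum>m\<in>I. card (Q m))" by (rule card_UN_le[OF finI])
      finally have "real (card (Pn n)) \<le> (\<Sum>m\<in>I. real (card (Q m)))" by (metis of_nat_le_iff of_nat_sum)
      also have "\<dots> \<le> (\<Sum>m\<in>I. C * r n powr s * real (card P))"
        unfolding cardP using N0[OF True NN0[OF n]] by (intro sum_mono) (simp add: Q_def card_PiE)
      also have "\<dots> = C' * r n powr s * real (card P)" by (simp add: cardI C'_def)
      finally show "real (card (Pn n)) \<le> C' * r n powr s * real (card P)" .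
    qed
  qed
  have dp0: "0 \<le> diam_power s (U n)" for n by (simp add: diam_power_def)
  have "card P \<le> card (\<Union>n<M. Pn n)" using finP by (intro card_mono Psub) (auto simp: Pn_def)
  also have "\<dots> \<le> (\<Sum>n<M. card (Pn n))" by (rule card_UN_le) simp
  finally have "real (card P) \<le> (\<Sum>n<M. real (card (Pn n)))" by (metis of_nat_le_iff of_nat_sum)
  also have "\<dots> \<le> (\<Sum>n<M. C' * (diam_power s (U n) + \<eta> n) * real (card P))"
    by (intro sum_mono Pn_le) simp
  also have "\<dots> = C' * ((\<Sum>n<M. diam_power s (U n)) + (\<Sum>n<M. \<eta> n)) * real (card P)"
    by (simp add: sum_distrib_left sum_distrib_right sum.distrib distrib_left distrib_right)
  finally have "1 * real (card P) \<le> C' * ((\<Sum>n<M. diam_power s (U n)) + (\<Sum>n<M. \<eta> n)) * real (card P)" by simp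
  then have ge: "1 \<le> C' * ((\<Sum>n<M. diam_power s (U n)) + (\<Sum>n<M. \<eta> n))"
    using cardP0 by (simp only: mult_le_cancel_right_pos)
  have "ennreal (\<Sum>n<M. diam_power s (U n)) = (\<Sum>n<M. ennreal (diam_power s (U n)))"
    using dp0 by (simp add: sum_ennreal)
  also have "\<dots> \<le> (\<Sum>n. ennreal (diam_power s (U n)))" by (rule sum_le_suminf) auto
  finally have "ennreal (\<Sum>n<M. diam_power s (U n)) < ennreal \<epsilon>" using Usum by (rule le_less_trans)
  then have "(\<Sum>n<M. diam_power s (U n)) < \<epsilon>" using dp0 \<epsilon> by (simp add: ennreal_less_iff sum_nonneg)
  moreover have "(\<Sum>n<M. \<eta> n) \<le> \<epsilon>"
  proof -
    have "(\<Sum>n<M. \<eta> n) = \<epsilon> * (1 - (1 / 2) ^ M)" by (induction M) (simp_all add: \<eta>_def algebra_simps)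
    also have "\<dots> \<le> \<epsilon> * 1" using \<epsilon> by (intro mult_left_mono) auto
    finally show ?thesis by simp
  qed
  ultimately have "C' * ((\<Sum>n<M. diam_power s (U n)) + (\<Sum>n<M. \<eta> n)) < C' * (\<epsilon> + \<epsilon>)"
    using C'1 by (intro mult_strict_left_mono) auto
  also have "\<dots> = 1" using C'1 by (simp add: \<epsilon>_def field_simps)
  finally show False using ge by simp
qed

text \<open>Radii between exp (- B n_(j+1)) and exp (- B n_j) fall into two regimes. While r is at
  least exp (- \<mu> n_(j+1)), every coordinate looks uniform up to a loss in n_j, and r^d exp (C
  n_j) \<le> r^s. Below that, r = exp (- n_(j+1) L) with L > \<mu>; \<open>loc_exp_sum_ge\<close>
  yields the exponent \<open>m\<close>, and the margin (m - s) L pays for all losses.\<close>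

lemma hausdorff_measure_shrinking_pos:
  fixes \<beta> \<tau> \<sigma> :: "'d::finite \<Rightarrow> real" and a :: "'d torus"
  assumes \<beta>: "\<And>k. 1 < \<beta> k" and \<tau>: "\<And>k. 0 < \<tau> k" "\<And>k. \<tau> k < \<sigma> k"
    and S: "infinite S" and s: "0 < s" "s < m" and mcard: "m \<le> real CARD('d)"
    and m: "\<And>i. m * (ln (\<beta> i) + \<sigma> i) \<le> (\<Sum>k\<in>UNIV. loc_exp (\<beta> k) (\<sigma> k) (ln (\<beta> i) + \<sigma> i))"
    and W: "\<And>x. \<exists>\<^sub>\<infinity>n. n \<in> S \<and> (\<forall>k. dist_int ((beta_map (\<beta> k) ^^ n) (Rep_torus x $ k) - Rep_torus a $ k)
              \<le> exp (- real n * \<tau> k)) \<Longrightarrow> x \<in> W"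
  shows "hausdorff_measure s W \<noteq> 0"
proof -
  define d where "d = real CARD('d)"
  have d: "0 < d" "s < d" using s mcard by (auto simp: d_def)
  have lb: "0 < ln (\<beta> k)" for k using \<beta>[of k] by simp
  have \<sigma>: "0 < \<sigma> k" for k using \<tau>[of k] by linarith
  define c where "c k = 2 * ln (\<beta> k) + \<sigma> k" for k
  have c0: "0 < c k" for k using lb[of k] \<sigma>[of k] by (simp add: c_def)
  define C where "C = (\<Sum>k\<in>UNIV. c k)"
  have C0: "0 \<le> C" unfolding C_def using c0 by (intro sum_nonneg) (simp add: less_imp_le)
  \<comment> \<open>The summand \<open>C / (d - s)\<close> lets r^(d - s) outweigh exp (C n_j) as
    soon as r \<le> exp (- B n_j); the summand \<open>C\<close> dominates every
    \<open>c k\<close>.\<close>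
  define B where "B = C + C / (d - s)"
  have CB: "C \<le> B" using C0 d by (simp add: B_def)
  have cB: "c k \<le> B" for k
  proof -
    have "c k \<le> C" unfolding C_def using c0 by (intro member_le_sum) (auto simp: less_imp_le)
    then show ?thesis using CB by linarith
  qed
  have BC: "C \<le> B * (d - s)" using C0 d by (simp add: B_def distrib_right)
  \<comment> \<open>Half of the smallest \<open>ln (\<beta> k)\<close>: then
    \<open>(real n + 5) / \<beta> k ^ n\<close> is eventually below exp (- n \<mu>) in every
    coordinate.\<close>
  define \<mu> where "\<mu> = Min (range (\<lambda>k. ln (\<beta> k))) / 2"
  have \<mu>0: "0 < \<mu>" unfolding \<mu>_def using lb by (subst zero_less_divide_iff) (simp add: Min_gr_iff)
  have \<mu>: "2 * \<mu> \<le> ln (\<beta> k)" for k unfolding \<mu>_def by simp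
  \<comment> \<open>Each of the \<open>d\<close> coordinates loses a factor exp (n \<epsilon>); the
    total \<open>d * \<epsilon> = (m - s) * \<mu>\<close> is covered by the margin
    \<open>(m - s) * L\<close> when \<open>L > \<mu>\<close>.\<close>
  define \<epsilon> where "\<epsilon> = (m - s) * \<mu> / d"
  have \<epsilon>0: "0 < \<epsilon>" using s \<mu>0 d by (simp add: \<epsilon>_def)
  define step where "step i n \<longleftrightarrow> n \<in> S \<and> i < n \<and> (\<forall>k. good_step (\<beta> k) (Rep_torus a $ k) (\<tau> k) (\<sigma> k) B i n \<and>
      100 * \<beta> k * (real n + 5) * exp (B * real i) \<le> exp (real n * \<epsilon>) \<and>
      (real n + 5) / \<beta> k ^ n \<le> exp (- real n * \<mu>))" for i n
  have ex_step: "\<exists>n. step i n" for i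
  proof -
    have "\<forall>\<^sub>F n in sequentially. good_step (\<beta> k) (Rep_torus a $ k) (\<tau> k) (\<sigma> k) B i n \<and>
      100 * \<beta> k * (real n + 5) * exp (B * real i) \<le> exp (real n * \<epsilon>) \<and>
      (real n + 5) / \<beta> k ^ n \<le> exp (- real n * \<mu>)" for k
    proof (intro eventually_conj)
      show "\<forall>\<^sub>F n in sequentially. good_step (\<beta> k) (Rep_torus a $ k) (\<tau> k) (\<sigma> k) B i n"
        by (intro eventually_good_step \<beta> \<tau> Rep_torus_range)
      define E where "E = 100 * \<beta> k * exp (B * real i)"
      have "(\<lambda>n. E * (real n + 5) * exp (- real n * \<epsilon>)) \<longlonglongrightarrow> 0" using \<epsilon>0 by real_asymp
      then have "\<forall>\<^sub>F n in sequentially. E * (real n + 5) * exp (- real n * \<epsilon>) < 1"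
        by (intro order_tendstoD(2)) auto
      then show "\<forall>\<^sub>F n in sequentially. 100 * \<beta> k * (real n + 5) * exp (B * real i) \<le> exp (real n * \<epsilon>)"
      proof eventually_elim
        case (elim n)
        have "E * (real n + 5) * exp (- real n * \<epsilon>) * exp (real n * \<epsilon>) \<le> 1 * exp (real n * \<epsilon>)"
          using elim by (intro mult_right_mono) auto
        then show ?case by (simp add: E_def mult.assoc exp_add[symmetric]) (simp add: mult_ac)
      qed
      define h where "h = ln (\<beta> k) - \<mu>"
      have "h > 0" using \<mu>[of k] \<mu>0 by (simp add: h_def)
      then have "(\<lambda>n. (real n + 5) * exp (- real n * h)) \<longlonglongrightarrow> 0" by real_asymp
      then have "\<forall>\<^sub>F n in sequentially. (real n + 5) * exp (- real n * h) < 1"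
        by (intro order_tendstoD(2)) auto
      then show "\<forall>\<^sub>F n in sequentially. (real n + 5) / \<beta> k ^ n \<le> exp (- real n * \<mu>)"
      proof eventually_elim
        case (elim n)
        have "\<beta> k ^ n = exp (real n * ln (\<beta> k))" using \<beta>[of k] by (simp add: exp_of_nat_mult)
        then have "(real n + 5) / \<beta> k ^ n = ((real n + 5) * exp (- real n * h)) * exp (- real n * \<mu>)"
          by (simp add: h_def mult.assoc exp_add[symmetric] exp_minus[symmetric] divide_inverse algebra_simps)
        also have "\<dots> \<le> 1 * exp (- real n * \<mu>)" using elim by (intro mult_right_mono) auto
        finally show ?case by simp
      qed
    qed
    then have "\<forall>\<^sub>F n in sequentially. \<forall>k. good_step (\<beta> k) (Rep_torus a $ k) (\<tau> k) (\<sigma> k) B i n \<and>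
      100 * \<beta> k * (real n + 5) * exp (B * real i) \<le> exp (real n * \<epsilon>) \<and>
      (real n + 5) / \<beta> k ^ n \<le> exp (- real n * \<mu>)"
      by (rule eventually_all_finite)
    then obtain N where N: "\<And>n. n \<ge> N \<Longrightarrow> \<forall>k. good_step (\<beta> k) (Rep_torus a $ k) (\<tau> k) (\<sigma> k) B i n \<and>
      100 * \<beta> k * (real n + 5) * exp (B * real i) \<le> exp (real n * \<epsilon>) \<and>
      (real n + 5) / \<beta> k ^ n \<le> exp (- real n * \<mu>)"
      unfolding eventually_sequentially by blast
    obtain n where "n \<in> S" "n \<ge> max N (Suc i)" using S unfolding infinite_nat_iff_unbounded_le by blast
    then have "step i n" using N[of n] by (simp add: step_def)
    then show ?thesis by blast
  qed
  define n where "n = rec_nat 0 (\<lambda>_ i. SOME n. step i n)"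
  have n0: "n 0 = 0" by (simp add: n_def)
  have nstep: "step (n j) (n (Suc j))" for j using someI_ex[OF ex_step[of "n j"]] by (simp add: n_def)
  have nS: "n (Suc j) \<in> S" and nlt: "n j < n (Suc j)"
    and good: "good_step (\<beta> k) (Rep_torus a $ k) (\<tau> k) (\<sigma> k) B (n j) (n (Suc j))"
    and loss: "100 * \<beta> k * (real (n (Suc j)) + 5) * exp (B * real (n j)) \<le> exp (real (n (Suc j)) * \<epsilon>)"
    and scale: "(real (n (Suc j)) + 5) / \<beta> k ^ n (Suc j) \<le> exp (- real (n (Suc j)) * \<mu>)" for j k
    using nstep[of j] unfolding step_def by blast+
  have mono_n: "strict_mono n" using nlt by (simp add: strict_mono_Suc_iff)
  define p where "p k j = n j + target_depth (\<beta> k) (\<sigma> k) (n j)" for k j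
  define Q where "Q k A \<longleftrightarrow> (\<forall>j. finite (A j) \<and> A j \<noteq> {} \<and> A j \<subseteq> full_cyl (\<beta> k) (p k j)) \<and>
    (\<forall>j. \<forall>z\<in>A (Suc j). \<exists>u\<in>A j. u \<le> z \<and> z + 1 / \<beta> k ^ p k (Suc j) < u + 1 / \<beta> k ^ p k j) \<and>
    (\<forall>j. \<forall>z\<in>A (Suc j). \<forall>x. z \<le> x \<longrightarrow> x < z + 1 / \<beta> k ^ p k (Suc j) \<longrightarrow>
       \<bar>(beta_map (\<beta> k) ^^ n (Suc j)) x - Rep_torus a $ k\<bar> \<le> exp (- real (n (Suc j)) * \<tau> k)) \<and>
    (\<forall>j N x L. j + 2 \<le> N \<longrightarrow> exp (- B * real (n (Suc j))) \<le> exp (- real (n (Suc j)) * L) \<longrightarrow>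
       exp (- real (n (Suc j)) * L) \<le> exp (- B * real (n j)) \<longrightarrow>
       real (card (A N \<inter> {x..x + 2 * exp (- real (n (Suc j)) * L)})) \<le>
         100 * \<beta> k * (real (n (Suc j)) + 5) * exp (B * real (n j)) *
           exp (- real (n (Suc j)) * loc_exp (\<beta> k) (\<sigma> k) L) * real (card (A N))) \<and>
    (\<forall>j N x r. j + 2 \<le> N \<longrightarrow> (real (n (Suc j)) + 5) / \<beta> k ^ n (Suc j) \<le> r \<longrightarrow> r \<le> exp (- B * real (n j)) \<longrightarrow>
       real (card (A N \<inter> {x..x + 2 * r})) \<le> 60 * exp ((2 * ln (\<beta> k) + \<sigma> k) * real (n j)) * r * real (card (A N)))"
    for k A
  have "\<exists>A. Q k A" for k
    unfolding Q_def p_def using cB[of k] good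
    by (intro cantor_set_exists \<beta> \<tau> n0) (auto simp: c_def)
  then obtain A where A: "\<And>k. Q k (A k)" by metis
  note A' = A[unfolded Q_def]
  note A1 = A'[THEN conjunct1] and A2 = A'[THEN conjunct2, THEN conjunct1]
    and A3 = A'[THEN conjunct2, THEN conjunct2, THEN conjunct1]
    and A4 = A'[THEN conjunct2, THEN conjunct2, THEN conjunct2, THEN conjunct1]
    and A5 = A'[THEN conjunct2, THEN conjunct2, THEN conjunct2, THEN conjunct2]
  have Afin: "finite (A k N)" and Ane: "A k N \<noteq> {}" and Afull: "A k N \<subseteq> full_cyl (\<beta> k) (p k N)" for k N
    using A1[THEN spec, of k N] by simp_all
  have Anest: "\<exists>u\<in>A k N. u \<le> z \<and> z + 1 / \<beta> k ^ p k (Suc N) < u + 1 / \<beta> k ^ p k N"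
    if "z \<in> A k (Suc N)" for k N z
    by (rule A2[rule_format, OF that])
  have Atarget: "\<bar>(beta_map (\<beta> k) ^^ n (Suc j)) x - Rep_torus a $ k\<bar> \<le> exp (- real (n (Suc j)) * \<tau> k)"
    if "z \<in> A k (Suc j)" "z \<le> x" "x < z + 1 / \<beta> k ^ p k (Suc j)" for k j z x
    by (rule A3[rule_format, OF that])
  have Acount1: "real (card (A k N \<inter> {x..x + 2 * exp (- real (n (Suc j)) * L)})) \<le>
         100 * \<beta> k * (real (n (Suc j)) + 5) * exp (B * real (n j)) *
           exp (- real (n (Suc j)) * loc_exp (\<beta> k) (\<sigma> k) L) * real (card (A k N))"
    if "j + 2 \<le> N" "exp (- B * real (n (Suc j))) \<le> exp (- real (n (Suc j)) * L)"
       "exp (- real (n (Suc j)) * L) \<le> exp (- B * real (n j))" for j N x L k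
    by (rule A4[rule_format, OF that])
  have Acount2: "real (card (A k N \<inter> {x..x + 2 * r})) \<le> 60 * exp (c k * real (n j)) * r * real (card (A k N))"
    if "j + 2 \<le> N" "(real (n (Suc j)) + 5) / \<beta> k ^ n (Suc j) \<le> r" "r \<le> exp (- B * real (n j))" for j N x r k
    unfolding c_def by (rule A5[rule_format, OF that])
  show ?thesis
  proof (rule hausdorff_measure_product_cantor_pos[where A = A and g = "\<lambda>k N. 1 / \<beta> k ^ p k N" and C = "60 ^ CARD('d)"])
    show "0 < s" by (rule s)
    show "(1::real) \<le> 60 ^ CARD('d)" by (simp add: one_le_power)
    show "0 \<le> 1 / \<beta> k ^ p k N" for k N using \<beta>[of k] by simp
    show "finite (A k N)" "A k N \<noteq> {}" for k N by (rule Afin Ane)+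
    show "0 \<le> z \<and> z < 1 \<and> z + 1 / \<beta> k ^ p k N \<le> 1" if "z \<in> A k N" for k N z
    proof -
      have "0 \<le> z" "z + 1 / \<beta> k ^ p k N \<le> 1" using Afull[of k N] that by (auto simp: full_cyl_def)
      moreover have "0 < 1 / \<beta> k ^ p k N" using \<beta>[of k] by simp
      ultimately show ?thesis by linarith
    qed
    show "\<exists>u\<in>A k N. u \<le> z \<and> z + 1 / \<beta> k ^ p k (Suc N) < u + 1 / \<beta> k ^ p k N"
      if "z \<in> A k (Suc N)" for k N z using Anest[OF that] .
    show "x \<in> W" if x: "\<And>k N. \<exists>u\<in>A k N. u \<le> Rep_torus x $ k \<and> Rep_torus x $ k < u + 1 / \<beta> k ^ p k N" for x
    proof (rule W)
      have hit: "dist_int ((beta_map (\<beta> k) ^^ n (Suc j)) (Rep_torus x $ k) - Rep_torus a $ k)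
              \<le> exp (- real (n (Suc j)) * \<tau> k)" for k j
      proof -
        obtain u where "u \<in> A k (Suc j)" "u \<le> Rep_torus x $ k" "Rep_torus x $ k < u + 1 / \<beta> k ^ p k (Suc j)"
          using x by blast
        from Atarget[OF this] dist_int_le[of 0 "(beta_map (\<beta> k) ^^ n (Suc j)) (Rep_torus x $ k) - Rep_torus a $ k"]
        show ?thesis by simp
      qed
      show "\<exists>\<^sub>\<infinity>n. n \<in> S \<and> (\<forall>k. dist_int ((beta_map (\<beta> k) ^^ n) (Rep_torus x $ k) - Rep_torus a $ k)
              \<le> exp (- real n * \<tau> k))"
        unfolding INFM_nat_le
      proof
        fix M
        have "M \<le> n (Suc M)" using strict_mono_imp_increasing[OF mono_n, of "Suc M"] by simp
        then show "\<exists>n\<ge>M. n \<in> S \<and> (\<forall>k. dist_int ((beta_map (\<beta> k) ^^ n) (Rep_torus x $ k) - Rep_torus a $ k)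
              \<le> exp (- real n * \<tau> k))"
          using nS hit by blast
      qed
    qed
    show "\<exists>N0. \<forall>N\<ge>N0. \<forall>x. (\<Prod>k\<in>UNIV. real (card (A k N \<inter> {x k..x k + 2 * r}))) \<le>
        60 ^ CARD('d) * r powr s * (\<Prod>k\<in>UNIV. real (card (A k N)))" if r: "0 < r" "r \<le> 1" for r
    proof -
      have ex_i: "\<exists>i. exp (- B * real (n i)) \<le> r"
      proof (cases "B = 0")
        case True
        then have "c k = 0" for k using cB[of k] c0[of k] by linarith
        then show ?thesis using c0 by simp
      next
        case False
        then have B0: "0 < B" using CB C0 by linarith
        obtain i :: nat where "- ln r / B < real i" using reals_Archimedean2 by blast
        also have "real i \<le> real (n i)" using strict_mono_imp_increasing[OF mono_n, of i] by simp
        finally have "- ln r < real (n i) * B" by (simp only: pos_divide_less_eq[OF B0])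
        then have "- B * real (n i) \<le> ln r" by (simp add: mult.commute)
        then have "exp (- B * real (n i)) \<le> exp (ln r)" by simp
        then show ?thesis using r by auto
      qed
      define i where "i = (LEAST i. exp (- B * real (n i)) \<le> r)"
      have i: "exp (- B * real (n i)) \<le> r" unfolding i_def by (rule LeastI_ex[OF ex_i])
      have "\<exists>j. exp (- B * real (n (Suc j))) \<le> r \<and> r \<le> exp (- B * real (n j))"
      proof (cases i)
        case 0
        have "exp (- B * real (n (Suc 0))) \<le> exp (- B * real (n 0))"
          using CB C0 by (simp add: n0)
        then show ?thesis using i 0 r by (intro exI[of _ 0]) (auto simp: n0)
      next
        case (Suc j)
        have "\<not> exp (- B * real (n j)) \<le> r" using not_less_Least[of j "\<lambda>i. exp (- B * real (n i)) \<le> r"] Suc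
          by (simp add: i_def)
        then show ?thesis using i Suc by (intro exI[of _ j]) auto
      qed
      then obtain j where j: "exp (- B * real (n (Suc j))) \<le> r" "r \<le> exp (- B * real (n j))" by blast
      have "(\<Prod>k\<in>UNIV. real (card (A k N \<inter> {x k..x k + 2 * r}))) \<le>
        60 ^ CARD('d) * r powr s * (\<Prod>k\<in>UNIV. real (card (A k N)))" if N: "j + 2 \<le> N" for N x
      proof (cases "exp (- real (n (Suc j)) * \<mu>) \<le> r")
        case True
        have "(\<Prod>k\<in>UNIV. real (card (A k N \<inter> {x k..x k + 2 * r}))) \<le>
            (\<Prod>k\<in>UNIV. 60 * exp (c k * real (n j)) * r * real (card (A k N)))"
          using order_trans[OF scale True] by (intro prod_mono conjI Acount2 N j) auto
        also have "\<dots> = 60 ^ CARD('d) * (exp (C * real (n j)) * r ^ CARD('d)) * (\<Prod>k\<in>UNIV. real (card (A k N)))"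
          by (simp add: prod.distrib C_def sum_distrib_right exp_sum)
        also have "\<dots> \<le> 60 ^ CARD('d) * (r powr s) * (\<Prod>k\<in>UNIV. real (card (A k N)))"
        proof (intro mult_right_mono mult_left_mono)
          have "r powr (d - s) \<le> exp (- B * real (n j)) powr (d - s)"
            using j r d by (intro powr_mono2) auto
          also have "\<dots> = exp (- (B * (d - s)) * real (n j))" by (simp add: powr_def algebra_simps)
          also have "\<dots> \<le> exp (- C * real (n j))" using BC by (simp add: mult_right_mono)
          finally have le: "r powr (d - s) \<le> exp (- C * real (n j))" .
          have "r ^ CARD('d) = r powr d" using r by (simp add: d_def powr_realpow)
          also have "\<dots> = r powr (d - s) * r powr s" by (simp add: powr_add[symmetric])
          finally have "exp (C * real (n j)) * r ^ CARD('d) = exp (C * real (n j)) * r powr (d - s) * r powr s" by simp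
          also have "\<dots> \<le> exp (C * real (n j)) * exp (- C * real (n j)) * r powr s"
            using le by (intro mult_right_mono mult_left_mono) auto
          also have "\<dots> = r powr s" by (simp add: exp_add[symmetric])
          finally show "exp (C * real (n j)) * r ^ CARD('d) \<le> r powr s" .
        qed (auto intro: prod_nonneg)
        finally show ?thesis .
      next
        case False
        define M where "M = real (n (Suc j))"
        have M0: "0 < M" using nlt[of j] by (simp add: M_def)
        define L where "L = - ln r / M"
        have rL: "r = exp (- M * L)" using M0 r by (simp add: L_def)
        have L\<mu>: "\<mu> < L" using False M0 by (simp add: rL M_def[symmetric])
        have "(\<Prod>k\<in>UNIV. real (card (A k N \<inter> {x k..x k + 2 * r}))) \<le>
            (\<Prod>k\<in>UNIV. exp (M * \<epsilon>) * exp (- M * loc_exp (\<beta> k) (\<sigma> k) L) * real (card (A k N)))"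
        proof (intro prod_mono conjI)
          fix k
          have "real (card (A k N \<inter> {x k..x k + 2 * r})) \<le> 100 * \<beta> k * (M + 5) * exp (B * real (n j)) *
             exp (- M * loc_exp (\<beta> k) (\<sigma> k) L) * real (card (A k N))"
            unfolding rL M_def by (rule Acount1[OF N]) (use j in \<open>simp_all add: rL M_def\<close>)
          also have "\<dots> \<le> exp (M * \<epsilon>) * exp (- M * loc_exp (\<beta> k) (\<sigma> k) L) * real (card (A k N))"
            using loss[of k j] by (intro mult_right_mono) (auto simp: M_def)
          finally show "real (card (A k N \<inter> {x k..x k + 2 * r})) \<le>
            exp (M * \<epsilon>) * exp (- M * loc_exp (\<beta> k) (\<sigma> k) L) * real (card (A k N))" .
        qed simp
        also have "\<dots> = exp (M * (d * \<epsilon> - (\<Sum>k\<in>UNIV. loc_exp (\<beta> k) (\<sigma> k) L))) * (\<Prod>k\<in>UNIV. real (card (A k N)))"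
        proof -
          have P1: "(\<Prod>k\<in>(UNIV::'d set). exp (M * \<epsilon>)) = exp (M * (d * \<epsilon>))"
            by (simp add: d_def exp_of_nat_mult[symmetric] mult_ac)
          have P2: "(\<Prod>k\<in>UNIV. exp (- M * loc_exp (\<beta> k) (\<sigma> k) L)) = exp (- M * (\<Sum>k\<in>UNIV. loc_exp (\<beta> k) (\<sigma> k) L))"
            by (simp only: exp_sum[OF finite] sum_distrib_left)
          show ?thesis unfolding prod.distrib P1 P2
            by (simp add: exp_add[symmetric] right_diff_distrib)
        qed
        also have "\<dots> \<le> r powr s * (\<Prod>k\<in>UNIV. real (card (A k N)))"
        proof (intro mult_right_mono)
          have "m * L \<le> (\<Sum>k\<in>UNIV. loc_exp (\<beta> k) (\<sigma> k) L)"
            by (rule loc_exp_sum_ge[where \<beta> = \<beta> and t = \<sigma>, OF \<beta> _ m mcard])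
              (use \<sigma> \<mu>0 L\<mu> in \<open>simp_all add: less_imp_le\<close>)
          moreover have "d * \<epsilon> \<le> (m - s) * L" using d s L\<mu> by (simp add: \<epsilon>_def)
          ultimately have "d * \<epsilon> - (\<Sum>k\<in>UNIV. loc_exp (\<beta> k) (\<sigma> k) L) \<le> - L * s" by (simp add: algebra_simps)
          then have "M * (d * \<epsilon> - (\<Sum>k\<in>UNIV. loc_exp (\<beta> k) (\<sigma> k) L)) \<le> M * (- L * s)"
            using M0 by (intro mult_left_mono) auto
          then show "exp (M * (d * \<epsilon> - (\<Sum>k\<in>UNIV. loc_exp (\<beta> k) (\<sigma> k) L))) \<le> r powr s"
            by (simp add: rL powr_def algebra_simps)
        qed (auto intro: prod_nonneg)
        also have "\<dots> \<le> 60 ^ CARD('d) * r powr s * (\<Prod>k\<in>UNIV. real (card (A k N)))"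
          by (intro mult_right_mono mult_left_mono prod_nonneg) (auto simp: mult_le_cancel_right1 one_le_power)
        finally show ?thesis .
      qed
      then show ?thesis by blast
    qed
  qed
qed

section \<open>The upper bound\<close>

lemma target_box_cover:
  fixes \<beta> p :: "'d::finite \<Rightarrow> real" and a :: "'d torus"
  assumes \<beta>: "\<And>k. 1 < \<beta> k" and p: "\<And>k. 0 \<le> p k" and r: "0 < r" "r \<le> 1"
  shows "\<exists>\<U>. finite \<U> \<and>
    real (card \<U>) \<le> (\<Prod>k\<in>UNIV. 9 * (real n + 1) * min (1 / r) (max (\<beta> k ^ n) (p k / r))) \<and>
    (\<forall>U\<in>\<U>. bounded U \<and> diameter U \<le> real CARD('d) * r) \<and>
    {x. \<forall>k. dist_int ((beta_map (\<beta> k) ^^ n) (Rep_torus x $ k) - Rep_torus a $ k) \<le> p k} \<subseteq> \<Union>\<U>"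
proof -
  define b where "b k = 9 * (real n + 1) * min (1 / r) (max (\<beta> k ^ n) (p k / r))" for k
  define Y where "Y k = {x\<in>{0..<1}. dist_int ((beta_map (\<beta> k) ^^ n) x - Rep_torus a $ k) \<le> p k}" for k
  have "\<exists>C. finite C \<and> real (card C) \<le> b k \<and> Y k \<subseteq> (\<Union>c\<in>C. {c..c + r})" for k
    unfolding b_def Y_def by (rule target_preimage_cover[OF \<beta> r p Rep_torus_range])
  then obtain C where C: "\<And>k. finite (C k)" "\<And>k. real (card (C k)) \<le> b k"
    "\<And>k. Y k \<subseteq> (\<Union>c\<in>C k. {c..c + r})" by metis
  define X where "X c = {x :: 'd torus. \<forall>k. Rep_torus x $ k \<in> {c k..c k + r}}" for c
  define \<U> where "\<U> = X ` PiE UNIV C"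
  have "card \<U> \<le> card (PiE UNIV C)" unfolding \<U>_def by (intro card_image_le finite_PiE C) simp
  also have "\<dots> = (\<Prod>k\<in>UNIV. card (C k))" by (simp add: card_PiE)
  finally have "real (card \<U>) \<le> (\<Prod>k\<in>UNIV. real (card (C k)))" by (metis of_nat_le_iff of_nat_prod)
  also have "\<dots> \<le> (\<Prod>k\<in>UNIV. b k)" using C(2) by (intro prod_mono) auto
  finally have card: "real (card \<U>) \<le> (\<Prod>k\<in>UNIV. b k)" .
  have diam: "bounded (X c) \<and> diameter (X c) \<le> real CARD('d) * r" for c
  proof -
    have "dist x y \<le> real CARD('d) * r" if xy: "x \<in> X c" "y \<in> X c" for x y
    proof -
      have le: "dist_int (Rep_torus x $ k - Rep_torus y $ k) \<le> r" for k
      proof -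
        have "Rep_torus x $ k \<in> {c k..c k + r}" "Rep_torus y $ k \<in> {c k..c k + r}" using xy by (auto simp: X_def)
        then show ?thesis using dist_int_le[of 0 "Rep_torus x $ k - Rep_torus y $ k"] by auto
      qed
      have "dist x y \<le> (\<Sum>k\<in>UNIV. dist_int (Rep_torus x $ k - Rep_torus y $ k))"
        unfolding dist_torus_def by (rule L2_set_le_sum) simp
      also have "\<dots> \<le> (\<Sum>k\<in>(UNIV::'d set). r)" by (intro sum_mono le)
      finally show ?thesis by simp
    qed
    then show ?thesis using diameter_le_dist[of "real CARD('d) * r" "X c"] r by auto
  qed
  have cov: "{x. \<forall>k. dist_int ((beta_map (\<beta> k) ^^ n) (Rep_torus x $ k) - Rep_torus a $ k) \<le> p k} \<subseteq> \<Union>\<U>"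
  proof
    fix x assume x: "x \<in> {x. \<forall>k. dist_int ((beta_map (\<beta> k) ^^ n) (Rep_torus x $ k) - Rep_torus a $ k) \<le> p k}"
    have "\<exists>c\<in>C k. Rep_torus x $ k \<in> {c..c + r}" for k
    proof -
      have "Rep_torus x $ k \<in> Y k" using x Rep_torus_range[of x k] by (simp add: Y_def)
      then show ?thesis using C(3) by blast
    qed
    then obtain c where c: "\<And>k. c k \<in> C k" "\<And>k. Rep_torus x $ k \<in> {c k..c k + r}" by metis
    have "X c \<in> \<U>" unfolding \<U>_def using c(1) by (intro imageI PiE_I) auto
    moreover have "x \<in> X c" using c(2) by (simp add: X_def)
    ultimately show "x \<in> \<Union>\<U>" by blast
  qed
  have "finite \<U>" unfolding \<U>_def by (intro finite_imageI finite_PiE C) simp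
  then show ?thesis using card diam cov unfolding b_def
    by (intro exI[of _ \<U>] conjI) (auto simp: \<U>_def)
qed

lemma summable_power_times_exp:
  assumes h: "0 < h"
  shows "summable (\<lambda>n. (real n + 1) ^ D * exp (- real n * h))"
proof (rule summable_comparison_test_ev)
  define e where "e = real D + 1"
  have e: "e > 0" by (simp add: e_def)
  have "(\<lambda>n. (real n + 1) powr e * exp (- real n * (h / 2))) \<longlonglongrightarrow> 0" using h e by real_asymp
  then have "\<forall>\<^sub>F n in sequentially. (real n + 1) powr e * exp (- real n * (h / 2)) < 1"
    by (intro order_tendstoD(2)) auto
  then show "\<forall>\<^sub>F n in sequentially. norm ((real n + 1) ^ D * exp (- real n * h)) \<le> exp (- h / 2) ^ n"
  proof eventually_elim
    case (elim n)
    have "(real n + 1) ^ D = (real n + 1) powr real D" by (simp add: powr_realpow)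
    also have "\<dots> \<le> (real n + 1) powr e" by (intro powr_mono) (auto simp: e_def)
    finally have "(real n + 1) ^ D * exp (- real n * (h / 2)) \<le> 1"
      using elim by (smt (verit) exp_gt_zero mult_right_mono)
    then have "((real n + 1) ^ D * exp (- real n * (h / 2))) * exp (- real n * (h / 2)) \<le> 1 * exp (- real n * (h / 2))"
      by (intro mult_right_mono) auto
    then show ?case by (simp add: mult.assoc exp_add[symmetric] exp_of_nat_mult[symmetric] field_simps)
  qed
  show "summable (\<lambda>n. exp (- h / 2) ^ n)" using h by (intro summable_geometric) simp
qed

text \<open>The best scale \<open>I n\<close> may change with \<open>n\<close>, and the exponents
  \<open>t n\<close> need not converge. A uniform gap \<eta> and the uniform lower bound \<mu> on
  the scales suffice: the series of the covers is dominated by a polynomial times exp (- n \<eta>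
  \<mu>).\<close>

lemma hausdorff_measure_shrinking_zero:
  fixes \<beta> :: "'d::finite \<Rightarrow> real" and a :: "'d torus" and t :: "nat \<Rightarrow> 'd \<Rightarrow> real" and I :: "nat \<Rightarrow> 'd"
  assumes \<beta>: "\<And>k. 1 < \<beta> k" and t: "\<And>n k. 0 \<le> t n k" and s: "0 < s" and \<eta>: "0 < \<eta>"
    and L: "\<forall>\<^sub>F n in sequentially.
      (\<Sum>k\<in>UNIV. loc_exp (\<beta> k) (t n k) (ln (\<beta> (I n)) + t n (I n))) \<le> (s - \<eta>) * (ln (\<beta> (I n)) + t n (I n))"
    and W: "W \<subseteq> {x. \<exists>\<^sub>\<infinity>n. \<forall>k. dist_int ((beta_map (\<beta> k) ^^ n) (Rep_torus x $ k) - Rep_torus a $ k)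
              \<le> exp (- real n * t n k)}"
  shows "hausdorff_measure s W = 0"
proof -
  define d where "d = real CARD('d)"
  have d: "0 < d" by (simp add: d_def)
  define M where "M n = ln (\<beta> (I n)) + t n (I n)" for n
  define \<mu> where "\<mu> = Min (range (\<lambda>k. ln (\<beta> k)))"
  have lb: "0 < ln (\<beta> k)" for k using \<beta>[of k] by simp
  have \<mu>0: "0 < \<mu>" unfolding \<mu>_def using lb by (simp add: Min_gr_iff)
  have M: "\<mu> \<le> M n" for n
  proof -
    have "\<mu> \<le> ln (\<beta> (I n))" unfolding \<mu>_def by simp
    then show ?thesis using t[of n "I n"] by (simp add: M_def)
  qed
  define r where "r n = exp (- real n * M n)" for n
  have r: "0 < r n" "r n \<le> 1" "r n \<le> exp (- real n * \<mu>)" for n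
    using M[of n] \<mu>0 by (auto simp: r_def mult_left_mono mult_nonneg_nonneg)
  define Y where "Y n = {x. \<forall>k. dist_int ((beta_map (\<beta> k) ^^ n) (Rep_torus x $ k) - Rep_torus a $ k)
              \<le> exp (- real n * t n k)}" for n
  define Q where "Q n \<U> \<longleftrightarrow> finite \<U> \<and>
    real (card \<U>) \<le> (\<Prod>k\<in>UNIV. 9 * (real n + 1) * min (1 / r n) (max (\<beta> k ^ n) (exp (- real n * t n k) / r n))) \<and>
    (\<forall>U\<in>\<U>. bounded U \<and> diameter U \<le> d * r n) \<and> Y n \<subseteq> \<Union>\<U>" for n \<U>
  have "\<exists>\<U>. Q n \<U>" for n
    unfolding Q_def Y_def d_def by (rule target_box_cover) (use \<beta> r in simp_all)
  then obtain \<U> where "\<And>n. Q n (\<U> n)" by metis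
  note \<U>' = this[unfolded Q_def]
  note \<U> = \<U>'[THEN conjunct1] \<U>'[THEN conjunct2, THEN conjunct1]
    \<U>'[THEN conjunct2, THEN conjunct2, THEN conjunct1] \<U>'[THEN conjunct2, THEN conjunct2, THEN conjunct2]
  define G where "G n = (\<Sum>k\<in>UNIV. loc_exp (\<beta> k) (t n k) (M n))" for n
  have card: "real (card (\<U> n)) \<le> 9 ^ CARD('d) * (real n + 1) ^ CARD('d) * exp (real n * G n)" for n
  proof -
    have "real (card (\<U> n)) \<le> (\<Prod>k\<in>UNIV. 9 * (real n + 1) * exp (real n * loc_exp (\<beta> k) (t n k) (M n)))"
      using \<U>(2)[of n] unfolding exp_loc_exp[OF \<beta>] r_def by simp
    also have "\<dots> = 9 ^ CARD('d) * (real n + 1) ^ CARD('d) * exp (real n * G n)"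
      by (simp only: prod.distrib prod_constant G_def sum_distrib_left exp_sum[OF finite])
    finally show ?thesis .
  qed
  show ?thesis
  proof (rule hausdorff_measure_limsup_zero[where \<U> = \<U> and \<rho> = "\<lambda>n. d * r n"])
    show "0 < s" by (rule s)
    show "finite (\<U> n)" for n by (rule \<U>)
    show "bounded U \<and> diameter U \<le> d * r n" if "U \<in> \<U> n" for n U using \<U>(3) that by blast
    show "0 \<le> d * r n" for n using d r(1)[of n] by simp
    show "W \<subseteq> {x. \<exists>\<^sub>\<infinity>n. x \<in> \<Union>(\<U> n)}"
    proof
      fix x assume "x \<in> W"
      then have "\<exists>\<^sub>\<infinity>n. x \<in> Y n" using W by (auto simp: Y_def)
      then have "\<exists>\<^sub>\<infinity>n. x \<in> \<Union>(\<U> n)" by (rule INFM_mono) (use \<U>(4) in blast)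
      then show "x \<in> {x. \<exists>\<^sub>\<infinity>n. x \<in> \<Union>(\<U> n)}" by simp
    qed
    have lim: "(\<lambda>n. d * exp (- real n * \<mu>)) \<longlonglongrightarrow> 0" using \<mu>0 by real_asymp
    show "(\<lambda>n. d * r n) \<longlonglongrightarrow> 0"
      by (rule tendsto_sandwich[OF _ _ tendsto_const lim])
        (use d r in \<open>auto intro!: always_eventually mult_left_mono simp: less_imp_le\<close>)
    define K where "K = 9 ^ CARD('d) * d powr s"
    show "summable (\<lambda>n. real (card (\<U> n)) * (d * r n) powr s)"
    proof (rule summable_comparison_test_ev)
      show "summable (\<lambda>n. K * ((real n + 1) ^ CARD('d) * exp (- real n * (\<eta> * \<mu>))))"
        using \<eta> \<mu>0 by (intro summable_mult summable_power_times_exp) simp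
      show "\<forall>\<^sub>F n in sequentially. norm (real (card (\<U> n)) * (d * r n) powr s) \<le>
          K * ((real n + 1) ^ CARD('d) * exp (- real n * (\<eta> * \<mu>)))"
        using L
      proof eventually_elim
        case (elim n)
        then have G: "G n \<le> (s - \<eta>) * M n" by (simp add: G_def M_def)
        have "r n powr s = exp (- real n * M n * s)" by (simp add: r_def powr_def)
        then have "(d * r n) powr s = d powr s * exp (- real n * M n * s)"
          using d r(1)[of n] by (simp add: powr_mult)
        then have "real (card (\<U> n)) * (d * r n) powr s \<le>
            (9 ^ CARD('d) * (real n + 1) ^ CARD('d) * exp (real n * G n)) * (d powr s * exp (- real n * M n * s))"
          using card[of n] by (simp add: mult_right_mono)
        also have "\<dots> = K * ((real n + 1) ^ CARD('d) * exp (real n * (G n - s * M n)))"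
          by (simp add: K_def exp_diff exp_minus field_simps)
        also have "\<dots> \<le> K * ((real n + 1) ^ CARD('d) * exp (- real n * (\<eta> * \<mu>)))"
        proof (intro mult_left_mono)
          have "\<eta> * \<mu> \<le> \<eta> * M n" using M \<eta> by (intro mult_left_mono) auto
          then have "G n - s * M n \<le> - (\<eta> * \<mu>)" using G by (simp add: algebra_simps)
          then have "real n * (G n - s * M n) \<le> real n * (- (\<eta> * \<mu>))" by (intro mult_left_mono) auto
          then show "exp (real n * (G n - s * M n)) \<le> exp (- real n * (\<eta> * \<mu>))" by simp
        qed (auto simp: K_def)
        finally show ?case by simp
      qed
    qed
  qed
qed

section \<open>The dimension formula\<close>

text \<open>Powers of the diameter decrease in the exponent only for diameters at most 1, hence the
  passage to \<open>min \<delta> 1\<close>. For \<open>s' = 0\<close> the convention in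
  \<open>diam_power\<close> gives the same comparison.\<close>

lemma hausdorff_measure_antimono:
  fixes W :: "'a::metric_space set"
  assumes s: "0 \<le> s'" "s' < s"
  shows "hausdorff_measure s W \<le> hausdorff_measure s' W"
  unfolding hausdorff_measure_def
proof (rule SUP_least)
  fix \<delta> :: real assume "\<delta> \<in> {0<..}"
  then have \<delta>: "0 < min \<delta> 1" by simp
  have "hausdorff_premeasure s \<delta> W \<le> hausdorff_premeasure s' (min \<delta> 1) W"
    unfolding hausdorff_premeasure_def
  proof (rule INF_greatest)
    fix U :: "nat \<Rightarrow> 'a set"
    assume U: "U \<in> {U. W \<subseteq> (\<Union>n. U n) \<and> (\<forall>n. bounded (U n) \<and> diameter (U n) \<le> min \<delta> 1)}"
    have le: "diam_power s (U n) \<le> diam_power s' (U n)" for n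
    proof -
      have "0 \<le> diameter (U n)" "diameter (U n) \<le> 1" using U by (auto intro: diameter_ge_0)
      then have "diameter (U n) powr s \<le> diameter (U n) powr s'" "diameter (U n) powr s \<le> 1"
        using s by (auto intro: powr_mono' powr_le1)
      then show ?thesis using s by (simp add: diam_power_def)
    qed
    have "(INF U \<in> {U :: nat \<Rightarrow> 'a set. W \<subseteq> (\<Union>n. U n) \<and> (\<forall>n. bounded (U n) \<and> diameter (U n) \<le> \<delta>)}.
        \<Sum>n. ennreal (diam_power s (U n))) \<le> (\<Sum>n. ennreal (diam_power s (U n)))"
      using U by (intro INF_lower) auto
    also have "\<dots> \<le> (\<Sum>n. ennreal (diam_power s' (U n)))"
      by (intro suminf_le ennreal_leI le) auto
    finally show "(INF U \<in> {U :: nat \<Rightarrow> 'a set. W \<subseteq> (\<Union>n. U n) \<and> (\<forall>n. bounded (U n) \<and> diameter (U n) \<le> \<delta>)}.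
        \<Sum>n. ennreal (diam_power s (U n))) \<le> (\<Sum>n. ennreal (diam_power s' (U n)))" .
  qed
  also have "\<dots> \<le> (SUP \<delta>\<in>{0<..}. hausdorff_premeasure s' \<delta> W)" using \<delta> by (intro SUP_upper) simp
  finally show "hausdorff_premeasure s \<delta> W \<le> (SUP \<delta>\<in>{0<..}. hausdorff_premeasure s' \<delta> W)" .
qed

text \<open>Sequential compactness of the extended reals is applied to one coordinate after another,
  along successive subsequences.\<close>

lemma accumulation_point_along_infinite_set:
  fixes X :: "nat \<Rightarrow> ereal ^ 'd::finite"
  assumes I: "infinite I"
  shows "\<exists>r l. strict_mono r \<and> (\<forall>j. r j \<in> I) \<and> (\<forall>k. (\<lambda>j. X (r j) $ k) \<longlonglongrightarrow> l $ k) \<and> l \<in> accumulation_points X"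
proof -
  have "\<exists>r l. strict_mono r \<and> (\<forall>j. r j \<in> I) \<and> (\<forall>k\<in>D. (\<lambda>j. X (r j) $ k) \<longlonglongrightarrow> l k)" if "finite D" for D
    using that
  proof induction
    case empty
    show ?case using strict_mono_enumerate[OF I] enumerate_in_set[OF I] by blast
  next
    case (insert k D)
    then obtain r l where r: "strict_mono r" "\<And>j. r j \<in> I" "\<forall>k\<in>D. (\<lambda>j. X (r j) $ k) \<longlonglongrightarrow> l k" by blast
    obtain l' r' where r': "strict_mono r'" "((\<lambda>j. X (r j) $ k) \<circ> r') \<longlonglongrightarrow> l'"
      using compact_complete_linorder[of "\<lambda>j. X (r j) $ k"] by blast
    have lim: "(\<lambda>j. X ((r \<circ> r') j) $ i) \<longlonglongrightarrow> (l(k := l')) i" if "i \<in> insert k D" for i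
    proof (cases "i = k")
      case True
      then show ?thesis using r'(2) by (simp add: comp_def)
    next
      case False
      then have "(\<lambda>j. X (r j) $ i) \<longlonglongrightarrow> l i" using r(3) that by blast
      from LIMSEQ_subseq_LIMSEQ[OF this r'(1)] show ?thesis using False by (simp add: comp_def)
    qed
    show ?case
    proof (intro exI conjI allI ballI)
      show "strict_mono (r \<circ> r')" by (rule strict_mono_o[OF r(1) r'(1)])
      show "(r \<circ> r') j \<in> I" for j using r(2) by simp
    qed (rule lim)
  qed
  from this[OF finite, of UNIV] obtain r l where
    r: "strict_mono r" "\<And>j. r j \<in> I" "\<And>k. (\<lambda>j. X (r j) $ k) \<longlonglongrightarrow> l k" by blast
  have lim: "(\<lambda>j. X (r j)) \<longlonglongrightarrow> vec_lambda l" using r(3) by (intro vec_tendstoI) simp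
  have "vec_lambda l \<in> accumulation_points X"
    unfolding accumulation_points_def
  proof (intro CollectI allI impI)
    fix S assume "open S" "vec_lambda l \<in> S"
    then have "\<forall>\<^sub>F j in sequentially. X (r j) \<in> S" using topological_tendstoD[OF lim] by blast
    then obtain N where N: "\<And>j. j \<ge> N \<Longrightarrow> X (r j) \<in> S" by (auto simp: eventually_sequentially)
    show "\<exists>\<^sub>\<infinity>n. X n \<in> S" unfolding INFM_nat_le
    proof
      fix m
      have "m \<le> max m N" by simp
      also have "\<dots> \<le> r (max m N)" by (rule strict_mono_imp_increasing[OF r(1)])
      finally show "\<exists>n\<ge>m. X n \<in> S" using N[of "max m N"] by auto
    qed
  qed
  then show ?thesis using r by (intro exI[of _ r] exI[of _ "vec_lambda l"]) auto
qed

lemma Rep_torus_map_funpow: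
  assumes "\<And>i j. T $ i $ j = (if i = j then \<beta> i else 0)"
  shows "Rep_torus ((torus_map T ^^ n) x) $ k = (beta_map (\<beta> k) ^^ n) (Rep_torus x $ k)"
proof (induction n)
  case (Suc n)
  have "(T *v v) $ k = \<beta> k * v $ k" for v
  proof -
    have "(T *v v) $ k = (\<Sum>j\<in>UNIV. if k = j then \<beta> k * v $ j else 0)"
      unfolding matrix_vector_mult_def by (simp add: assms if_distrib[of "\<lambda>x. x * _"] cong: if_cong)
    also have "\<dots> = \<beta> k * v $ k" by simp
    finally show ?thesis .
  qed
  then show ?case using Suc by (simp add: torus_map_def Rep_torus_of beta_map_def)
qed simp

theorem theorem12:
  fixes T :: "real ^ ('d::{finite,linorder}) ^ ('d::{finite,linorder})"
    and \<beta> :: "'d \<Rightarrow> real"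
    and \<psi> :: "'d \<Rightarrow> real \<Rightarrow> real"
    and a :: "'d torus"
  assumes "invertible T"
    and "\<forall>i j. T $ i $ j = (if i = j then \<beta> i else 0)"
    and "\<forall>i. 1 < \<beta> i"
    and "mono \<beta>"
    and "\<forall>i. \<forall>x>0. 0 < \<psi> i x"
    and "\<forall>t\<in>exponent_set \<psi>. \<forall>i. 0 \<le> t $ i"
    and "\<exists>B. bounded B \<and> exponent_set \<psi> = ereal_vec ` B"
  shows "hausdorff_dim (shrinking_target_set T \<psi> a) =
           (SUP t \<in> {t. ereal_vec t \<in> exponent_set \<psi>}. ereal (MIN i. theta \<beta> t i))"
proof -
  have \<beta>: "\<And>k. 1 < \<beta> k" using assms(3) by blast
  have \<psi>0: "0 < \<psi> k (real n)" if "0 < n" for k and n :: nat using assms(5) that by simp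
  define W where "W = shrinking_target_set T \<psi> a"
  have W_iff: "x \<in> W \<longleftrightarrow> (\<exists>\<^sub>\<infinity>n. \<forall>k. dist_int ((beta_map (\<beta> k) ^^ n) (Rep_torus x $ k) - Rep_torus a $ k)
      \<le> \<psi> k (real n))" for x
    using assms(2) by (simp add: W_def shrinking_target_set_def target_rect_def Rep_torus_map_funpow[of T \<beta>])
  define u where "u n = (\<chi> k. - ln (\<psi> k (real n)) / real n)" for n :: nat
  define E where "E = exponent_set \<psi>"
  have E: "E = accumulation_points (\<lambda>n. ereal_vec (u n))" by (simp add: E_def exponent_set_def u_def)
  define \<T> where "\<T> = {t. ereal_vec t \<in> E}"
  have \<T>0: "0 \<le> t $ k" if "t \<in> \<T>" for t k
    using assms(6) that by (auto simp: \<T>_def E_def ereal_vec_def)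
  define \<theta> where "\<theta> t = (MIN i. theta \<beta> t i)" for t
  define S where "S = (SUP t\<in>\<T>. ereal (\<theta> t))"
  have subseq: "\<exists>r t. strict_mono r \<and> (\<forall>j. r j \<in> I) \<and> t \<in> \<T> \<and> (\<forall>k. (\<lambda>j. u (r j) $ k) \<longlonglongrightarrow> t $ k)"
    if I: "infinite I" for I
  proof -
    obtain r l where r: "strict_mono r" "\<forall>j. r j \<in> I" "\<And>k. (\<lambda>j. ereal_vec (u (r j)) $ k) \<longlonglongrightarrow> l $ k" "l \<in> E"
      using accumulation_point_along_infinite_set[OF I, of "\<lambda>n. ereal_vec (u n)"] unfolding E by blast
    \<comment> \<open>Boundedness of the exponent set enters here: the limit has finite
      coordinates.\<close>
    obtain t where t: "l = ereal_vec t" using r(4) assms(7) by (auto simp: E_def)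
    have "(\<lambda>j. u (r j) $ k) \<longlonglongrightarrow> t $ k" for k
      using r(3)[of k] unfolding t ereal_vec_def by simp
    moreover have "t \<in> \<T>" using r(4) t by (simp add: \<T>_def)
    ultimately show ?thesis using r(1,2) by blast
  qed
  have \<theta>_less: "x < \<theta> t \<longleftrightarrow> (\<forall>i. x < theta \<beta> t i)" and \<theta>_le: "x \<le> \<theta> t \<longleftrightarrow> (\<forall>i. x \<le> theta \<beta> t i)" for x t
    unfolding \<theta>_def by (simp_all add: Min_gr_iff)
  obtain t0 where t0: "t0 \<in> \<T>" using subseq[of UNIV] by auto
  \<comment> \<open>This keeps the exponents between \<open>S\<close> and \<open>s\<close> positive,
    as the covering lemma requires.\<close>
  have S0: "0 < S"
  proof -
    have "0 < \<theta> t0" unfolding \<theta>_less using theta_pos[where \<beta> = \<beta>, OF \<beta> \<T>0[OF t0]] by blast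
    then have "0 < ereal (\<theta> t0)" by simp
    also have "\<dots> \<le> S" unfolding S_def using t0 by (rule SUP_upper)
    finally show ?thesis .
  qed
  have "hausdorff_dim W \<le> S"
  proof (rule dense_ge)
    fix y assume y: "S < y"
    show "hausdorff_dim W \<le> y"
    proof (cases y)
      case (real s)
      obtain s1' where s1': "S < s1'" "s1' < y" using dense[OF y] by blast
      then obtain s1 where s1: "s1' = ereal s1" using S0 real by (cases s1') auto
      have "0 < ereal s1" using S0 s1'(1) unfolding s1 by (rule less_trans)
      then have s1s: "0 < s1" "s1 < s" using s1' s1 real by auto
      \<comment> \<open>Accumulation points are nonnegative, so cutting off negative exponents
        changes no limit along the chosen subsequences; it gives the nonnegativity that
        \<open>theta_eq\<close> needs at every \<open>n\<close>.\<close>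
      define t where "t n = (\<chi> k. max 0 (u n $ k))" for n
      have t0: "0 \<le> t n $ k" for n k by (simp add: t_def)
      \<comment> \<open>Infinitely many such times would have, by compactness and continuity of
        \<open>theta\<close>, an accumulation point \<open>v\<close> with
        \<open>\<theta> v \<ge> s1 > S\<close>.\<close>
      have "finite {n. s1 \<le> \<theta> (t n)}"
      proof (rule ccontr)
        assume "infinite {n. s1 \<le> \<theta> (t n)}"
        from subseq[OF this] obtain r v where r: "\<And>j. s1 \<le> \<theta> (t (r j))" "v \<in> \<T>"
          "\<And>k. (\<lambda>j. u (r j) $ k) \<longlonglongrightarrow> v $ k" by auto
        have "(\<lambda>j. t (r j) $ k) \<longlonglongrightarrow> v $ k" for k
        proof -
          have "(\<lambda>j. max 0 (u (r j) $ k)) \<longlonglongrightarrow> max 0 (v $ k)" by (intro tendsto_max tendsto_const r)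
          then show ?thesis using \<T>0[OF r(2), of k] by (simp add: t_def)
        qed
        then have "(\<lambda>j. theta \<beta> (t (r j)) i) \<longlonglongrightarrow> theta \<beta> v i" for i
          by (intro tendsto_theta \<beta> \<T>0[OF r(2)] t0)
        then have "s1 \<le> theta \<beta> v i" for i
          by (rule LIMSEQ_le_const) (use r(1) \<theta>_le in blast)
        then have "s1 \<le> \<theta> v" using \<theta>_le by blast
        then have "ereal s1 \<le> S" unfolding S_def using r(2) by (intro SUP_upper2[of v]) auto
        then show False using s1' s1 by simp
      qed
      then have "\<forall>\<^sub>F n in cofinite. \<not> s1 \<le> \<theta> (t n)" by (simp add: eventually_cofinite)
      then have ev: "\<forall>\<^sub>F n in sequentially. \<exists>i. theta \<beta> (t n) i < s1"
        unfolding \<theta>_le cofinite_eq_sequentially by (simp add: not_le)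
      define I where "I n = (SOME i. theta \<beta> (t n) i < s1)" for n
      have "hausdorff_measure s W = 0"
      proof (rule hausdorff_measure_shrinking_zero[where \<beta> = \<beta> and a = a and t = "\<lambda>n k. t n $ k" and I = I and \<eta> = "s - s1", OF \<beta>])
        show "0 \<le> t n $ k" for n k by (rule t0)
        show "0 < s" "0 < s - s1" using s1s by auto
        show "\<forall>\<^sub>F n in sequentially. (\<Sum>k\<in>UNIV. loc_exp (\<beta> k) (t n $ k) (ln (\<beta> (I n)) + t n $ I n))
            \<le> (s - (s - s1)) * (ln (\<beta> (I n)) + t n $ I n)"
          using ev
        proof eventually_elim
          case (elim n)
          then have "theta \<beta> (t n) (I n) < s1" unfolding I_def by (rule someI_ex)
          moreover have "0 < ln (\<beta> (I n)) + t n $ I n" using \<beta>[of "I n"] t0[of n "I n"] by (simp add: add_pos_nonneg)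
          ultimately show ?case unfolding theta_eq[where \<beta> = \<beta>, OF \<beta> t0] by (simp add: divide_less_eq)
        qed
        show "W \<subseteq> {x. \<exists>\<^sub>\<infinity>n. \<forall>k. dist_int ((beta_map (\<beta> k) ^^ n) (Rep_torus x $ k) - Rep_torus a $ k)
              \<le> exp (- real n * t n $ k)}"
        proof
          fix x assume "x \<in> W"
          then have "\<exists>\<^sub>\<infinity>n. \<forall>k. dist_int ((beta_map (\<beta> k) ^^ n) (Rep_torus x $ k) - Rep_torus a $ k) \<le> \<psi> k (real n)"
            by (simp add: W_iff)
          then have "\<exists>\<^sub>\<infinity>n. \<forall>k. dist_int ((beta_map (\<beta> k) ^^ n) (Rep_torus x $ k) - Rep_torus a $ k)
              \<le> exp (- real n * t n $ k)"
          proof (rule INFM_mono, intro allI)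
            fix n k assume le: "\<forall>k. dist_int ((beta_map (\<beta> k) ^^ n) (Rep_torus x $ k) - Rep_torus a $ k) \<le> \<psi> k (real n)"
            show "dist_int ((beta_map (\<beta> k) ^^ n) (Rep_torus x $ k) - Rep_torus a $ k) \<le> exp (- real n * t n $ k)"
            proof (cases "n = 0 \<or> u n $ k \<le> 0")
              \<comment> \<open>With the cut-off active, or at time 0, the condition is void:
                distances to the integers are at most 1.\<close>
              case True
              then have "exp (- real n * t n $ k) = 1" by (auto simp: t_def)
              then show ?thesis by (simp only: dist_int_le_1)
            next
              case False
              then have "- real n * t n $ k = ln (\<psi> k (real n))" by (simp add: t_def u_def)
              then show ?thesis using le \<psi>0[of n k] False by simp
            qed
          qed
          then show "x \<in> {x. \<exists>\<^sub>\<infinity>n. \<forall>k. dist_int ((beta_map (\<beta> k) ^^ n) (Rep_torus x $ k) - Rep_torus a $ k)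
              \<le> exp (- real n * t n $ k)}" by simp
        qed
      qed
      then show ?thesis unfolding hausdorff_dim_def real using s1s by (intro INF_lower) auto
    next
      case MInf
      then show ?thesis using y by simp
    qed simp
  qed
  moreover have "S \<le> hausdorff_dim W"
    unfolding S_def hausdorff_dim_def
  proof (intro SUP_least INF_greatest)
    fix t s' assume t: "t \<in> \<T>" and s': "s' \<in> {s. 0 \<le> s \<and> hausdorff_measure s W = 0}"
    show "ereal (\<theta> t) \<le> ereal s'"
    proof (rule ccontr)
      assume "\<not> ereal (\<theta> t) \<le> ereal s'"
      then have "s' < \<theta> t" by simp
      then obtain s where s: "s' < s" "s < \<theta> t" using dense by blast
      then obtain m where m: "s < m" "m < \<theta> t" using dense by blast
      \<comment> \<open>The absolute value is there because \<open>tendsto_theta\<close> asks for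
        nonnegative coordinates at every \<open>e\<close>, not only near 0 from the right.\<close>
      have lim: "((\<lambda>e. theta \<beta> (\<chi> k. t $ k + 2 * \<bar>e\<bar>) i) \<longlongrightarrow> theta \<beta> t i) (at_right 0)" for i
        by (intro tendsto_theta \<beta> \<T>0[OF t]) (auto intro!: tendsto_eq_intros add_nonneg_nonneg \<T>0[OF t])
      have "\<forall>\<^sub>F e in at_right 0. m < theta \<beta> (\<chi> k. t $ k + 2 * \<bar>e\<bar>) i" for i
        using lim by (rule order_tendstoD) (use m \<theta>_less in blast)
      then have "\<forall>\<^sub>F e in at_right 0. \<forall>i. m < theta \<beta> (\<chi> k. t $ k + 2 * \<bar>e\<bar>) i"
        by (rule eventually_all_finite)
      then have "\<forall>\<^sub>F e in at_right 0. (\<forall>i. m < theta \<beta> (\<chi> k. t $ k + 2 * \<bar>e\<bar>) i) \<and> (0::real) < e"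
        using eventually_at_right_less[of "0::real"] by (rule eventually_conj)
      then obtain e :: real where e: "\<And>i. m < theta \<beta> (\<chi> k. t $ k + 2 * \<bar>e\<bar>) i" "0 < e"
        using eventually_happens'[OF trivial_limit_at_right_real] by blast
      \<comment> \<open>Of the two increments \<open>e\<close>, the first makes the given targets
        contain those of exponent \<tau> infinitely often, since \<open>t\<close> is an accumulation
        point; the second is the room for full cylinders.\<close>
      define \<sigma> where "\<sigma> = (\<chi> k. t $ k + 2 * e)"
      define \<tau> where "\<tau> k = t $ k + e" for k
      have \<sigma>0: "0 \<le> \<sigma> $ k" for k using \<T>0[OF t, of k] e(2) by (simp add: \<sigma>_def)
      have m\<sigma>: "m < theta \<beta> \<sigma> i" for i using e by (simp add: \<sigma>_def)
      define J where "J = {n. \<forall>k. exp (- real n * \<tau> k) \<le> \<psi> k (real n)}"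
      have "infinite J"
      proof -
        have "open {x. \<forall>k. x $ k < ereal (\<tau> k)}"
        proof -
          have "{x. \<forall>k. x $ k < ereal (\<tau> k)} = (\<Inter>k. (\<lambda>x. x $ k) -` {..<ereal (\<tau> k)})" by auto
          also have "open \<dots>" by (intro open_INT ballI open_vimage_vec_nth) auto
          finally show ?thesis .
        qed
        moreover have "ereal_vec t \<in> {x. \<forall>k. x $ k < ereal (\<tau> k)}" using e(2) by (simp add: ereal_vec_def \<tau>_def)
        moreover have "ereal_vec t \<in> accumulation_points (\<lambda>n. ereal_vec (u n))" using t by (simp add: \<T>_def E)
        ultimately have "\<exists>\<^sub>\<infinity>n. ereal_vec (u n) \<in> {x. \<forall>k. x $ k < ereal (\<tau> k)}"
          unfolding accumulation_points_def by blast
        then have "\<exists>\<^sub>\<infinity>n. (\<forall>k. u n $ k < \<tau> k) \<and> 0 < n"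
          by (intro INFM_conjI) (auto simp: ereal_vec_def MOST_nat)
        then have "\<exists>\<^sub>\<infinity>n. n \<in> J"
        proof (rule INFM_mono)
          fix n assume n: "(\<forall>k. u n $ k < \<tau> k) \<and> 0 < n"
          have "exp (- real n * \<tau> k) \<le> \<psi> k (real n)" for k
          proof -
            have "- ln (\<psi> k (real n)) / real n < \<tau> k" using n by (simp add: u_def)
            then have "- ln (\<psi> k (real n)) < \<tau> k * real n" using n by (subst (asm) pos_divide_less_eq) auto
            then have "- real n * \<tau> k \<le> ln (\<psi> k (real n))" by (simp add: mult.commute)
            then have "exp (- real n * \<tau> k) \<le> exp (ln (\<psi> k (real n)))" by simp
            then show ?thesis using \<psi>0 n by simp
          qed
          then show "n \<in> J" by (simp add: J_def)
        qed
        then show ?thesis by (simp add: frequently_cofinite)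
      qed
      have "hausdorff_measure s W \<noteq> 0"
      proof (rule hausdorff_measure_shrinking_pos[where \<beta> = \<beta> and \<tau> = \<tau> and \<sigma> = "\<lambda>k. \<sigma> $ k" and S = J and m = m and a = a, OF \<beta>])
        show "0 < \<tau> k" "\<tau> k < \<sigma> $ k" for k using \<T>0[OF t, of k] e(2) by (simp_all add: \<tau>_def \<sigma>_def)
        show "infinite J" by fact
        show "0 < s" "s < m" using s' s m by auto
        show "m \<le> real CARD('d)" using m\<sigma> theta_le_card[where \<beta> = \<beta>, OF \<beta> \<sigma>0] by (meson less_imp_le order_trans)
        show "m * (ln (\<beta> i) + \<sigma> $ i) \<le> (\<Sum>k\<in>UNIV. loc_exp (\<beta> k) (\<sigma> $ k) (ln (\<beta> i) + \<sigma> $ i))" for i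
        proof -
          have "0 < ln (\<beta> i) + \<sigma> $ i" using \<beta>[of i] \<sigma>0[of i] by (simp add: add_pos_nonneg)
          then show ?thesis using m\<sigma>[of i] unfolding theta_eq[where \<beta> = \<beta>, OF \<beta> \<sigma>0] by (simp add: less_divide_eq less_imp_le)
        qed
        fix x assume "\<exists>\<^sub>\<infinity>n. n \<in> J \<and> (\<forall>k. dist_int ((beta_map (\<beta> k) ^^ n) (Rep_torus x $ k) - Rep_torus a $ k)
              \<le> exp (- real n * \<tau> k))"
        then show "x \<in> W" unfolding W_iff
          by (rule INFM_mono) (auto simp: J_def intro: order_trans)
      qed
      moreover have "hausdorff_measure s W \<le> hausdorff_measure s' W"
        using s' s by (intro hausdorff_measure_antimono) auto
      ultimately show False using s' by simp
    qed
  qed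
  ultimately show ?thesis unfolding W_def S_def \<T>_def \<theta>_def E_def by (rule antisym)
qed

end
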